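(* Let $k\ge 1$ be an integer. Under the equivalence between the category of points of the simplicial topos $\hat\Delta$ and the category of intervals, the action on points of $\hat\Delta$ of the geometric morphism $\hat\Delta\to\hat\Delta$ associated to the barycentric subdivision functor $\mathrm{Sd}_k:\Delta\to\Delta$ is described by the endofunctor $\mathrm{Sd}_k^*$ of the category of intervals.
   Context: $\Delta$ is the simplicial category: objects $[n]=\{0,\dots,n\}$, $n\ge0$, morphisms the non-decreasing maps. $\hat\Delta$ is the topos of contravariant functors $\Delta\to\mathrm{Sets}$. An interval $I$ is a totally ordered set with a smallest element $b_I$ and a largest element $t_I\ne b_I$; morphisms of intervals are non-decreasing maps preserving $b$ and $t$. For $n\ge 0$ let $n^*=\{0,\dots,n+1\}$; $\Delta^{\rm op}$ is identified with the category of the finite intervals $n^*$ via $[n]\mapsto n^*$ and $f\mapsto f^*$, where for $f\in\mathrm{Hom}_\Delta([n],[m])$ the map $f^*:m^*\to n^*$ is determined by $f^{-1}(\{x\in[m]: x\ge j\})=\{x\in[n]:x\ge f^*(j)\}$ for all $j\in m^*$. The category of points of $\hat\Delta$ is equivalent to the category of intervals, an interval $I$ corresponding to the point $p_I$ given by the flat functor $\Delta\to\mathrm{Sets}$, $[n]\mapsto\mathrm{Hom}(n^*,I)$ (interval morphisms). Barycentric subdivision: for a finite totally ordered set $F$, $\mathrm{Sd}_k(F)=\{0,\dots,k-1\}\times F$ with the lexicographic order, and $\mathrm{Sd}_k(f)=\mathrm{id}\times f$; with $\mathrm{Sd}_k([n])$ identified with $[k(n+1)-1]$ via the unique increasing bijection,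 this is an endofunctor of $\Delta$. The associated geometric morphism $\hat\Delta\to\hat\Delta$ is the one whose inverse image functor sends a contravariant functor $Y:\Delta\to\mathrm{Sets}$ to $Y\circ\mathrm{Sd}_k$; it acts on points by composition. For an interval $I$, $\mathrm{Sd}_k^*(I)$ is the quotient of $\{0,\dots,k-1\}\times I$ (lexicographic order) by the identifications $(j,t_I)\sim(j+1,b_I)$ for $0\le j\le k-2$, and $\mathrm{Sd}_k^*(f)$ is induced by $\mathrm{id}\times f$. *)

theory Defs
  imports Main "HOL-Library.FuncSet"
begin

section \<open>Categories and functors\<close>

text \<open>
  A category is given by its objects, its hom-sets, identities and composition; the composite of
  \<open>f\<close> from \<open>a\<close> to \<open>b\<close> and \<open>g\<close> from \<open>b\<close> to \<open>c\<close> is \<open>Comp C a b c g f\<close>. All concrete arrows below are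
  functions that are extensional (\<open>undefined\<close> off their domain), so that equality of arrows is HOL
  equality.
\<close>

record ('o, 'm) category =
  Obj :: "'o set"
  Hom :: "'o \<Rightarrow> 'o \<Rightarrow> 'm set"
  Ident :: "'o \<Rightarrow> 'm"
  Comp :: "'o \<Rightarrow> 'o \<Rightarrow> 'o \<Rightarrow> 'm \<Rightarrow> 'm \<Rightarrow> 'm"

record ('o, 'm, 'p, 'n) cat_functor =
  Fo :: "'o \<Rightarrow> 'p"
  Fm :: "'o \<Rightarrow> 'o \<Rightarrow> 'm \<Rightarrow> 'n"

definition is_functor ::
  "('o, 'm) category \<Rightarrow> ('p, 'n) category \<Rightarrow> ('o, 'm, 'p, 'n) cat_functor \<Rightarrow> bool" where
  "is_functor C D F \<longleftrightarrow>
     (\<forall>a\<in>Obj C. Fo F a \<in> Obj D) \<and>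
     (\<forall>a\<in>Obj C. \<forall>b\<in>Obj C. \<forall>f\<in>Hom C a b. Fm F a b f \<in> Hom D (Fo F a) (Fo F b)) \<and>
     (\<forall>a\<in>Obj C. Fm F a a (Ident C a) = Ident D (Fo F a)) \<and>
     (\<forall>a\<in>Obj C. \<forall>b\<in>Obj C. \<forall>c\<in>Obj C. \<forall>f\<in>Hom C a b. \<forall>g\<in>Hom C b c.
        Fm F a c (Comp C a b c g f)
          = Comp D (Fo F a) (Fo F b) (Fo F c) (Fm F b c g) (Fm F a b f))"

definition functor_comp ::
  "('p, 'n, 'q, 'l) cat_functor \<Rightarrow> ('o, 'm, 'p, 'n) cat_functor \<Rightarrow> ('o, 'm, 'q, 'l) cat_functor" where
  "functor_comp G F =
     \<lparr>Fo = (\<lambda>a. Fo G (Fo F a)), Fm = (\<lambda>a b f. Fm G (Fo F a) (Fo F b) (Fm F a b f))\<rparr>"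

definition op_cat :: "('o, 'm) category \<Rightarrow> ('o, 'm) category" where
  "op_cat C = \<lparr>Obj = Obj C, Hom = (\<lambda>a b. Hom C b a), Ident = Ident C,
     Comp = (\<lambda>a b c g f. Comp C c b a f g)\<rparr>"

definition op_functor :: "('o, 'm, 'p, 'n) cat_functor \<Rightarrow> ('o, 'm, 'p, 'n) cat_functor" where
  "op_functor F = \<lparr>Fo = Fo F, Fm = (\<lambda>a b. Fm F b a)\<rparr>"

definition nat_trans ::
  "('o, 'm) category \<Rightarrow> ('p, 'n) category \<Rightarrow> ('o, 'm, 'p, 'n) cat_functor
     \<Rightarrow> ('o, 'm, 'p, 'n) cat_functor \<Rightarrow> ('o \<Rightarrow> 'n) set" where
  "nat_trans C D F G =
     {\<eta> \<in> (\<Pi>\<^sub>E a\<in>Obj C. Hom D (Fo F a) (Fo G a)).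
        \<forall>a\<in>Obj C. \<forall>b\<in>Obj C. \<forall>f\<in>Hom C a b.
          Comp D (Fo F a) (Fo F b) (Fo G b) (\<eta> b) (Fm F a b f)
            = Comp D (Fo F a) (Fo G a) (Fo G b) (Fm G a b f) (\<eta> a)}"

definition functor_cat ::
  "('o, 'm) category \<Rightarrow> ('p, 'n) category
     \<Rightarrow> (('o, 'm, 'p, 'n) cat_functor, 'o \<Rightarrow> 'n) category" where
  "functor_cat C D = \<lparr>Obj = {F. is_functor C D F}, Hom = nat_trans C D,
     Ident = (\<lambda>F. \<lambda>a\<in>Obj C. Ident D (Fo F a)),
     Comp = (\<lambda>F G H \<theta> \<eta>. \<lambda>a\<in>Obj C. Comp D (Fo F a) (Fo G a) (Fo H a) (\<theta> a) (\<eta> a))\<rparr>"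

definition full_subcat :: "('o, 'm) category \<Rightarrow> ('o \<Rightarrow> bool) \<Rightarrow> ('o, 'm) category" where
  "full_subcat C P = C\<lparr>Obj := {a \<in> Obj C. P a}\<rparr>"

text \<open>For \<open>S\<close> a functor from \<open>A\<close> to \<open>B\<close>: the functor \<open>Y \<mapsto> Y \<circ> S\<close> between categories of functors
  defined on \<open>B\<close> and on \<open>A\<close>.\<close>

definition precomp ::
  "('a, 'k) category \<Rightarrow> ('a, 'k, 'o, 'm) cat_functor
     \<Rightarrow> (('o, 'm, 'p, 'n) cat_functor, 'o \<Rightarrow> 'n, ('a, 'k, 'p, 'n) cat_functor, 'a \<Rightarrow> 'n) cat_functor"
  where
  "precomp A S = \<lparr>Fo = (\<lambda>Y. functor_comp Y S), Fm = (\<lambda>Y Z \<eta>. \<lambda>a\<in>Obj A. \<eta> (Fo S a))\<rparr>"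

text \<open>The category of sets: all subsets of a type, which serves as universe.\<close>

definition sets :: "('u set, 'u \<Rightarrow> 'u) category" where
  "sets = \<lparr>Obj = UNIV, Hom = (\<lambda>A B. A \<rightarrow>\<^sub>E B), Ident = (\<lambda>A. \<lambda>x\<in>A. x),
     Comp = (\<lambda>A B C g f. compose A g f)\<rparr>"

text \<open>
  Natural isomorphism of two functors \<open>T\<close>, \<open>T'\<close> from \<open>C\<close> to categories of set-valued functors on
  \<open>D\<close>. It is spelled out, because the sets may live in different types: components are
  bijections, natural in both the \<open>C\<close>- and the \<open>D\<close>-variable.
\<close>

definition set_valued_nat_iso ::
  "('o, 'm) category \<Rightarrow> ('p, 'n) category
     \<Rightarrow> ('o, 'm, ('p, 'n, 'v set, 'v \<Rightarrow> 'v) cat_functor, 'p \<Rightarrow> 'v \<Rightarrow> 'v) cat_functor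
     \<Rightarrow> ('o, 'm, ('p, 'n, 'w set, 'w \<Rightarrow> 'w) cat_functor, 'p \<Rightarrow> 'w \<Rightarrow> 'w) cat_functor
     \<Rightarrow> ('o \<Rightarrow> 'p \<Rightarrow> 'v \<Rightarrow> 'w) \<Rightarrow> bool" where
  "set_valued_nat_iso C D T T' \<Phi> \<longleftrightarrow>
     (\<forall>a\<in>Obj C. \<forall>y\<in>Obj D. bij_betw (\<Phi> a y) (Fo (Fo T a) y) (Fo (Fo T' a) y)) \<and>
     (\<forall>a\<in>Obj C. \<forall>y\<in>Obj D. \<forall>z\<in>Obj D. \<forall>h\<in>Hom D y z. \<forall>x\<in>Fo (Fo T a) y.
        \<Phi> a z (Fm (Fo T a) y z h x) = Fm (Fo T' a) y z h (\<Phi> a y x)) \<and>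
     (\<forall>a\<in>Obj C. \<forall>b\<in>Obj C. \<forall>f\<in>Hom C a b. \<forall>y\<in>Obj D. \<forall>x\<in>Fo (Fo T a) y.
        \<Phi> b y (Fm T a b f y x) = Fm T' a b f y (\<Phi> a y x))"


section \<open>The simplicial category and barycentric subdivision\<close>

text \<open>The number \<open>n\<close> stands for the object \<open>[n] = {0,\<dots>,n}\<close>.\<close>

definition delta :: "(nat, nat \<Rightarrow> nat) category" where
  "delta = \<lparr>Obj = UNIV, Hom = (\<lambda>n m. {f \<in> {..n} \<rightarrow>\<^sub>E {..m}. mono_on {..n} f}),
     Ident = (\<lambda>n. \<lambda>x\<in>{..n}. x), Comp = (\<lambda>n m l g f. compose {..n} g f)\<rparr>"

text \<open>The increasing bijection from \<open>{0,\<dots>,k-1} \<times> [n]\<close>, ordered lexicographically, to \<open>[k(n+1)-1]\<close>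
  (it does not depend on \<open>k\<close>).\<close>

definition sd_code :: "nat \<Rightarrow> nat \<times> nat \<Rightarrow> nat" where
  "sd_code n = (\<lambda>(j, x). j * (n + 1) + x)"

lemma sd_code_increasing:
  assumes "x \<le> n" "x' \<le> n" "((j, x), (j', x')) \<in> less_than <*lex*> less_than"
  shows "sd_code n (j, x) < sd_code n (j', x')"
proof (cases "j < j'")
  case True
  then have "Suc j * (n + 1) \<le> j' * (n + 1)" by (intro mult_right_mono) auto
  with assms(1) show ?thesis by (simp add: sd_code_def)
next
  case False
  with assms(3) show ?thesis by (auto simp: sd_code_def)
qed

lemma sd_code_bij:
  assumes "1 \<le> k"
  shows "bij_betw (sd_code n) ({..<k} \<times> {..n}) {..k * (n + 1) - 1}"
proof (rule bij_betw_byWitness[where f' = "\<lambda>i. (i div (n + 1), i mod (n + 1))"])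
  have pos: "0 < k * (n + 1)" using assms by simp
  show "\<forall>p\<in>{..<k} \<times> {..n}. (sd_code n p div (n + 1), sd_code n p mod (n + 1)) = p"
  proof
    fix p assume p: "p \<in> {..<k} \<times> {..n}"
    obtain j x where "p = (j, x)" by (cases p)
    with p have e: "sd_code n p = x + j * (n + 1)" and x: "x < n + 1"
      and pe: "p = (j, x)" by (auto simp: sd_code_def)
    have "(x + j * (n + 1)) div (n + 1) = j"
      using div_mult_self1[of "n + 1" x j] x by simp
    moreover have "(x + j * (n + 1)) mod (n + 1) = x"
      using mod_mult_self1[of x j "n + 1"] x by simp
    ultimately show "(sd_code n p div (n + 1), sd_code n p mod (n + 1)) = p"
      by (simp only: e) (simp only: pe)
  qed
  show "\<forall>i\<in>{..k * (n + 1) - 1}. sd_code n (i div (n + 1), i mod (n + 1)) = i"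
    using div_mult_mod_eq[of _ "n + 1"] by (simp add: sd_code_def)
  show "sd_code n ` ({..<k} \<times> {..n}) \<subseteq> {..k * (n + 1) - 1}"
  proof
    fix i assume "i \<in> sd_code n ` ({..<k} \<times> {..n})"
    then obtain j x where i: "i = j * (n + 1) + x" "j < k" "x \<le> n" by (auto simp: sd_code_def)
    have "Suc j * (n + 1) \<le> k * (n + 1)" using i(2) by (intro mult_right_mono) auto
    with i show "i \<in> {..k * (n + 1) - 1}" by simp
  qed
  show "(\<lambda>i. (i div (n + 1), i mod (n + 1))) ` {..k * (n + 1) - 1} \<subseteq> {..<k} \<times> {..n}"
  proof
    fix p assume "p \<in> (\<lambda>i. (i div (n + 1), i mod (n + 1))) ` {..k * (n + 1) - 1}"
    then obtain i where i: "i \<le> k * (n + 1) - 1" "p = (i div (n + 1), i mod (n + 1))" by auto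
    have "i < k * (n + 1)" using i(1) pos by linarith
    then have "i div (n + 1) < k" by (rule less_mult_imp_div_less)
    moreover have "i mod (n + 1) \<le> n" using mod_less_divisor[of "n + 1" i] by linarith
    ultimately show "p \<in> {..<k} \<times> {..n}" using i(2) by simp
  qed
qed

definition Sd :: "nat \<Rightarrow> (nat, nat \<Rightarrow> nat, nat, nat \<Rightarrow> nat) cat_functor" where
  "Sd k = \<lparr>Fo = (\<lambda>n. k * (n + 1) - 1),
     Fm = (\<lambda>n m f. \<lambda>i\<in>{..k * (n + 1) - 1}.
       sd_code m (map_prod id f (the_inv_into ({..<k} \<times> {..n}) (sd_code n) i)))\<rparr>"


section \<open>The simplicial topos and its points\<close>

type_synonym 'u presheaf = "(nat, nat \<Rightarrow> nat, 'u set, 'u \<Rightarrow> 'u) cat_functor"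

type_synonym ('u, 'v) topos_functor =
  "('u presheaf, nat \<Rightarrow> 'u \<Rightarrow> 'u, 'v set, 'v \<Rightarrow> 'v) cat_functor"

type_synonym ('u, 'v) topos_trans = "'u presheaf \<Rightarrow> 'v \<Rightarrow> 'v"

definition presheaves :: "('u presheaf, nat \<Rightarrow> 'u \<Rightarrow> 'u) category" where
  "presheaves = functor_cat (op_cat delta) sets"

definition equiv_gen :: "'x set \<Rightarrow> 'x rel \<Rightarrow> 'x rel" where
  "equiv_gen A R = (R \<union> R\<inverse>)\<^sup>* \<inter> A \<times> A"

definition set_pullback ::
  "'w set \<Rightarrow> 'x set \<Rightarrow> 'y set \<Rightarrow> ('w \<Rightarrow> 'x) \<Rightarrow> ('w \<Rightarrow> 'y) \<Rightarrow> ('x \<Rightarrow> 'z) \<Rightarrow> ('y \<Rightarrow> 'z) \<Rightarrow> bool" where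
  "set_pullback W X Y p q f g \<longleftrightarrow>
     bij_betw (\<lambda>w. (p w, q w)) W {(x, y). x \<in> X \<and> y \<in> Y \<and> f x = g y}"

definition set_coproduct ::
  "'i set \<Rightarrow> ('i \<Rightarrow> 'x set) \<Rightarrow> 'y set \<Rightarrow> ('i \<Rightarrow> 'x \<Rightarrow> 'y) \<Rightarrow> bool" where
  "set_coproduct J X Y \<iota> \<longleftrightarrow> bij_betw (\<lambda>(i, x). \<iota> i x) (Sigma J X) Y"

definition set_coequalizer ::
  "'x set \<Rightarrow> 'y set \<Rightarrow> 'q set \<Rightarrow> ('x \<Rightarrow> 'y) \<Rightarrow> ('x \<Rightarrow> 'y) \<Rightarrow> ('y \<Rightarrow> 'q) \<Rightarrow> bool" where
  "set_coequalizer X Y Q f g q \<longleftrightarrow> q ` Y = Q \<and>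
     (\<forall>y\<in>Y. \<forall>y'\<in>Y. q y = q y' \<longleftrightarrow> (y, y') \<in> equiv_gen Y {(f x, g x) | x. x \<in> X})"

text \<open>
  A point is a geometric morphism from sets to the topos. It is represented by its inverse image
  functor, and morphisms of points are the natural transformations of inverse image functors.
  The inverse image functors of points are the set-valued functors on the topos that preserve finite
  limits (terminal object and pullbacks) and small colimits (coproducts and coequalizers); limits
  and colimits of presheaves are formed objectwise. Preservation of colimits is used in place of
  a right adjoint, because the latter need not exist inside fixed types. The index type
  \<open>nat \<times> 'u\<close> is no restriction: the members of a coproduct decomposition of a \<open>'u\<close>-valued presheaf
  that are not empty inject into it.
\<close>

definition preserves_finite_limits :: "('u, 'v) topos_functor \<Rightarrow> bool" where
  "preserves_finite_limits P \<longleftrightarrow>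
     (\<forall>Y\<in>Obj presheaves. (\<forall>n. is_singleton (Fo Y n)) \<longrightarrow> is_singleton (Fo P Y)) \<and>
     (\<forall>W\<in>Obj presheaves. \<forall>X\<in>Obj presheaves. \<forall>Y\<in>Obj presheaves. \<forall>Z\<in>Obj presheaves.
      \<forall>p\<in>Hom presheaves W X. \<forall>q\<in>Hom presheaves W Y.
      \<forall>f\<in>Hom presheaves X Z. \<forall>g\<in>Hom presheaves Y Z.
        (\<forall>n. set_pullback (Fo W n) (Fo X n) (Fo Y n) (p n) (q n) (f n) (g n)) \<longrightarrow>
        set_pullback (Fo P W) (Fo P X) (Fo P Y)
          (Fm P W X p) (Fm P W Y q) (Fm P X Z f) (Fm P Y Z g))"

definition preserves_colimits :: "('u, 'v) topos_functor \<Rightarrow> bool" where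
  "preserves_colimits P \<longleftrightarrow>
     (\<forall>(J :: (nat \<times> 'u) set) X \<iota>. \<forall>Y\<in>Obj presheaves.
        (\<forall>i\<in>J. X i \<in> Obj presheaves \<and> \<iota> i \<in> Hom presheaves (X i) Y) \<longrightarrow>
        (\<forall>n. set_coproduct J (\<lambda>i. Fo (X i) n) (Fo Y n) (\<lambda>i. \<iota> i n)) \<longrightarrow>
        set_coproduct J (\<lambda>i. Fo P (X i)) (Fo P Y) (\<lambda>i. Fm P (X i) Y (\<iota> i))) \<and>
     (\<forall>X\<in>Obj presheaves. \<forall>Y\<in>Obj presheaves. \<forall>Q\<in>Obj presheaves.
      \<forall>f\<in>Hom presheaves X Y. \<forall>g\<in>Hom presheaves X Y. \<forall>q\<in>Hom presheaves Y Q.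
        (\<forall>n. set_coequalizer (Fo X n) (Fo Y n) (Fo Q n) (f n) (g n) (q n)) \<longrightarrow>
        set_coequalizer (Fo P X) (Fo P Y) (Fo P Q) (Fm P X Y f) (Fm P X Y g) (Fm P Y Q q))"

definition points :: "(('u, 'v) topos_functor, ('u, 'v) topos_trans) category" where
  "points = full_subcat (functor_cat presheaves sets)
     (\<lambda>P. preserves_finite_limits P \<and> preserves_colimits P)"

text \<open>The inverse image functor \<open>Y \<mapsto> Y \<circ> Sd k\<close> of the geometric morphism associated to \<open>Sd k\<close>, and the
  action of that geometric morphism on points: composing geometric morphisms amounts to
  composing inverse image functors in the reverse order.\<close>

definition sd_inverse_image ::
  "nat \<Rightarrow> ('u presheaf, nat \<Rightarrow> 'u \<Rightarrow> 'u, 'u presheaf, nat \<Rightarrow> 'u \<Rightarrow> 'u) cat_functor" where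
  "sd_inverse_image k = precomp (op_cat delta) (op_functor (Sd k))"

definition sd_on_points ::
  "nat \<Rightarrow> (('u, 'v) topos_functor, ('u, 'v) topos_trans,
            ('u, 'v) topos_functor, ('u, 'v) topos_trans) cat_functor" where
  "sd_on_points k = precomp presheaves (sd_inverse_image k)"


section \<open>Intervals\<close>

text \<open>A totally ordered set is given by its (reflexive) order relation; the underlying set is the
  \<open>Field\<close> of the relation.\<close>

definition is_bot :: "'a rel \<Rightarrow> 'a \<Rightarrow> bool" where
  "is_bot I b \<longleftrightarrow> b \<in> Field I \<and> (\<forall>x\<in>Field I. (b, x) \<in> I)"

definition is_top :: "'a rel \<Rightarrow> 'a \<Rightarrow> bool" where
  "is_top I t \<longleftrightarrow> t \<in> Field I \<and> (\<forall>x\<in>Field I. (x, t) \<in> I)"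

definition interval :: "'a rel \<Rightarrow> bool" where
  "interval I \<longleftrightarrow> Linear_order I \<and> (\<exists>b t. is_bot I b \<and> is_top I t \<and> t \<noteq> b)"

definition ibot :: "'a rel \<Rightarrow> 'a" where
  "ibot I = (THE b. is_bot I b)"

definition itop :: "'a rel \<Rightarrow> 'a" where
  "itop I = (THE t. is_top I t)"

definition interval_hom :: "'a rel \<Rightarrow> 'b rel \<Rightarrow> ('a \<Rightarrow> 'b) set" where
  "interval_hom I J = {f \<in> Field I \<rightarrow>\<^sub>E Field J.
     (\<forall>x y. (x, y) \<in> I \<longrightarrow> (f x, f y) \<in> J) \<and> f (ibot I) = ibot J \<and> f (itop I) = itop J}"

definition intervals :: "('a rel, 'a \<Rightarrow> 'a) category" where
  "intervals = \<lparr>Obj = {I. interval I}, Hom = interval_hom, Ident = (\<lambda>I. \<lambda>x\<in>Field I. x),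
     Comp = (\<lambda>I J K g f. compose (Field I) g f)\<rparr>"

definition star :: "nat \<Rightarrow> nat rel" where
  "star n = {(i, j). i \<le> j \<and> j \<le> n + 1}"

definition star_map :: "nat \<Rightarrow> nat \<Rightarrow> (nat \<Rightarrow> nat) \<Rightarrow> nat \<Rightarrow> nat" where
  "star_map n m f = (\<lambda>j\<in>{..m + 1}.
     THE i. i \<le> n + 1 \<and> {x. x \<le> n \<and> j \<le> f x} = {x. x \<le> n \<and> i \<le> x})"


section \<open>The point associated to an interval\<close>

text \<open>The functor \<open>[n] \<mapsto> Hom(n\<^sup>*, I)\<close> on the simplicial category.\<close>

definition flat_functor ::
  "'a rel \<Rightarrow> (nat, nat \<Rightarrow> nat, (nat \<Rightarrow> 'a) set, (nat \<Rightarrow> 'a) \<Rightarrow> (nat \<Rightarrow> 'a)) cat_functor" where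
  "flat_functor I = \<lparr>Fo = (\<lambda>n. interval_hom (star n) I),
     Fm = (\<lambda>n m f. \<lambda>\<phi>\<in>interval_hom (star n) I. compose (Field (star m)) \<phi> (star_map n m f))\<rparr>"

text \<open>The tensor product over the simplicial category of a presheaf \<open>Y\<close> and a covariant functor
  \<open>F\<close>: the disjoint union of the products \<open>Y([n]) \<times> F([n])\<close> modulo \<open>(Y(f) y, \<phi>) \<sim> (y, F(f) \<phi>)\<close> for
  \<open>f\<close> from \<open>[n]\<close> to \<open>[m]\<close>, \<open>y\<close> in \<open>Y([m])\<close> and \<open>\<phi>\<close> in \<open>F([n])\<close>. The inverse image functor of the point
  given by a flat functor \<open>F\<close> is \<open>Y \<mapsto> Y \<otimes> F\<close>.\<close>

definition tensor_pairs ::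
  "'u presheaf \<Rightarrow> (nat, nat \<Rightarrow> nat, 'w set, 'w \<Rightarrow> 'w) cat_functor \<Rightarrow> (nat \<times> 'u \<times> 'w) set" where
  "tensor_pairs Y F = {(n, y, \<phi>). y \<in> Fo Y n \<and> \<phi> \<in> Fo F n}"

definition tensor_rel ::
  "'u presheaf \<Rightarrow> (nat, nat \<Rightarrow> nat, 'w set, 'w \<Rightarrow> 'w) cat_functor \<Rightarrow> (nat \<times> 'u \<times> 'w) rel" where
  "tensor_rel Y F = equiv_gen (tensor_pairs Y F)
     {((n, Fm Y m n f y, \<phi>), (m, y, Fm F n m f \<phi>)) | n m f y \<phi>.
        f \<in> Hom delta n m \<and> y \<in> Fo Y m \<and> \<phi> \<in> Fo F n}"

definition tensor ::
  "'u presheaf \<Rightarrow> (nat, nat \<Rightarrow> nat, 'w set, 'w \<Rightarrow> 'w) cat_functor \<Rightarrow> (nat \<times> 'u \<times> 'w) set set" where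
  "tensor Y F = tensor_pairs Y F // tensor_rel Y F"

definition tensor_map ::
  "'u presheaf \<Rightarrow> (nat, nat \<Rightarrow> nat, 'w set, 'w \<Rightarrow> 'w) cat_functor
     \<Rightarrow> 'u presheaf \<Rightarrow> (nat, nat \<Rightarrow> nat, 'w set, 'w \<Rightarrow> 'w) cat_functor
     \<Rightarrow> (nat \<Rightarrow> 'u \<Rightarrow> 'u) \<Rightarrow> (nat \<Rightarrow> 'w \<Rightarrow> 'w)
     \<Rightarrow> (nat \<times> 'u \<times> 'w) set \<Rightarrow> (nat \<times> 'u \<times> 'w) set" where
  "tensor_map Y F Z G \<eta> \<theta> =
     (\<lambda>X\<in>tensor Y F. tensor_rel Z G `` ((\<lambda>(n, y, \<phi>). (n, \<eta> n y, \<theta> n \<phi>)) ` X))"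

type_synonym ('u, 'a) stalk = "(nat \<times> 'u \<times> (nat \<Rightarrow> 'a)) set"

definition point_of :: "'a rel \<Rightarrow> ('u, ('u, 'a) stalk) topos_functor" where
  "point_of I = \<lparr>Fo = (\<lambda>Y. tensor Y (flat_functor I)),
     Fm = (\<lambda>Y Z \<eta>. tensor_map Y (flat_functor I) Z (flat_functor I) \<eta> (\<lambda>n \<phi>. \<phi>))\<rparr>"

text \<open>The functor \<open>I \<mapsto> p\<^sub>I\<close> from intervals to points: a morphism \<open>f\<close> of intervals acts by
  postcomposition on the sets \<open>Hom(n\<^sup>*, I)\<close>.\<close>

definition interval_point ::
  "('a rel, 'a \<Rightarrow> 'a,
    ('u, ('u, 'a) stalk) topos_functor, ('u, ('u, 'a) stalk) topos_trans) cat_functor" where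
  "interval_point = \<lparr>Fo = point_of,
     Fm = (\<lambda>I J f. \<lambda>Y\<in>Obj presheaves.
       tensor_map Y (flat_functor I) Y (flat_functor J)
         (\<lambda>n y. y) (\<lambda>n \<phi>. compose (Field (star n)) f \<phi>))\<rparr>"


section \<open>Barycentric subdivision of intervals\<close>

definition sdstar_carrier :: "nat \<Rightarrow> 'a rel \<Rightarrow> (nat \<times> 'a) set" where
  "sdstar_carrier k I = {..<k} \<times> Field I"

definition sdstar_rel :: "nat \<Rightarrow> 'a rel \<Rightarrow> (nat \<times> 'a) rel" where
  "sdstar_rel k I = equiv_gen (sdstar_carrier k I)
     {((j, itop I), (j + 1, ibot I)) | j. j + 1 < k}"

text \<open>The quotient, with the order induced by the lexicographic one. As \<open>I\<close> is reflexive,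
  \<open>less_than <*lex*> I\<close> is the reflexive lexicographic order.\<close>

definition sdstar :: "nat \<Rightarrow> 'a rel \<Rightarrow> (nat \<times> 'a) set rel" where
  "sdstar k I = {(X, Y).
     X \<in> sdstar_carrier k I // sdstar_rel k I \<and> Y \<in> sdstar_carrier k I // sdstar_rel k I \<and>
     (\<exists>p\<in>X. \<exists>q\<in>Y. (p, q) \<in> less_than <*lex*> I)}"

definition sdstar_map ::
  "nat \<Rightarrow> 'a rel \<Rightarrow> 'a rel \<Rightarrow> ('a \<Rightarrow> 'a) \<Rightarrow> (nat \<times> 'a) set \<Rightarrow> (nat \<times> 'a) set" where
  "sdstar_map k I J f =
     (\<lambda>X\<in>sdstar_carrier k I // sdstar_rel k I. sdstar_rel k J `` (map_prod id f ` X))"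

definition Sdstar ::
  "nat \<Rightarrow> ('a rel, 'a \<Rightarrow> 'a, (nat \<times> 'a) set rel, (nat \<times> 'a) set \<Rightarrow> (nat \<times> 'a) set) cat_functor" where
  "Sdstar k = \<lparr>Fo = sdstar k, Fm = sdstar_map k\<rparr>"

end

theory Submission
  imports Defs
begin

text \<open>
  An element of a stalk \<open>p\<^sub>I\<^sup>* Y\<close> is represented by a finite subset of \<open>I\<close> containing both end points,
  enumerated by an injective \<open>\<chi>\<close> from some \<open>n\<^sup>*\<close> to \<open>I\<close>, and an element of \<open>Y [n]\<close>. Any two elements
  can be represented over the same subset, and an injective \<open>\<chi>\<close> is not equalized by two different
  maps of \<open>\<Delta>\<close>; hence the stalk is a filtered colimit and commutes with finite limits. Since
  \<open>(Sd\<^sub>k [n])\<^sup>*\<close> is the subdivision of the interval \<open>n\<^sup>*\<close>, an \<open>n\<^sup>*\<close>-point of \<open>I\<close> induces an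
  \<open>(Sd\<^sub>k [n])\<^sup>*\<close>-point of the subdivision of \<open>I\<close>. This gives a natural map from the stalk of \<open>Y \<circ> Sd\<^sub>k\<close>
  at \<open>I\<close> to the stalk of \<open>Y\<close> at the subdivision of \<open>I\<close>. It is bijective because each finite subset of
  the subdivision lies in the subdivision of a finite subset of \<open>I\<close>.
\<close>

section \<open>Functors and generated equivalence relations\<close>


text \<open>The tensor product is a quotient by a generated equivalence relation, so the obstacle is
  to read an equality of classes back: a priori it is a zigzag of unbounded length. Free elements
  remove it. At most one arrow carries a free element to a given element, so two refinements of a
  common element agree once they are composed with arrows from a free one, and a zigzag collapses to
  a single common refinement. The same device gives injectivity of the comparison. An equality over
  the subdivision is witnessed by a refinement that need not be a subdivision of anything. It is
  refined further, and freeness shows that the composite arrow is \<open>Sd k\<close> of an arrow.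
  The argument works with representatives throughout, in place of a left Kan extension along
  \<open>Sd k\<close>. The constant \<open>k * (n + 1) - 1\<close> comes from gluing
  \<open>k\<close> copies of the dual interval of \<open>[n]\<close>, which has \<open>n + 2\<close>
  elements, at \<open>k - 1\<close> joints: this leaves \<open>k * (n + 1) + 1\<close> elements, as
  many as the dual interval of \<open>[k * (n + 1) - 1]\<close> has.\<close>

lemma is_functor_functor_comp:
  assumes "is_functor A B F" "is_functor B C G"
  shows "is_functor A C (functor_comp G F)"
  using assms unfolding is_functor_def functor_comp_def by simp

lemma is_functor_op_functor:
  assumes "is_functor C D F"
  shows "is_functor (op_cat C) (op_cat D) (op_functor F)"
  using assms unfolding is_functor_def op_cat_def op_functor_def by simp

lemma nat_trans_precomp:
  assumes S: "is_functor A B S" and \<eta>: "\<eta> \<in> nat_trans B D Y Z"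
  shows "(\<lambda>a\<in>Obj A. \<eta> (Fo S a)) \<in> nat_trans A D (functor_comp Y S) (functor_comp Z S)"
  using assms unfolding nat_trans_def is_functor_def functor_comp_def by (auto simp: PiE_iff)

text \<open>Used at two levels: \<open>S\<close> is the opposite of \<open>Sd k\<close> for the
  inverse image functor on presheaves, and that inverse image functor itself for the action on
  points.\<close>

lemma is_functor_precomp:
  assumes S: "is_functor A B S"
  shows "is_functor (functor_cat B D) (functor_cat A D) (precomp A S)"
proof -
  have obj: "Fo S a \<in> Obj B" if "a \<in> Obj A" for a
    using S that by (simp add: is_functor_def)
  show ?thesis
    unfolding is_functor_def[of "functor_cat B D"]
    by (simp add: functor_cat_def precomp_def is_functor_functor_comp[OF S] nat_trans_precomp[OF S]
        obj cong: restrict_cong) (simp add: functor_comp_def)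
qed

lemma equiv_equiv_gen: "equiv A (equiv_gen A R)"
proof (rule equivI)
  have "sym ((R \<union> R\<inverse>)\<^sup>*)" by (intro sym_rtrancl sym_Un_converse)
  then show "sym (equiv_gen A R)" unfolding equiv_gen_def sym_def by blast
  show "trans (equiv_gen A R)" unfolding equiv_gen_def
    by (intro transI) (auto intro: rtrancl_trans)
qed (auto simp: equiv_gen_def refl_on_def)

lemma equiv_gen_base:
  assumes "(x, y) \<in> R" "x \<in> A" "y \<in> A"
  shows "(x, y) \<in> equiv_gen A R"
  using assms by (auto simp: equiv_gen_def)

text \<open>Zigzags of \<open>R\<close> are followed inside \<open>E\<close>: symmetry of
  \<open>E\<close> absorbs the reversed steps, and the empty zigzag is covered by reflexivity on
  \<open>A\<close>.\<close>

lemma equiv_gen_least: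
  assumes E: "equiv A E" and R: "R \<subseteq> E"
  shows "equiv_gen A R \<subseteq> E"
proof (rule subrelI)
  fix x y assume "(x, y) \<in> equiv_gen A R"
  then have "(x, y) \<in> (R \<union> R\<inverse>)\<^sup>*" and x: "x \<in> A" by (auto simp: equiv_gen_def)
  from this(1) show "(x, y) \<in> E"
  proof induction
    case base
    show ?case using x by (rule equiv_class_self[OF E, unfolded Image_singleton_iff])
  next
    case (step y z)
    then have "(y, z) \<in> E" using R E by (auto simp: equiv_def sym_def)
    with step.IH show ?case using E by (auto simp: equiv_def dest: transD)
  qed
qed

text \<open>The preimage of \<open>E\<close> under \<open>f\<close> is an equivalence relation on
  \<open>A\<close> containing \<open>R\<close>, so it contains what \<open>R\<close> generates.
  Well-definedness on quotients thus has to be checked on generators only.\<close>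

lemma equiv_gen_map:
  assumes "(x, y) \<in> equiv_gen A R" and E: "equiv B E"
    and f: "f \<in> A \<rightarrow> B" and R: "R \<subseteq> A \<times> A"
    and step: "\<And>x y. (x, y) \<in> R \<Longrightarrow> (f x, f y) \<in> E"
  shows "(f x, f y) \<in> E"
proof -
  have "equiv A {(x, y) \<in> A \<times> A. (f x, f y) \<in> E}"
    using E f by (intro equivI refl_onI symI transI)
      (auto simp: equiv_def Pi_iff refl_on_def dest: transD symD)
  from equiv_gen_least[OF this] show ?thesis using assms(1) R step by blast
qed

text \<open>The image of a class under \<open>f\<close> may be only a part of a class, which is why
  the maps on quotients saturate it with \<open>s\<close>; compatibility of \<open>f\<close> with
  the relations makes the result the class of \<open>f a\<close>.\<close>

lemma Image_image_class:
  assumes r: "equiv A r" and s: "equiv B s" and a: "a \<in> A"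
    and f: "\<And>x y. (x, y) \<in> r \<Longrightarrow> (f x, f y) \<in> s"
  shows "s `` (f ` (r `` {a})) = s `` {f a}"
proof -
  have "(a, a) \<in> r" using r a by (auto simp: equiv_def refl_on_def)
  moreover have "(f a, z) \<in> s" if "(a, x) \<in> r" "(f x, z) \<in> s" for x z
    using s f[OF that(1)] that(2) by (auto simp: equiv_def dest: transD)
  ultimately show ?thesis by auto
qed

section \<open>Duality with finite intervals\<close>

lemma Hom_delta_iff:
  "f \<in> Hom delta n m \<longleftrightarrow> f \<in> {..n} \<rightarrow>\<^sub>E {..m} \<and> mono_on {..n} f"
  by (simp add: delta_def)

lemma Hom_delta_le: "f \<in> Hom delta n m \<Longrightarrow> x \<le> n \<Longrightarrow> f x \<le> m"
  by (auto simp: Hom_delta_iff)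

lemma Hom_delta_mono: "f \<in> Hom delta n m \<Longrightarrow> x \<le> y \<Longrightarrow> y \<le> n \<Longrightarrow> f x \<le> f y"
  by (auto simp: Hom_delta_iff mono_on_def)

lemma Comp_delta_apply: "x \<le> n \<Longrightarrow> Comp delta n m l g f x = g (f x)"
  by (simp add: delta_def compose_def)

lemma Comp_delta_Hom:
  assumes "f \<in> Hom delta n m" "g \<in> Hom delta m l"
  shows "Comp delta n m l g f \<in> Hom delta n l"
  using assms by (auto simp: delta_def compose_def mono_on_def PiE_iff)

lemma Ident_delta_Hom: "Ident delta n \<in> Hom delta n n"
  by (auto simp: delta_def mono_on_def)

lemma Hom_delta_eqI:
  assumes "f \<in> Hom delta n m" "g \<in> Hom delta n m" "\<And>x. x \<le> n \<Longrightarrow> f x = g x"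
  shows "f = g"
  using assms by (intro PiE_ext[of f "{..n}" _ g]) (auto simp: Hom_delta_iff)

lemma Field_star: "Field (star n) = {..n + 1}"
  by (auto simp: star_def Field_def)

lemma star_iff: "(i, j) \<in> star n \<longleftrightarrow> i \<le> j \<and> j \<le> n + 1"
  by (simp add: star_def)

section \<open>Linear orders and the end points of intervals\<close>

lemma Linear_order_antisym:
  assumes "Linear_order I" "(x, y) \<in> I" "(y, x) \<in> I"
  shows "x = y"
  using assms by (auto simp: linear_order_on_def partial_order_on_def dest: antisymD)

lemma Linear_order_trans:
  assumes "Linear_order I" "(x, y) \<in> I" "(y, z) \<in> I"
  shows "(x, z) \<in> I"
  using assms by (auto simp: linear_order_on_def partial_order_on_def preorder_on_def dest: transD)

lemma Linear_order_total:
  assumes "Linear_order I" "x \<in> Field I" "y \<in> Field I"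
  shows "(x, y) \<in> I \<or> (y, x) \<in> I"
  using assms
  by (cases "x = y")
    (auto simp: linear_order_on_def partial_order_on_def preorder_on_def total_on_def refl_on_def)

lemma ibot_eqI:
  assumes "Linear_order I" "is_bot I b"
  shows "ibot I = b"
  unfolding ibot_def using assms
  by (intro the_equality) (auto simp: is_bot_def intro: Linear_order_antisym)

lemma itop_eqI:
  assumes "Linear_order I" "is_top I t"
  shows "itop I = t"
  unfolding itop_def using assms
  by (intro the_equality) (auto simp: is_top_def intro: Linear_order_antisym)

lemma interval_ibot: "interval I \<Longrightarrow> is_bot I (ibot I)"
  unfolding interval_def using ibot_eqI by metis

lemma interval_itop: "interval I \<Longrightarrow> is_top I (itop I)"
  unfolding interval_def using itop_eqI by metis

lemma interval_ibot_neq_itop: "interval I \<Longrightarrow> itop I \<noteq> ibot I"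
  unfolding interval_def using itop_eqI ibot_eqI by metis

lemma interval_Linear_order: "interval I \<Longrightarrow> Linear_order I"
  by (simp add: interval_def)

lemma Linear_order_star: "Linear_order (star n)"
  by (auto simp: linear_order_on_def partial_order_on_def preorder_on_def total_on_def refl_on_def
      Field_star star_iff intro!: antisymI transI)

lemma ibot_star: "ibot (star n) = 0"
  by (rule ibot_eqI[OF Linear_order_star]) (auto simp: is_bot_def Field_star star_iff)

lemma itop_star: "itop (star n) = n + 1"
  by (rule itop_eqI[OF Linear_order_star]) (auto simp: is_top_def Field_star star_iff)

lemma interval_hom_star_iff:
  "\<phi> \<in> interval_hom (star n) I \<longleftrightarrow> \<phi> \<in> {..n + 1} \<rightarrow>\<^sub>E Field I \<and>
     (\<forall>i j. i \<le> j \<longrightarrow> j \<le> n + 1 \<longrightarrow> (\<phi> i, \<phi> j) \<in> I) \<and> \<phi> 0 = ibot I \<and> \<phi> (n + 1) = itop I"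
  by (auto simp: interval_hom_def Field_star ibot_star itop_star star_iff)

lemma interval_hom_extensional: "\<phi> \<in> interval_hom (star n) I \<Longrightarrow> \<phi> \<in> extensional {..n + 1}"
  by (auto simp: interval_hom_star_iff PiE_iff)

text \<open>Monotonicity makes \<open>{x. j \<le> f x}\<close> an upper set of \<open>[n]\<close>,
  determined by its least element; \<open>n + 1\<close> stands for the empty upper set.\<close>

lemma star_map_ex:
  assumes f: "f \<in> Hom delta n m"
  shows "\<exists>i \<le> n + 1. {x. x \<le> n \<and> j \<le> f x} = {x. x \<le> n \<and> i \<le> x}"
proof (cases "\<exists>x\<le>n. j \<le> f x")
  case True
  define i where "i = (LEAST x. x \<le> n \<and> j \<le> f x)"
  have i: "i \<le> n \<and> j \<le> f i" unfolding i_def using True by (rule LeastI_ex)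
  have "i \<le> x" if "x \<le> n" "j \<le> f x" for x
    unfolding i_def using that by (intro Least_le) simp
  with i have "{x. x \<le> n \<and> j \<le> f x} = {x. x \<le> n \<and> i \<le> x}"
    using Hom_delta_mono[OF f, of i] by (auto intro: order_trans)
  then show ?thesis using i by (intro exI[of _ i]) auto
next
  case False
  then show ?thesis by (intro exI[of _ "n + 1"]) auto
qed

lemma star_map_unique:
  fixes i i' n :: nat
  assumes "i \<le> n + 1" "i' \<le> n + 1" "{x. x \<le> n \<and> i \<le> x} = {x. x \<le> n \<and> i' \<le> x}"
  shows "i = i'"
proof (rule ccontr)
  assume "i \<noteq> i'"
  \<comment> \<open>Two different numbers up to \<open>n + 1\<close> have a minimum of at most
    \<open>n\<close>, so the minimum is an element of \<open>[n]\<close>; it lies in exactly one of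
    the two upper sets.\<close>
  then have "min i i' \<in> {x. x \<le> n \<and> i \<le> x} \<longleftrightarrow> min i i' \<notin> {x. x \<le> n \<and> i' \<le> x}"
    using assms(1,2) by (auto simp: min_def)
  with assms(3) show False by blast
qed

text \<open>On \<open>[n]\<close> this is a Galois connection: \<open>star_map n m f\<close> is the
  lower adjoint of \<open>f\<close>, with the extra value \<open>n + 1\<close> where no
  \<open>x\<close> qualifies. Identities about \<open>star_map\<close> are derived from it by
  uniqueness of adjoints.\<close>

lemma star_map_char:
  assumes f: "f \<in> Hom delta n m" and j: "j \<le> m + 1"
  shows star_map_le: "star_map n m f j \<le> n + 1"
    and star_map_galois: "x \<le> n \<Longrightarrow> star_map n m f j \<le> x \<longleftrightarrow> j \<le> f x"
proof -
  have "\<exists>!i. i \<le> n + 1 \<and> {x. x \<le> n \<and> j \<le> f x} = {x. x \<le> n \<and> i \<le> x}"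
  proof (rule ex_ex1I)
    show "\<exists>i. i \<le> n + 1 \<and> {x. x \<le> n \<and> j \<le> f x} = {x. x \<le> n \<and> i \<le> x}"
      using star_map_ex[OF f, of j] by blast
  qed (elim conjE, rule star_map_unique, simp_all)
  from theI'[OF this] j have *: "star_map n m f j \<le> n + 1 \<and>
      {x. x \<le> n \<and> j \<le> f x} = {x. x \<le> n \<and> star_map n m f j \<le> x}"
    by (simp add: star_map_def)
  show "star_map n m f j \<le> n + 1" using * by blast
  show "x \<le> n \<Longrightarrow> star_map n m f j \<le> x \<longleftrightarrow> j \<le> f x" using * by blast
qed

lemma star_map_apply_eqI:
  assumes f: "f \<in> Hom delta n m" and j: "j \<le> m + 1" and i: "i \<le> n + 1"
    and galois: "\<And>x. x \<le> n \<Longrightarrow> i \<le> x \<longleftrightarrow> j \<le> f x"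
  shows "star_map n m f j = i"
  by (rule star_map_unique[OF star_map_le[OF f j] i])
    (use star_map_galois[OF f j] galois in blast)

lemma star_map_Ident: "j \<le> n + 1 \<Longrightarrow> star_map n n (Ident delta n) j = j"
  by (rule star_map_apply_eqI[OF Ident_delta_Hom]) (auto simp: delta_def)

text \<open>Lower adjoints compose in the reverse order: the Galois condition of the right side
  follows from those of its two factors.\<close>

lemma star_map_Comp:
  assumes f: "f \<in> Hom delta n m" and g: "g \<in> Hom delta m l" and j: "j \<le> l + 1"
  shows "star_map n l (Comp delta n m l g f) j = star_map n m f (star_map m l g j)"
  using star_map_le[OF g j] star_map_galois[OF g j] Hom_delta_le[OF f]
  by (intro star_map_apply_eqI[OF Comp_delta_Hom[OF f g] j])
    (simp_all add: star_map_le[OF f, simplified] star_map_galois[OF f] Comp_delta_apply)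

lemma star_map_Hom:
  assumes f: "f \<in> Hom delta n m"
  shows "star_map n m f \<in> interval_hom (star m) (star n)"
proof -
  have mono: "star_map n m f i \<le> star_map n m f j" if "i \<le> j" "j \<le> m + 1" for i j
  \<comment> \<open>The Galois condition can be evaluated only at points of \<open>[n]\<close>. If
    \<open>star_map n m f j\<close> is \<open>n + 1\<close>, it bounds every value of
    \<open>star_map n m f\<close>.\<close>
  proof (cases "star_map n m f j \<le> n")
    case True
    have "i \<le> f (star_map n m f j)"
      using star_map_galois[OF f that(2) True] that(1) by simp
    then show ?thesis using star_map_galois[OF f _ True, of i] that by simp
  next
    case False
    then show ?thesis using star_map_le[OF f, of i] that by simp
  qed
  have 0: "star_map n m f 0 = 0" by (rule star_map_apply_eqI[OF f]) auto
  have 1: "star_map n m f (m + 1) = n + 1"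
    by (rule star_map_apply_eqI[OF f]) (use Hom_delta_le[OF f] in fastforce)+
  have "star_map n m f \<in> {..m + 1} \<rightarrow>\<^sub>E {..n + 1}"
    using star_map_le[OF f] by (auto simp: PiE_iff) (simp add: star_map_def)
  then show ?thesis using mono 0 1 star_map_le[OF f]
    by (simp add: interval_hom_star_iff Field_star ibot_star itop_star star_iff)
qed

text \<open>A map is recovered from its adjoint: testing the Galois condition at \<open>x\<close>
  against \<open>f x\<close> and \<open>g x\<close> gives both inequalities.\<close>

lemma star_map_faithful:
  assumes f: "f \<in> Hom delta n m" and g: "g \<in> Hom delta n m"
    and eq: "\<And>j. j \<le> m + 1 \<Longrightarrow> star_map n m f j = star_map n m g j"
  shows "f = g"
proof (rule Hom_delta_eqI[OF f g])
  fix x assume x: "x \<le> n"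
  have "f x \<le> m" "g x \<le> m" using x f g by (auto intro: Hom_delta_le)
  then show "f x = g x"
    using star_map_galois[OF f _ x, of "f x"] star_map_galois[OF f _ x, of "g x"]
      star_map_galois[OF g _ x, of "f x"] star_map_galois[OF g _ x, of "g x"] eq
    by (intro antisym) auto
qed

text \<open>A morphism of finite intervals has an upper adjoint, and preservation of the end points
  is what makes this adjoint a map from \<open>[n]\<close> to \<open>[m]\<close>.\<close>

lemma star_map_full:
  assumes u: "u \<in> interval_hom (star m) (star n)"
  obtains f where "f \<in> Hom delta n m" "\<And>j. j \<le> m + 1 \<Longrightarrow> star_map n m f j = u j"
proof -
  have u0: "u 0 = 0" and u1: "u (m + 1) = n + 1"
    and mono: "\<And>i j. i \<le> j \<Longrightarrow> j \<le> m + 1 \<Longrightarrow> u i \<le> u j \<and> u j \<le> n + 1"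
    using u by (auto simp: interval_hom_star_iff ibot_star itop_star star_iff)
  \<comment> \<open>The usual formula for an upper adjoint; the set of competing indices contains
    \<open>0\<close> because \<open>u 0 = 0\<close>.\<close>
  define f where "f = (\<lambda>x\<in>{..n}. GREATEST j. j \<le> m \<and> u j \<le> x)"
  have P: "f x \<le> m \<and> u (f x) \<le> x" if "x \<le> n" for x
    using GreatestI_nat[of "\<lambda>j. j \<le> m \<and> u j \<le> x" 0 m] that u0 by (simp add: f_def)
  have ge: "j \<le> f x" if "x \<le> n" "j \<le> m" "u j \<le> x" for x j
    using Greatest_le_nat[of "\<lambda>j. j \<le> m \<and> u j \<le> x" j m] that by (simp add: f_def)
  have galois: "u j \<le> x \<longleftrightarrow> j \<le> f x" if "x \<le> n" "j \<le> m + 1" for x j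
  proof
    assume "u j \<le> x"
    \<comment> \<open>The index \<open>m + 1\<close> does not compete in the definition of
      \<open>f x\<close>; it is excluded here because \<open>u (m + 1) = n + 1\<close> exceeds
      \<open>x\<close>.\<close>
    then have "j \<noteq> m + 1" using u1 that by auto
    then show "j \<le> f x" using ge \<open>u j \<le> x\<close> that by simp
  next
    assume "j \<le> f x"
    then show "u j \<le> x" using P[OF that(1)] mono[of j "f x"] by simp
  qed
  have "mono_on {..n} f"
    using P ge by (intro mono_onI) (meson atMost_iff order_trans)
  then have f: "f \<in> Hom delta n m"
    using P by (auto simp: Hom_delta_iff PiE_iff) (simp add: f_def)
  show ?thesis
    by (rule that[OF f], rule star_map_apply_eqI[OF f]) (use galois mono in auto)
qed


section \<open>Tensor products\<close>

lemma presheaves_Obj: "Y \<in> Obj presheaves \<longleftrightarrow> is_functor (op_cat delta) sets Y"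
  by (simp add: presheaves_def functor_cat_def)

lemma presheaf_Fm_in:
  assumes "Y \<in> Obj presheaves" "f \<in> Hom delta n m" "y \<in> Fo Y m"
  shows "Fm Y m n f y \<in> Fo Y n"
proof -
  have "Fm Y m n f \<in> Hom sets (Fo Y m) (Fo Y n)"
    using assms by (simp add: presheaves_Obj is_functor_def op_cat_def delta_def)
  then show ?thesis using assms(3) by (auto simp: sets_def)
qed

lemma presheaf_Comp:
  assumes "Y \<in> Obj presheaves" "f \<in> Hom delta n m" "g \<in> Hom delta m l" "y \<in> Fo Y l"
  shows "Fm Y l n (Comp delta n m l g f) y = Fm Y m n f (Fm Y l m g y)"
proof -
  have "Fm Y l n (Comp delta n m l g f) = Comp sets (Fo Y l) (Fo Y m) (Fo Y n) (Fm Y m n f) (Fm Y l m g)"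
    using assms by (simp add: presheaves_Obj is_functor_def op_cat_def delta_def)
  then show ?thesis using assms(4) by (simp add: sets_def compose_def)
qed

lemma presheaf_Hom_iff:
  "\<eta> \<in> Hom presheaves Y Z \<longleftrightarrow> (\<forall>n. \<eta> n \<in> Fo Y n \<rightarrow>\<^sub>E Fo Z n) \<and>
     (\<forall>n m. \<forall>f\<in>Hom delta n m.
        compose (Fo Y m) (\<eta> n) (Fm Y m n f) = compose (Fo Y m) (Fm Z m n f) (\<eta> m))"
  by (auto simp: presheaves_def functor_cat_def nat_trans_def op_cat_def delta_def sets_def PiE_iff)

lemma presheaf_Hom_in: "\<eta> \<in> Hom presheaves Y Z \<Longrightarrow> y \<in> Fo Y n \<Longrightarrow> \<eta> n y \<in> Fo Z n"
  by (auto simp: presheaf_Hom_iff)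

lemma presheaf_Hom_natural:
  assumes "\<eta> \<in> Hom presheaves Y Z" "f \<in> Hom delta n m" "y \<in> Fo Y m"
  shows "\<eta> n (Fm Y m n f y) = Fm Z m n f (\<eta> m y)"
proof -
  have "compose (Fo Y m) (\<eta> n) (Fm Y m n f) y = compose (Fo Y m) (Fm Z m n f) (\<eta> m) y"
    using assms by (simp add: presheaf_Hom_iff)
  then show ?thesis using assms(3) by (simp add: compose_def)
qed

lemma covariant_Fm_in:
  assumes "is_functor delta sets F" "f \<in> Hom delta n m" "\<phi> \<in> Fo F n"
  shows "Fm F n m f \<phi> \<in> Fo F m"
proof -
  have "Fm F n m f \<in> Hom sets (Fo F n) (Fo F m)"
    using assms by (simp add: is_functor_def delta_def)
  then show ?thesis using assms(3) by (auto simp: sets_def)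
qed

lemma covariant_Comp:
  assumes "is_functor delta sets F" "f \<in> Hom delta n m" "g \<in> Hom delta m l" "\<phi> \<in> Fo F n"
  shows "Fm F n l (Comp delta n m l g f) \<phi> = Fm F m l g (Fm F n m f \<phi>)"
proof -
  have "Fm F n l (Comp delta n m l g f) = Comp sets (Fo F n) (Fo F m) (Fo F l) (Fm F m l g) (Fm F n m f)"
    using assms by (simp add: is_functor_def delta_def)
  then show ?thesis using assms(4) by (simp add: sets_def compose_def)
qed

section \<open>Germs and maps between tensor products\<close>

lemma equiv_tensor_rel: "equiv (tensor_pairs Y F) (tensor_rel Y F)"
  unfolding tensor_rel_def by (rule equiv_equiv_gen)

definition germ ::
  "'u presheaf \<Rightarrow> (nat, nat \<Rightarrow> nat, 'w set, 'w \<Rightarrow> 'w) cat_functor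
     \<Rightarrow> nat \<Rightarrow> 'u \<Rightarrow> 'w \<Rightarrow> (nat \<times> 'u \<times> 'w) set" where
  "germ Y F n y \<phi> = tensor_rel Y F `` {(n, y, \<phi>)}"

lemma germ_eq_iff:
  assumes "y \<in> Fo Y n" "\<phi> \<in> Fo F n" "y' \<in> Fo Y m" "\<phi>' \<in> Fo F m"
  shows "germ Y F n y \<phi> = germ Y F m y' \<phi>' \<longleftrightarrow> ((n, y, \<phi>), (m, y', \<phi>')) \<in> tensor_rel Y F"
  unfolding germ_def using assms
  by (intro eq_equiv_class_iff[OF equiv_tensor_rel]) (auto simp: tensor_pairs_def)

lemma germ_in_tensor: "y \<in> Fo Y n \<Longrightarrow> \<phi> \<in> Fo F n \<Longrightarrow> germ Y F n y \<phi> \<in> tensor Y F"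
  unfolding germ_def tensor_def by (rule quotientI) (simp add: tensor_pairs_def)

lemma tensor_cases:
  assumes "A \<in> tensor Y F"
  obtains n y \<phi> where "y \<in> Fo Y n" "\<phi> \<in> Fo F n" "A = germ Y F n y \<phi>"
  using assms unfolding tensor_def germ_def by (auto elim!: quotientE simp: tensor_pairs_def)

lemma tensor_generators:
  assumes Y: "Y \<in> Obj presheaves" and F: "is_functor delta sets F"
    and f: "f \<in> Hom delta n m" and "y \<in> Fo Y m" "\<phi> \<in> Fo F n"
  shows "(n, Fm Y m n f y, \<phi>) \<in> tensor_pairs Y F" "(m, y, Fm F n m f \<phi>) \<in> tensor_pairs Y F"
  using assms by (auto simp: tensor_pairs_def presheaf_Fm_in covariant_Fm_in)

lemma germ_transport:
  assumes Y: "Y \<in> Obj presheaves" and F: "is_functor delta sets F"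
    and f: "f \<in> Hom delta n m" and y: "y \<in> Fo Y m" and \<phi>: "\<phi> \<in> Fo F n"
  shows "germ Y F n (Fm Y m n f y) \<phi> = germ Y F m y (Fm F n m f \<phi>)"
proof -
  have "((n, Fm Y m n f y, \<phi>), (m, y, Fm F n m f \<phi>)) \<in> tensor_rel Y F"
    unfolding tensor_rel_def
    by (rule equiv_gen_base) (use f y \<phi> tensor_generators[OF assms] in blast)+
  then show ?thesis
    unfolding germ_def by (rule equiv_class_eq[OF equiv_tensor_rel])
qed

lemma tensor_rel_map:
  assumes Y: "Y \<in> Obj presheaves" and F: "is_functor delta sets F" and E: "equiv B E"
    and h: "\<And>n y \<phi>. y \<in> Fo Y n \<Longrightarrow> \<phi> \<in> Fo F n \<Longrightarrow> h (n, y, \<phi>) \<in> B"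
    and step: "\<And>n m f y \<phi>. f \<in> Hom delta n m \<Longrightarrow> y \<in> Fo Y m \<Longrightarrow> \<phi> \<in> Fo F n \<Longrightarrow>
      (h (n, Fm Y m n f y, \<phi>), h (m, y, Fm F n m f \<phi>)) \<in> E"
    and "(p, q) \<in> tensor_rel Y F"
  shows "(h p, h q) \<in> E"
proof (rule equiv_gen_map[OF assms(6)[unfolded tensor_rel_def] E])
  show "h \<in> tensor_pairs Y F \<rightarrow> B" using h by (auto simp: tensor_pairs_def)
qed (use step tensor_generators[OF Y F] in auto)

text \<open>The level is allowed to move from \<open>n\<close> to \<open>r n\<close>. Maps induced
  by natural transformations keep it, while the comparison of stalks sends level \<open>n\<close> to
  \<open>k * (n + 1) - 1\<close>; both are covered.\<close>

lemma germ_Image_map: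
  assumes Y: "Y \<in> Obj presheaves" and F: "is_functor delta sets F"
    and h: "\<And>n y \<phi>. y \<in> Fo Y n \<Longrightarrow> \<phi> \<in> Fo F n \<Longrightarrow>
      s n \<phi> \<in> Fo G (r n) \<and> \<eta> n y \<in> Fo Z (r n)"
    and step: "\<And>n m f y \<phi>. f \<in> Hom delta n m \<Longrightarrow> y \<in> Fo Y m \<Longrightarrow> \<phi> \<in> Fo F n \<Longrightarrow>
      germ Z G (r n) (\<eta> n (Fm Y m n f y)) (s n \<phi>) = germ Z G (r m) (\<eta> m y) (s m (Fm F n m f \<phi>))"
    and y: "y \<in> Fo Y n" and \<phi>: "\<phi> \<in> Fo F n"
  shows "tensor_rel Z G `` ((\<lambda>(n, y, \<phi>). (r n, \<eta> n y, s n \<phi>)) ` germ Y F n y \<phi>)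
    = germ Z G (r n) (\<eta> n y) (s n \<phi>)"
proof -
  let ?h = "\<lambda>(n, y, \<phi>). (r n, \<eta> n y, s n \<phi>)"
  have "(?h p, ?h q) \<in> tensor_rel Z G" if "(p, q) \<in> tensor_rel Y F" for p q
  proof (rule tensor_rel_map[OF Y F equiv_tensor_rel _ _ that])
    fix n y \<phi> assume "y \<in> Fo Y n" "\<phi> \<in> Fo F n"
    then show "?h (n, y, \<phi>) \<in> tensor_pairs Z G" using h by (simp add: tensor_pairs_def)
  next
    fix n m f y \<phi> assume *: "f \<in> Hom delta n m" "y \<in> Fo Y m" "\<phi> \<in> Fo F n"
    show "(?h (n, Fm Y m n f y, \<phi>), ?h (m, y, Fm F n m f \<phi>)) \<in> tensor_rel Z G"
      using step[OF *] h[OF presheaf_Fm_in[OF Y *(1,2)] *(3)]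
        h[OF *(2) covariant_Fm_in[OF F *(1,3)]] by (simp add: germ_eq_iff)
  qed
  from Image_image_class[OF equiv_tensor_rel equiv_tensor_rel _ this, of "(n, y, \<phi>)"] y \<phi>
  show ?thesis by (simp add: germ_def tensor_pairs_def)
qed

lemma tensor_map_germ:
  assumes Y: "Y \<in> Obj presheaves" and F: "is_functor delta sets F"
    and Z: "Z \<in> Obj presheaves" and G: "is_functor delta sets G"
    and \<eta>: "\<And>n y. y \<in> Fo Y n \<Longrightarrow> \<eta> n y \<in> Fo Z n"
    and \<eta>_nat: "\<And>n m f y. f \<in> Hom delta n m \<Longrightarrow> y \<in> Fo Y m \<Longrightarrow>
      \<eta> n (Fm Y m n f y) = Fm Z m n f (\<eta> m y)"
    and \<theta>: "\<And>n \<phi>. \<phi> \<in> Fo F n \<Longrightarrow> \<theta> n \<phi> \<in> Fo G n"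
    and \<theta>_nat: "\<And>n m f \<phi>. f \<in> Hom delta n m \<Longrightarrow> \<phi> \<in> Fo F n \<Longrightarrow>
      \<theta> m (Fm F n m f \<phi>) = Fm G n m f (\<theta> n \<phi>)"
    and y: "y \<in> Fo Y n" and \<phi>: "\<phi> \<in> Fo F n"
  shows "tensor_map Y F Z G \<eta> \<theta> (germ Y F n y \<phi>) = germ Z G n (\<eta> n y) (\<theta> n \<phi>)"
proof -
  have "tensor_rel Z G `` ((\<lambda>(n, y, \<phi>). (n, \<eta> n y, \<theta> n \<phi>)) ` germ Y F n y \<phi>)
    = germ Z G n (\<eta> n y) (\<theta> n \<phi>)"
    by (rule germ_Image_map[OF Y F _ _ y \<phi>])
      (simp_all add: \<theta> \<eta> \<theta>_nat \<eta>_nat germ_transport[OF Z G])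
  then show ?thesis by (simp add: tensor_map_def germ_in_tensor[OF y \<phi>])
qed

text \<open>There is at most one arrow from a free element to any other element in the category of
  elements of \<open>F\<close>: the equation \<open>Fm F n m f \<chi> = \<psi>\<close> determines
  \<open>f\<close>. This is how equalities of arrows are extracted from equalities of
  elements.\<close>

definition free_element ::
  "(nat, nat \<Rightarrow> nat, 'w set, 'w \<Rightarrow> 'w) cat_functor \<Rightarrow> nat \<Rightarrow> 'w \<Rightarrow> bool" where
  "free_element F n \<chi> \<longleftrightarrow> \<chi> \<in> Fo F n \<and>
     (\<forall>m. \<forall>f\<in>Hom delta n m. \<forall>g\<in>Hom delta n m. Fm F n m f \<chi> = Fm F n m g \<chi> \<longrightarrow> f = g)"

text \<open>This is stronger than flatness: the refinements can be chosen free, which yields the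
  equalizing condition on the category of elements at the same time.\<close>

locale freely_filtered =
  fixes F :: "(nat, nat \<Rightarrow> nat, 'w set, 'w \<Rightarrow> 'w) cat_functor"
  assumes functorial: "is_functor delta sets F"
    and nonempty: "\<exists>n. Fo F n \<noteq> {}"
    and refine: "\<And>\<phi> n \<phi>' m. \<phi> \<in> Fo F n \<Longrightarrow> \<phi>' \<in> Fo F m \<Longrightarrow>
      \<exists>l \<chi> f g. free_element F l \<chi> \<and> f \<in> Hom delta l n \<and> g \<in> Hom delta l m \<and>
        Fm F l n f \<chi> = \<phi> \<and> Fm F l m g \<chi> = \<phi>'"
begin

text \<open>Equality of germs in one step: two representatives become equal over one common
  refinement. The arrows go from the refining level \<open>l\<close> to \<open>n\<close> and
  \<open>m\<close>, so they push \<open>\<psi>\<close> forward and pull \<open>y\<close> and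
  \<open>y'\<close> back.\<close>

definition germ_equiv :: "'u presheaf \<Rightarrow> (nat \<times> 'u \<times> 'w) rel" where
  "germ_equiv Y = {((n, y, \<phi>), (m, y', \<phi>')).
     y \<in> Fo Y n \<and> y' \<in> Fo Y m \<and> (\<exists>l \<psi> f g. \<psi> \<in> Fo F l \<and> f \<in> Hom delta l n \<and> g \<in> Hom delta l m \<and>
       Fm F l n f \<psi> = \<phi> \<and> Fm F l m g \<psi> = \<phi>' \<and> Fm Y n l f y = Fm Y m l g y')}"

text \<open>Transitivity carries the content. The two given refinements both map to the middle
  element \<open>\<phi>'\<close>; a free \<open>\<chi>\<close> above both of them makes the two
  composites into \<open>[m]\<close> equal, so that the two restrictions of \<open>y'\<close> can be
  identified.\<close>

lemma equiv_germ_equiv: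
  assumes Y: "Y \<in> Obj presheaves"
  shows "equiv (tensor_pairs Y F) (germ_equiv Y)"
proof (rule equivI)
  show "germ_equiv Y \<subseteq> tensor_pairs Y F \<times> tensor_pairs Y F"
    by (auto simp: germ_equiv_def tensor_pairs_def covariant_Fm_in[OF functorial])
  show "refl_on (tensor_pairs Y F) (germ_equiv Y)"
  proof (rule refl_onI)
    fix p assume "p \<in> tensor_pairs Y F"
    then obtain n y \<phi> where p: "p = (n, y, \<phi>)" "y \<in> Fo Y n" "\<phi> \<in> Fo F n"
      by (auto simp: tensor_pairs_def)
    from refine[OF p(3) p(3)] show "(p, p) \<in> germ_equiv Y"
      using p unfolding germ_equiv_def free_element_def by blast
  qed
  show "sym (germ_equiv Y)"
    by (rule symI) (auto simp: germ_equiv_def, metis)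
  show "trans (germ_equiv Y)"
  proof (rule transI)
    fix p q r assume "(p, q) \<in> germ_equiv Y" "(q, r) \<in> germ_equiv Y"
    then obtain n y \<phi> m y' \<phi>' k y'' \<phi>'' l \<psi> f g l' \<psi>' f' g' where
      p: "p = (n, y, \<phi>)" "q = (m, y', \<phi>')" "r = (k, y'', \<phi>'')"
        "y \<in> Fo Y n" "y' \<in> Fo Y m" "y'' \<in> Fo Y k" and
      1: "\<psi> \<in> Fo F l" "f \<in> Hom delta l n" "g \<in> Hom delta l m"
        "Fm F l n f \<psi> = \<phi>" "Fm F l m g \<psi> = \<phi>'" "Fm Y n l f y = Fm Y m l g y'" and
      2: "\<psi>' \<in> Fo F l'" "f' \<in> Hom delta l' m" "g' \<in> Hom delta l' k"
        "Fm F l' m f' \<psi>' = \<phi>'" "Fm F l' k g' \<psi>' = \<phi>''" "Fm Y m l' f' y' = Fm Y k l' g' y''"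
      by (auto simp: germ_equiv_def)
    from refine[OF 1(1) 2(1)] obtain j \<chi> h h' where
      \<chi>: "free_element F j \<chi>" and h: "h \<in> Hom delta j l" "h' \<in> Hom delta j l'"
        "Fm F j l h \<chi> = \<psi>" "Fm F j l' h' \<chi> = \<psi>'" by blast
    note C = covariant_Comp[OF functorial]
    have \<chi>F: "\<chi> \<in> Fo F j" using \<chi> by (simp add: free_element_def)
    have "Fm F j m (Comp delta j l m g h) \<chi> = Fm F j m (Comp delta j l' m f' h') \<chi>"
      using 1 2 h \<chi>F by (simp add: C)
    then have eq: "Comp delta j l m g h = Comp delta j l' m f' h'"
      using \<chi> 1(3) 2(2) h(1,2) Comp_delta_Hom unfolding free_element_def by blast
    have "Fm Y n j (Comp delta j l n f h) y = Fm Y m j (Comp delta j l m g h) y'"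
      using p(4,5) 1 h by (simp add: presheaf_Comp[OF Y])
    also have "\<dots> = Fm Y k j (Comp delta j l' k g' h') y''"
      unfolding eq using p(5,6) 2 h by (simp add: presheaf_Comp[OF Y])
    finally have "Fm Y n j (Comp delta j l n f h) y = Fm Y k j (Comp delta j l' k g' h') y''" .
    moreover have "Fm F j n (Comp delta j l n f h) \<chi> = \<phi>" "Fm F j k (Comp delta j l' k g' h') \<chi> = \<phi>''"
      using 1 2 h \<chi>F by (simp_all add: C)
    ultimately show "(p, r) \<in> germ_equiv Y"
      using p \<chi>F Comp_delta_Hom[OF h(1) 1(2)] Comp_delta_Hom[OF h(2) 2(3)]
      unfolding germ_equiv_def by blast
  qed
qed

text \<open>The relation \<open>germ_equiv\<close> contains the generators, hence
  \<open>tensor_rel\<close>, but it allows different arrows \<open>f\<close> and \<open>g\<close>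
  for the two sections. As both carry \<open>\<psi>\<close> to the same \<open>\<phi>\<close>, a
  free element above \<open>\<psi>\<close> makes them equal, so one arrow serves both.\<close>

lemma germ_eqD:
  assumes Y: "Y \<in> Obj presheaves" and y: "y \<in> Fo Y n" and y': "y' \<in> Fo Y n"
    and \<phi>: "\<phi> \<in> Fo F n" and eq: "germ Y F n y \<phi> = germ Y F n y' \<phi>"
  obtains l \<psi> f where "\<psi> \<in> Fo F l" "f \<in> Hom delta l n" "Fm F l n f \<psi> = \<phi>"
    "Fm Y n l f y = Fm Y n l f y'"
proof -
  have "((n, y, \<phi>), (n, y', \<phi>)) \<in> tensor_rel Y F"
    using eq y y' \<phi> by (simp add: germ_eq_iff)
  also have "\<dots> \<subseteq> germ_equiv Y"
    unfolding tensor_rel_def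
  proof (rule equiv_gen_least[OF equiv_germ_equiv[OF Y]], clarify)
    fix n m f y \<phi> assume f: "f \<in> Hom delta n m" and y: "y \<in> Fo Y m" and \<phi>: "\<phi> \<in> Fo F n"
    from refine[OF \<phi> \<phi>] obtain l \<chi> h where
      \<chi>: "\<chi> \<in> Fo F l" and h: "h \<in> Hom delta l n" "Fm F l n h \<chi> = \<phi>"
      by (auto simp: free_element_def)
    have "Fm F l m (Comp delta l n m f h) \<chi> = Fm F n m f \<phi>"
      using covariant_Comp[OF functorial h(1) f \<chi>] h(2) by simp
    moreover have "Fm Y n l h (Fm Y m n f y) = Fm Y m l (Comp delta l n m f h) y"
      using presheaf_Comp[OF Y h(1) f y] by simp
    ultimately show "((n, Fm Y m n f y, \<phi>), (m, y, Fm F n m f \<phi>)) \<in> germ_equiv Y"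
      using h f y \<chi> presheaf_Fm_in[OF Y f y] Comp_delta_Hom[OF h(1) f]
      unfolding germ_equiv_def by blast
  qed
  finally obtain l \<psi> f g where *: "\<psi> \<in> Fo F l" "f \<in> Hom delta l n" "g \<in> Hom delta l n"
    "Fm F l n f \<psi> = \<phi>" "Fm F l n g \<psi> = \<phi>" "Fm Y n l f y = Fm Y n l g y'"
    by (auto simp: germ_equiv_def)
  \<comment> \<open>The element \<open>\<psi>\<close> is refined against itself just to have a free
    element above it.\<close>
  from refine[OF *(1) *(1)] obtain j \<chi> h where
    \<chi>: "free_element F j \<chi>" and h: "h \<in> Hom delta j l" "Fm F j l h \<chi> = \<psi>" by blast
  have \<chi>F: "\<chi> \<in> Fo F j" using \<chi> by (simp add: free_element_def)
  have fh: "Fm F j n (Comp delta j l n f h) \<chi> = \<phi>" "Fm F j n (Comp delta j l n g h) \<chi> = \<phi>"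
    using * h \<chi>F by (simp_all add: covariant_Comp[OF functorial])
  then have eq: "Comp delta j l n f h = Comp delta j l n g h"
    using \<chi> Comp_delta_Hom[OF h(1) *(2)] Comp_delta_Hom[OF h(1) *(3)]
    unfolding free_element_def by simp
  have "Fm Y n j (Comp delta j l n f h) y = Fm Y n j (Comp delta j l n g h) y'"
    using y y' * h by (simp add: presheaf_Comp[OF Y])
  then show ?thesis
    using that[OF \<chi>F Comp_delta_Hom[OF h(1) *(2)] fh(1)] by (simp add: eq)
qed

text \<open>Two presheaves are allowed because pullbacks and coproducts compare elements of stalks
  of different presheaves; the common refinement is taken in \<open>F\<close> and does not depend on
  them.\<close>

lemma common_germs:
  assumes Y: "Y \<in> Obj presheaves" and Z: "Z \<in> Obj presheaves"
    and "A \<in> tensor Y F" "B \<in> tensor Z F"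
  obtains n \<phi> y z where "\<phi> \<in> Fo F n" "y \<in> Fo Y n" "z \<in> Fo Z n"
    "A = germ Y F n y \<phi>" "B = germ Z F n z \<phi>"
proof -
  obtain n y \<phi> where A: "y \<in> Fo Y n" "\<phi> \<in> Fo F n" "A = germ Y F n y \<phi>"
    using assms(3) by (rule tensor_cases)
  obtain m z \<psi> where B: "z \<in> Fo Z m" "\<psi> \<in> Fo F m" "B = germ Z F m z \<psi>"
    using assms(4) by (rule tensor_cases)
  obtain l \<chi> f g where "\<chi> \<in> Fo F l" "f \<in> Hom delta l n" "g \<in> Hom delta l m"
    "Fm F l n f \<chi> = \<phi>" "Fm F l m g \<chi> = \<psi>"
    using refine[OF A(2) B(2)] by (auto simp: free_element_def)
  then show ?thesis
    using that[of \<chi> l "Fm Y n l f y" "Fm Z m l g z"] A B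
      germ_transport[OF Y functorial, of f l n y \<chi>] germ_transport[OF Z functorial, of g l m z \<chi>]
    by (simp add: presheaf_Fm_in[OF Y] presheaf_Fm_in[OF Z])
qed

end

section \<open>Exactness of tensoring with a freely filtered functor\<close>

definition tensor_functor ::
  "(nat, nat \<Rightarrow> nat, 'w set, 'w \<Rightarrow> 'w) cat_functor \<Rightarrow> ('u, (nat \<times> 'u \<times> 'w) set) topos_functor" where
  "tensor_functor F = \<lparr>Fo = (\<lambda>Y. tensor Y F), Fm = (\<lambda>Y Z \<eta>. tensor_map Y F Z F \<eta> (\<lambda>n \<phi>. \<phi>))\<rparr>"

lemma tensor_functor_simps:
  "Fo (tensor_functor F) Y = tensor Y F"
  "Fm (tensor_functor F) Y Z \<eta> = tensor_map Y F Z F \<eta> (\<lambda>n \<phi>. \<phi>)"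
  by (simp_all add: tensor_functor_def)

lemma tensor_functor_germ:
  assumes "is_functor delta sets F" "Y \<in> Obj presheaves" "Z \<in> Obj presheaves"
    "\<eta> \<in> Hom presheaves Y Z" "y \<in> Fo Y n" "\<phi> \<in> Fo F n"
  shows "tensor_map Y F Z F \<eta> (\<lambda>n \<phi>. \<phi>) (germ Y F n y \<phi>) = germ Z F n (\<eta> n y) \<phi>"
  by (rule tensor_map_germ) (use assms in \<open>simp_all add: presheaf_Hom_in presheaf_Hom_natural\<close>)

lemma tensor_map_extensional: "tensor_map Y F Z G \<eta> \<theta> \<in> extensional (tensor Y F)"
  by (simp add: tensor_map_def)

lemma presheaves_Ident: "Ident presheaves Y n = (\<lambda>y\<in>Fo Y n. y)"
  by (simp add: presheaves_def functor_cat_def op_cat_def delta_def sets_def)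

lemma presheaves_Ident_Hom:
  assumes "Y \<in> Obj presheaves" shows "Ident presheaves Y \<in> Hom presheaves Y Y"
  unfolding presheaf_Hom_iff
  using presheaf_Fm_in[OF assms] by (auto simp: presheaves_Ident compose_def)

lemma presheaves_Comp: "Comp presheaves X Y Z \<theta> \<eta> n = compose (Fo X n) (\<theta> n) (\<eta> n)"
  by (simp add: presheaves_def functor_cat_def op_cat_def delta_def sets_def)

lemma presheaves_Comp_Hom:
  assumes X: "X \<in> Obj presheaves" and \<eta>: "\<eta> \<in> Hom presheaves X Y" and \<theta>: "\<theta> \<in> Hom presheaves Y Z"
  shows "Comp presheaves X Y Z \<theta> \<eta> \<in> Hom presheaves X Z"
  unfolding presheaf_Hom_iff presheaves_Comp
  using presheaf_Fm_in[OF X] presheaf_Hom_in[OF \<eta>] presheaf_Hom_in[OF \<theta>]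
    presheaf_Hom_natural[OF \<eta>] presheaf_Hom_natural[OF \<theta>]
  by (auto simp: compose_def fun_eq_iff)

context freely_filtered begin

lemma is_functor_tensor_functor:
  "is_functor (presheaves :: ('u presheaf, nat \<Rightarrow> 'u \<Rightarrow> 'u) category) sets (tensor_functor F)"
  unfolding is_functor_def tensor_functor_simps
proof (intro conjI ballI)
  fix Y Z :: "'u presheaf" and \<eta>
  assume *: "Y \<in> Obj presheaves" "Z \<in> Obj presheaves" "\<eta> \<in> Hom presheaves Y Z"
  show "tensor_map Y F Z F \<eta> (\<lambda>n \<phi>. \<phi>) \<in> Hom sets (tensor Y F) (tensor Z F)"
    by (auto simp: sets_def PiE_iff tensor_map_extensional tensor_functor_germ[OF functorial *]
        intro!: germ_in_tensor presheaf_Hom_in[OF *(3)] elim!: tensor_cases)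
next
  fix Y :: "'u presheaf" assume Y: "Y \<in> Obj presheaves"
  show "tensor_map Y F Y F (Ident presheaves Y) (\<lambda>n \<phi>. \<phi>) = Ident sets (tensor Y F)"
  proof (rule extensionalityI[OF tensor_map_extensional])
    show "Ident sets (tensor Y F) \<in> extensional (tensor Y F)" by (simp add: sets_def)
    fix A assume "A \<in> tensor Y F"
    then show "tensor_map Y F Y F (Ident presheaves Y) (\<lambda>n \<phi>. \<phi>) A = Ident sets (tensor Y F) A"
      by (elim tensor_cases) (simp add: tensor_functor_germ[OF functorial Y Y presheaves_Ident_Hom[OF Y]]
        sets_def germ_in_tensor presheaves_Ident)
  qed
next
  fix X Y Z :: "'u presheaf" and \<eta> \<theta>
  assume X: "X \<in> Obj presheaves" and Y: "Y \<in> Obj presheaves" and Z: "Z \<in> Obj presheaves"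
    and \<eta>: "\<eta> \<in> Hom presheaves X Y" and \<theta>: "\<theta> \<in> Hom presheaves Y Z"
  show "tensor_map X F Z F (Comp presheaves X Y Z \<theta> \<eta>) (\<lambda>n \<phi>. \<phi>) =
    Comp sets (tensor X F) (tensor Y F) (tensor Z F) (tensor_map Y F Z F \<theta> (\<lambda>n \<phi>. \<phi>))
      (tensor_map X F Y F \<eta> (\<lambda>n \<phi>. \<phi>))" (is "?l = ?r")
  proof (rule extensionalityI[OF tensor_map_extensional])
    show "?r \<in> extensional (tensor X F)" by (simp add: sets_def)
    fix A assume "A \<in> tensor X F"
    then show "?l A = ?r A"
      by (elim tensor_cases) (simp add: tensor_functor_germ[OF functorial] X Y Z \<eta> \<theta>
        presheaves_Comp_Hom[OF X \<eta> \<theta>] sets_def compose_def germ_in_tensor presheaves_Comp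
        presheaf_Hom_in[OF \<eta>])
  qed
qed (simp_all add: sets_def)

text \<open>Finitely many elements, and finitely many equations between germs, can be realized at
  one level, where the hypothesis on sets applies.\<close>

lemma preserves_finite_limits_tensor_functor:
  "preserves_finite_limits (tensor_functor F :: ('u, (nat \<times> 'u \<times> 'w) set) topos_functor)"
  unfolding preserves_finite_limits_def tensor_functor_simps
proof (intro conjI ballI impI)
  fix Y :: "'u presheaf" assume Y: "Y \<in> Obj presheaves" and s: "\<forall>n. is_singleton (Fo Y n)"
  \<comment> \<open>If all \<open>Fo F n\<close> were empty, every stalk would be empty:
    preservation of the terminal object rests on \<open>nonempty\<close>.\<close>
  obtain n \<phi> where \<phi>: "\<phi> \<in> Fo F n" using nonempty by blast
  obtain y where y: "y \<in> Fo Y n" using s by (auto simp: is_singleton_def)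
  show "is_singleton (tensor Y F)"
  proof (rule is_singletonI')
    show "tensor Y F \<noteq> {}" using germ_in_tensor[of y Y n \<phi> F] y \<phi> by blast
    fix A B assume "A \<in> tensor Y F" "B \<in> tensor Y F"
    then obtain m \<psi> a b where "a \<in> Fo Y m" "b \<in> Fo Y m" "A = germ Y F m a \<psi>" "B = germ Y F m b \<psi>"
      by (rule common_germs[OF Y Y])
    moreover have "is_singleton (Fo Y m)" using s by blast
    ultimately show "A = B" by (auto simp: is_singleton_def)
  qed
next
  fix W X Y Z :: "'u presheaf" and p q f g
  assume W: "W \<in> Obj presheaves" and X: "X \<in> Obj presheaves"
    and Y: "Y \<in> Obj presheaves" and Z: "Z \<in> Obj presheaves"
    and p: "p \<in> Hom presheaves W X" and q: "q \<in> Hom presheaves W Y"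
    and f: "f \<in> Hom presheaves X Z" and g: "g \<in> Hom presheaves Y Z"
    and pb: "\<forall>n. set_pullback (Fo W n) (Fo X n) (Fo Y n) (p n) (q n) (f n) (g n)"
  let ?m = "\<lambda>Y Z \<eta>. tensor_map Y F Z F \<eta> (\<lambda>n \<phi>. \<phi>)"
  note P = tensor_functor_germ[OF functorial W X p] and Q = tensor_functor_germ[OF functorial W Y q]
    and F = tensor_functor_germ[OF functorial X Z f] and G = tensor_functor_germ[OF functorial Y Z g]
  have inj: "w = w'" if "w \<in> Fo W n" "w' \<in> Fo W n" "p n w = p n w'" "q n w = q n w'" for n w w'
    using pb that unfolding set_pullback_def bij_betw_def inj_on_def by simp
  have comm: "f n (p n w) = g n (q n w)" if "w \<in> Fo W n" for n w
    using pb that unfolding set_pullback_def bij_betw_def by blast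
  have surj: "\<exists>w\<in>Fo W n. x = p n w \<and> y = q n w"
    if "x \<in> Fo X n" "y \<in> Fo Y n" "f n x = g n y" for n x y
  proof -
    have "(x, y) \<in> (\<lambda>w. (p n w, q n w)) ` Fo W n"
      using pb that unfolding set_pullback_def bij_betw_def by simp
    then show ?thesis by auto
  qed
  show "set_pullback (tensor W F) (tensor X F) (tensor Y F) (?m W X p) (?m W Y q) (?m X Z f) (?m Y Z g)"
    unfolding set_pullback_def bij_betw_def
  proof (intro conjI)
    show "inj_on (\<lambda>w. (?m W X p w, ?m W Y q w)) (tensor W F)"
    proof (rule inj_onI)
      fix A B assume A: "A \<in> tensor W F" and B: "B \<in> tensor W F"
        and eq: "(?m W X p A, ?m W Y q A) = (?m W X p B, ?m W Y q B)"
      obtain n \<phi> w w' where 1: "\<phi> \<in> Fo F n" "w \<in> Fo W n" "w' \<in> Fo W n"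
        "A = germ W F n w \<phi>" "B = germ W F n w' \<phi>" using common_germs[OF W W A B] .
      \<comment> \<open>The two equations are realized one after the other: a first restriction
        equalizes the images under \<open>p\<close>, a second one, starting from the restricted
        \<open>v\<close> and \<open>v'\<close>, those under \<open>q\<close>. The first equality
        survives the second restriction.\<close>
      have "germ X F n (p n w) \<phi> = germ X F n (p n w') \<phi>" using eq 1 by (simp add: P)
      then obtain l \<psi> h where 2: "\<psi> \<in> Fo F l" "h \<in> Hom delta l n" "Fm F l n h \<psi> = \<phi>"
        "Fm X n l h (p n w) = Fm X n l h (p n w')"
        by (rule germ_eqD[OF X presheaf_Hom_in[OF p 1(2)] presheaf_Hom_in[OF p 1(3)] 1(1)])
      define v v' where "v = Fm W n l h w" and "v' = Fm W n l h w'"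
      have v: "v \<in> Fo W l" "v' \<in> Fo W l" "p l v = p l v'"
        using 1 2 by (simp_all add: v_def v'_def presheaf_Fm_in[OF W] presheaf_Hom_natural[OF p])
      have AB: "A = germ W F l v \<psi>" "B = germ W F l v' \<psi>"
        using 1 2 by (simp_all add: v_def v'_def germ_transport[OF W functorial])
      have "germ Y F l (q l v) \<psi> = germ Y F l (q l v') \<psi>" using eq 2 v AB by (simp add: Q)
      then obtain r \<chi> k where 3: "\<chi> \<in> Fo F r" "k \<in> Hom delta r l" "Fm F r l k \<chi> = \<psi>"
        "Fm Y l r k (q l v) = Fm Y l r k (q l v')"
        by (rule germ_eqD[OF Y presheaf_Hom_in[OF q v(1)] presheaf_Hom_in[OF q v(2)] 2(1)])
      have "Fm W l r k v = Fm W l r k v'"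
        by (rule inj[of _ r]) (use v 3 in \<open>simp_all add: presheaf_Fm_in[OF W] presheaf_Hom_natural[OF p]
          presheaf_Hom_natural[OF q]\<close>)
      then show "A = B"
        using germ_transport[OF W functorial 3(2) v(1) 3(1)] germ_transport[OF W functorial 3(2) v(2) 3(1)]
        by (simp add: AB 3(3))
    qed
  next
    show "(\<lambda>w. (?m W X p w, ?m W Y q w)) ` tensor W F =
      {(x, y). x \<in> tensor X F \<and> y \<in> tensor Y F \<and> ?m X Z f x = ?m Y Z g y}"
    proof (intro equalityI subsetI)
      fix c assume "c \<in> (\<lambda>w. (?m W X p w, ?m W Y q w)) ` tensor W F"
      then show "c \<in> {(x, y). x \<in> tensor X F \<and> y \<in> tensor Y F \<and> ?m X Z f x = ?m Y Z g y}"
        by (auto simp: P Q F G comm presheaf_Hom_in[OF p] presheaf_Hom_in[OF q]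
            intro!: germ_in_tensor elim!: tensor_cases)
    next
      fix c assume "c \<in> {(x, y). x \<in> tensor X F \<and> y \<in> tensor Y F \<and> ?m X Z f x = ?m Y Z g y}"
      then obtain A B where c: "c = (A, B)" and A: "A \<in> tensor X F" and B: "B \<in> tensor Y F"
        and eq: "?m X Z f A = ?m Y Z g B" by blast
      obtain n \<phi> x y where 1: "\<phi> \<in> Fo F n" "x \<in> Fo X n" "y \<in> Fo Y n"
        "A = germ X F n x \<phi>" "B = germ Y F n y \<phi>" using common_germs[OF X Y A B] .
      have "germ Z F n (f n x) \<phi> = germ Z F n (g n y) \<phi>" using eq 1 by (simp add: F G)
      then obtain l \<psi> h where 2: "\<psi> \<in> Fo F l" "h \<in> Hom delta l n" "Fm F l n h \<psi> = \<phi>"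
        "Fm Z n l h (f n x) = Fm Z n l h (g n y)"
        by (rule germ_eqD[OF Z presheaf_Hom_in[OF f 1(2)] presheaf_Hom_in[OF g 1(3)] 1(1)])
      \<comment> \<open>The equality in the stalk of \<open>Z\<close> has become an equality at
        level \<open>l\<close>, so the pullback at this level provides \<open>w\<close>.\<close>
      have "f l (Fm X n l h x) = g l (Fm Y n l h y)"
        using 1 2 by (simp add: presheaf_Hom_natural[OF f] presheaf_Hom_natural[OF g])
      then obtain w where w: "w \<in> Fo W l" "Fm X n l h x = p l w" "Fm Y n l h y = q l w"
        using surj presheaf_Fm_in[OF X 2(2) 1(2)] presheaf_Fm_in[OF Y 2(2) 1(3)] by metis
      have "c = (?m W X p (germ W F l w \<psi>), ?m W Y q (germ W F l w \<psi>))"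
        using 1 2 w germ_transport[OF X functorial 2(2) 1(2) 2(1)]
          germ_transport[OF Y functorial 2(2) 1(3) 2(1)] by (simp add: c P Q)
      then show "c \<in> (\<lambda>w. (?m W X p w, ?m W Y q w)) ` tensor W F"
        using germ_in_tensor[OF w(1) 2(1)] by blast
    qed
  qed
qed

text \<open>Surjectivity is checked on a representative. An equality in the stalk of the target is
  realized at some level and decided there by the hypothesis.\<close>

lemma preserves_colimits_tensor_functor:
  "preserves_colimits (tensor_functor F :: ('u, (nat \<times> 'u \<times> 'w) set) topos_functor)"
  unfolding preserves_colimits_def tensor_functor_simps
proof (intro conjI allI ballI impI)
  fix J :: "(nat \<times> 'u) set" and X and \<iota> and Y :: "'u presheaf"
  assume Y: "Y \<in> Obj presheaves"
    and X: "\<forall>i\<in>J. X i \<in> Obj presheaves \<and> \<iota> i \<in> Hom presheaves (X i) Y"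
    and cop: "\<forall>n. set_coproduct J (\<lambda>i. Fo (X i) n) (Fo Y n) (\<lambda>i. \<iota> i n)"
  have \<iota>: "tensor_map (X i) F Y F (\<iota> i) (\<lambda>n \<phi>. \<phi>) (germ (X i) F n x \<phi>) = germ Y F n (\<iota> i n x) \<phi>"
    if "i \<in> J" "x \<in> Fo (X i) n" "\<phi> \<in> Fo F n" for i n x \<phi>
    using that X by (intro tensor_functor_germ[OF functorial _ Y]) auto
  have \<iota>_in: "\<iota> i n x \<in> Fo Y n" if "i \<in> J" "x \<in> Fo (X i) n" for i n x
    by (rule presheaf_Hom_in[of _ "X i"]) (use that X in auto)
  have surj: "\<exists>i\<in>J. \<exists>x\<in>Fo (X i) n. y = \<iota> i n x" if "y \<in> Fo Y n" for n y
  proof -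
    have "y \<in> (\<lambda>(i, x). \<iota> i n x) ` Sigma J (\<lambda>i. Fo (X i) n)"
      using cop that unfolding set_coproduct_def bij_betw_def by simp
    then show ?thesis by auto
  qed
  have inj: "i = i' \<and> x = x'"
    if "i \<in> J" "x \<in> Fo (X i) n" "i' \<in> J" "x' \<in> Fo (X i') n" "\<iota> i n x = \<iota> i' n x'" for n i i' x x'
  proof -
    have "inj_on (\<lambda>(i, x). \<iota> i n x) (Sigma J (\<lambda>i. Fo (X i) n))"
      using cop unfolding set_coproduct_def bij_betw_def by simp
    from inj_onD[OF this, of "(i, x)" "(i', x')"] that show ?thesis by simp
  qed
  show "set_coproduct J (\<lambda>i. tensor (X i) F) (tensor Y F)
    (\<lambda>i. tensor_map (X i) F Y F (\<iota> i) (\<lambda>n \<phi>. \<phi>))"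
    unfolding set_coproduct_def bij_betw_def
  proof (intro conjI inj_onI equalityI subsetI)
    fix u v
    assume "u \<in> Sigma J (\<lambda>i. tensor (X i) F)" "v \<in> Sigma J (\<lambda>i. tensor (X i) F)"
      and eq: "(case u of (i, x) \<Rightarrow> tensor_map (X i) F Y F (\<iota> i) (\<lambda>n \<phi>. \<phi>) x) =
        (case v of (i, x) \<Rightarrow> tensor_map (X i) F Y F (\<iota> i) (\<lambda>n \<phi>. \<phi>) x)"
    then obtain i A i' B where u: "u = (i, A)" "i \<in> J" "A \<in> tensor (X i) F"
      and v: "v = (i', B)" "i' \<in> J" "B \<in> tensor (X i') F" by blast
    have Xi: "X i \<in> Obj presheaves" and Xi': "X i' \<in> Obj presheaves"
      and \<iota>i: "\<iota> i \<in> Hom presheaves (X i) Y" and \<iota>i': "\<iota> i' \<in> Hom presheaves (X i') Y"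
      using X u(2) v(2) by auto
    obtain n \<phi> x x' where 1: "\<phi> \<in> Fo F n" "x \<in> Fo (X i) n" "x' \<in> Fo (X i') n"
      "A = germ (X i) F n x \<phi>" "B = germ (X i') F n x' \<phi>"
      using common_germs[OF Xi Xi' u(3) v(3)] .
    have "germ Y F n (\<iota> i n x) \<phi> = germ Y F n (\<iota> i' n x') \<phi>"
      using eq u v 1 by (simp add: \<iota>)
    then obtain l \<psi> h where 2: "\<psi> \<in> Fo F l" "h \<in> Hom delta l n" "Fm F l n h \<psi> = \<phi>"
      "Fm Y n l h (\<iota> i n x) = Fm Y n l h (\<iota> i' n x')"
      by (rule germ_eqD[OF Y \<iota>_in[OF u(2) 1(2)] \<iota>_in[OF v(2) 1(3)] 1(1)])
    \<comment> \<open>At level \<open>l\<close> the coproduct hypothesis separates the summands, so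
      it yields equality of the indices together with equality of the elements.\<close>
    have "i = i' \<and> Fm (X i) n l h x = Fm (X i') n l h x'"
      by (rule inj[of i _ l]) (use u(2) v(2) 1 2 in \<open>simp_all add: presheaf_Fm_in[OF Xi]
        presheaf_Fm_in[OF Xi'] presheaf_Hom_natural[OF \<iota>i] presheaf_Hom_natural[OF \<iota>i']\<close>)
    moreover have "A = germ (X i) F l (Fm (X i) n l h x) \<psi>"
      using germ_transport[OF Xi functorial 2(2) 1(2) 2(1)] by (simp add: 1 2)
    moreover have "B = germ (X i') F l (Fm (X i') n l h x') \<psi>"
      using germ_transport[OF Xi' functorial 2(2) 1(3) 2(1)] by (simp add: 1 2)
    ultimately show "u = v" using u(1) v(1) by auto
  next
    fix B assume "B \<in> (\<lambda>(i, x). tensor_map (X i) F Y F (\<iota> i) (\<lambda>n \<phi>. \<phi>) x) ` Sigma J (\<lambda>i. tensor (X i) F)"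
    then show "B \<in> tensor Y F"
      by (auto simp: \<iota> intro!: germ_in_tensor elim!: tensor_cases) (auto intro: \<iota>_in)
  next
    fix B assume "B \<in> tensor Y F"
    then obtain n y \<phi> where B: "y \<in> Fo Y n" "\<phi> \<in> Fo F n" "B = germ Y F n y \<phi>" by (rule tensor_cases)
    obtain i x where i: "i \<in> J" "x \<in> Fo (X i) n" "y = \<iota> i n x" using surj[OF B(1)] by blast
    show "B \<in> (\<lambda>(i, x). tensor_map (X i) F Y F (\<iota> i) (\<lambda>n \<phi>. \<phi>) x) ` Sigma J (\<lambda>i. tensor (X i) F)"
      by (rule image_eqI[of _ _ "(i, germ (X i) F n x \<phi>)"]) (use i B in \<open>auto simp: \<iota> germ_in_tensor\<close>)
  qed
next
  fix X Y Q :: "'u presheaf" and f g q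
  assume X: "X \<in> Obj presheaves" and Y: "Y \<in> Obj presheaves" and Q: "Q \<in> Obj presheaves"
    and f: "f \<in> Hom presheaves X Y" and g: "g \<in> Hom presheaves X Y" and q: "q \<in> Hom presheaves Y Q"
    and coeq: "\<forall>n. set_coequalizer (Fo X n) (Fo Y n) (Fo Q n) (f n) (g n) (q n)"
  let ?m = "\<lambda>Y Z \<eta>. tensor_map Y F Z F \<eta> (\<lambda>n \<phi>. \<phi>)"
  let ?R = "{(?m X Y f A, ?m X Y g A) |A. A \<in> tensor X F}"
  note fm = tensor_functor_germ[OF functorial X Y f] and gm = tensor_functor_germ[OF functorial X Y g]
    and qm = tensor_functor_germ[OF functorial Y Q q]
  note f_in = presheaf_Hom_in[OF f] and g_in = presheaf_Hom_in[OF g] and q_in = presheaf_Hom_in[OF q]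
  have surj: "q n ` Fo Y n = Fo Q n" for n using coeq by (simp add: set_coequalizer_def)
  have eq: "q n y = q n y' \<longleftrightarrow> (y, y') \<in> equiv_gen (Fo Y n) {(f n x, g n x) |x. x \<in> Fo X n}"
    if "y \<in> Fo Y n" "y' \<in> Fo Y n" for n y y'
    using coeq that by (simp add: set_coequalizer_def)
  have qfg: "q n (f n x) = q n (g n x)" if "x \<in> Fo X n" for n x
    using that f_in g_in by (subst eq) (auto intro: equiv_gen_base)
  show "set_coequalizer (tensor X F) (tensor Y F) (tensor Q F) (?m X Y f) (?m X Y g) (?m Y Q q)"
    unfolding set_coequalizer_def
  proof (intro conjI ballI iffI)
    show "?m Y Q q ` tensor Y F = tensor Q F"
    proof (intro equalityI subsetI)
      fix B assume "B \<in> ?m Y Q q ` tensor Y F"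
      then show "B \<in> tensor Q F" by (auto simp: qm q_in intro!: germ_in_tensor elim!: tensor_cases)
    next
      fix B assume "B \<in> tensor Q F"
      then obtain n c \<phi> where B: "c \<in> Fo Q n" "\<phi> \<in> Fo F n" "B = germ Q F n c \<phi>" by (rule tensor_cases)
      from B(1) have "c \<in> q n ` Fo Y n" by (simp add: surj)
      then obtain y where "y \<in> Fo Y n" "c = q n y" by auto
      then show "B \<in> ?m Y Q q ` tensor Y F"
        using B by (intro image_eqI[of _ _ "germ Y F n y \<phi>"]) (auto simp: qm germ_in_tensor)
    qed
  next
    fix A B assume A: "A \<in> tensor Y F" and B: "B \<in> tensor Y F" and AB: "?m Y Q q A = ?m Y Q q B"
    obtain n \<phi> y y' where 1: "\<phi> \<in> Fo F n" "y \<in> Fo Y n" "y' \<in> Fo Y n"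
      "A = germ Y F n y \<phi>" "B = germ Y F n y' \<phi>" using common_germs[OF Y Y A B] .
    have "germ Q F n (q n y) \<phi> = germ Q F n (q n y') \<phi>" using AB 1 by (simp add: qm)
    then obtain l \<psi> h where 2: "\<psi> \<in> Fo F l" "h \<in> Hom delta l n" "Fm F l n h \<psi> = \<phi>"
      "Fm Q n l h (q n y) = Fm Q n l h (q n y')"
      by (rule germ_eqD[OF Q q_in[OF 1(2)] q_in[OF 1(3)] 1(1)])
    define v v' where "v = Fm Y n l h y" and "v' = Fm Y n l h y'"
    have v: "v \<in> Fo Y l" "v' \<in> Fo Y l" "q l v = q l v'"
      using 1 2 by (simp_all add: v_def v'_def presheaf_Fm_in[OF Y] presheaf_Hom_natural[OF q])
    have AB: "A = germ Y F l v \<psi>" "B = germ Y F l v' \<psi>"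
      using 1 2 by (simp_all add: v_def v'_def germ_transport[OF Y functorial])
    have "(v, v') \<in> equiv_gen (Fo Y l) {(f l x, g l x) |x. x \<in> Fo X l}" using eq v by blast
    \<comment> \<open>The zigzag at level \<open>l\<close> is pushed into the stalk by taking germs
      at the fixed \<open>\<psi>\<close>, which sends a generator \<open>(f l x, g l x)\<close> to
      the generator given by the germ of \<open>x\<close>.\<close>
    then have "(germ Y F l v \<psi>, germ Y F l v' \<psi>) \<in> equiv_gen (tensor Y F) ?R"
    proof (rule equiv_gen_map[OF _ equiv_equiv_gen])
      show "(\<lambda>y. germ Y F l y \<psi>) \<in> Fo Y l \<rightarrow> tensor Y F" using 2(1) by (auto intro: germ_in_tensor)
      show "{(f l x, g l x) |x. x \<in> Fo X l} \<subseteq> Fo Y l \<times> Fo Y l" using f_in g_in by auto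
      fix a b assume "(a, b) \<in> {(f l x, g l x) |x. x \<in> Fo X l}"
      then obtain x where x: "x \<in> Fo X l" "a = f l x" "b = g l x" by blast
      have "(germ Y F l a \<psi>, germ Y F l b \<psi>) = (?m X Y f (germ X F l x \<psi>), ?m X Y g (germ X F l x \<psi>))"
        using x 2(1) by (simp add: fm gm)
      then have "(germ Y F l a \<psi>, germ Y F l b \<psi>) \<in> ?R" using germ_in_tensor[OF x(1) 2(1)] by blast
      then show "(germ Y F l a \<psi>, germ Y F l b \<psi>) \<in> equiv_gen (tensor Y F) ?R"
        by (rule equiv_gen_base) (use x 2(1) in \<open>simp_all add: f_in g_in germ_in_tensor\<close>)
    qed
    then show "(A, B) \<in> equiv_gen (tensor Y F) ?R" by (simp add: AB)
  next
    fix A B assume AB: "(A, B) \<in> equiv_gen (tensor Y F) ?R"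
    \<comment> \<open>The kernel of the map induced by \<open>q\<close> is an equivalence relation
      that contains the generators.\<close>
    have E: "equiv (tensor Y F) {(A, B) \<in> tensor Y F \<times> tensor Y F. ?m Y Q q A = ?m Y Q q B}"
      by (intro equivI refl_onI symI transI) auto
    have "?R \<subseteq> {(A, B) \<in> tensor Y F \<times> tensor Y F. ?m Y Q q A = ?m Y Q q B}"
      by (auto simp: fm gm qm qfg f_in g_in intro!: germ_in_tensor elim!: tensor_cases)
    from subsetD[OF equiv_gen_least[OF E this] AB] show "?m Y Q q A = ?m Y Q q B" by simp
  qed
qed

lemma tensor_functor_in_points: "tensor_functor F \<in> Obj points"
  by (simp add: points_def full_subcat_def functor_cat_def is_functor_tensor_functor
    preserves_finite_limits_tensor_functor preserves_colimits_tensor_functor)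

end


section \<open>The points associated to intervals\<close>

text \<open>The map \<open>\<phi>\<close> followed by the inverse of \<open>\<chi>\<close> on its
  image is a morphism \<open>u\<close> of finite intervals, and \<open>star_map_full\<close> turns
  it into an arrow of the simplicial category. By contravariance this arrow starts at the level of
  the finer element \<open>\<chi>\<close>.\<close>

lemma interval_hom_factor:
  assumes I: "Linear_order I" and \<chi>: "\<chi> \<in> interval_hom (star n) I" and inj: "inj_on \<chi> {..n + 1}"
    and \<phi>: "\<phi> \<in> interval_hom (star m) I" and sub: "\<phi> ` {..m + 1} \<subseteq> \<chi> ` {..n + 1}"
  obtains f where "f \<in> Hom delta n m" "\<phi> = compose {..m + 1} \<chi> (star_map n m f)"
proof -
  define u where "u = (\<lambda>j\<in>{..m + 1}. the_inv_into {..n + 1} \<chi> (\<phi> j))"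
  have u: "u j \<le> n + 1" "\<chi> (u j) = \<phi> j" if "j \<le> m + 1" for j
  proof -
    have *: "\<phi> j \<in> \<chi> ` {..n + 1}" using sub that by blast
    show "u j \<le> n + 1" using the_inv_into_into[OF inj * subset_refl] that by (simp add: u_def)
    show "\<chi> (u j) = \<phi> j" using f_the_inv_into_f[OF inj *] that by (simp add: u_def)
  qed
  have uI: "u j = i" if "j \<le> m + 1" "i \<le> n + 1" "\<phi> j = \<chi> i" for i j
    using inj_onD[OF inj, of "u j" i] u[OF that(1)] that by simp
  have "u i \<le> u j" if ij: "i \<le> j" "j \<le> m + 1" for i j
  proof (rule ccontr)
    assume lt: "\<not> u i \<le> u j"
    \<comment> \<open>If \<open>u j < u i\<close>, monotonicity of \<open>\<chi>\<close> and of
      \<open>\<phi>\<close> gives opposite inequalities, so \<open>\<phi> i = \<phi> j\<close>, and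
      injectivity of \<open>\<chi>\<close> forces \<open>u i = u j\<close>.\<close>
    have "(\<chi> (u j), \<chi> (u i)) \<in> I"
      using \<chi> lt u(1)[of i] ij unfolding interval_hom_star_iff by auto
    moreover have "(\<phi> i, \<phi> j) \<in> I" using \<phi> ij unfolding interval_hom_star_iff by blast
    ultimately have "\<phi> i = \<phi> j" using Linear_order_antisym[OF I] u(2) ij by simp
    then have "u i = u j" using uI[of i "u j"] u[of j] ij by simp
    then show False using lt by simp
  qed
  moreover have "u 0 = 0" "u (m + 1) = n + 1"
    using \<chi> \<phi> by (auto simp: interval_hom_star_iff intro!: uI)
  moreover have "u \<in> {..m + 1} \<rightarrow>\<^sub>E {..n + 1}" using u(1) by (auto simp: u_def)
  ultimately have "u \<in> interval_hom (star m) (star n)"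
    using u(1) by (simp add: interval_hom_star_iff Field_star ibot_star itop_star star_iff)
  then obtain f where f: "f \<in> Hom delta n m" "\<And>j. j \<le> m + 1 \<Longrightarrow> star_map n m f j = u j"
    using star_map_full by blast
  have "\<phi> = compose {..m + 1} \<chi> (star_map n m f)"
    by (rule extensionalityI[OF interval_hom_extensional[OF \<phi>]])
      (simp_all add: compose_def f(2)[simplified] u(2)[simplified])
  with f(1) show ?thesis by (rule that)
qed

section \<open>Enumeration of finite subsets of an interval\<close>

lemma Linear_order_finite_max:
  assumes I: "Linear_order I" and S: "finite S" "S \<noteq> {}" "S \<subseteq> Field I"
  shows "\<exists>t\<in>S. \<forall>x\<in>S. (x, t) \<in> I"
  using S
proof (induction rule: finite_ne_induct)
  case (singleton x)
  then show ?case using Linear_order_total[OF I, of x x] by simp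
next
  case (insert x S)
  then obtain t where t: "t \<in> S" "\<forall>x\<in>S. (x, t) \<in> I" by auto
  have "(x, x) \<in> I" "(x, t) \<in> I \<or> (t, x) \<in> I"
    using Linear_order_total[OF I, of x] insert.prems t(1) by auto
  then show ?case using t Linear_order_trans[OF I] by blast
qed

text \<open>Induction on the number of elements, splitting off the largest one, which receives the
  last index \<open>c\<close>.\<close>

lemma Linear_order_finite_enumeration:
  assumes I: "Linear_order I" and "finite S" "S \<subseteq> Field I" "card S = c"
  shows "\<exists>\<chi>. bij_betw \<chi> {..<c} S \<and> (\<forall>i j. i \<le> j \<longrightarrow> j < c \<longrightarrow> (\<chi> i, \<chi> j) \<in> I)"
  using assms(2-4)
proof (induction c arbitrary: S)
  case 0
  then show ?case by (auto simp: bij_betw_def)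
next
  case (Suc c)
  then have "S \<noteq> {}" by auto
  then obtain t where t: "t \<in> S" "\<forall>x\<in>S. (x, t) \<in> I"
    using Linear_order_finite_max[OF I Suc.prems(1) _ Suc.prems(2)] by auto
  have "card (S - {t}) = c" using Suc.prems t(1) by simp
  then obtain \<chi> where
    \<chi>: "bij_betw \<chi> {..<c} (S - {t})" "\<forall>i j. i \<le> j \<longrightarrow> j < c \<longrightarrow> (\<chi> i, \<chi> j) \<in> I"
    using Suc.IH[of "S - {t}"] Suc.prems(1,2) by auto
  have "bij_betw (\<chi>(c := t)) {..<c} (S - {t})"
    using \<chi>(1) by (subst bij_betw_cong[of _ _ \<chi>]) auto
  then have "bij_betw (\<chi>(c := t)) ({..<c} \<union> {c}) ((S - {t}) \<union> {t})"
    by (rule bij_betw_combine) (auto simp: bij_betw_def)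
  moreover have eq: "{..<c} \<union> {c} = {..<Suc c}" "(S - {t}) \<union> {t} = S" using t(1) by auto
  moreover have "((\<chi>(c := t)) i, (\<chi>(c := t)) j) \<in> I" if "i \<le> j" "j < Suc c" for i j
  proof (cases "j = c")
    case True
    moreover have "i < c \<Longrightarrow> \<chi> i \<in> S" using bij_betwE[OF \<chi>(1)] by simp
    ultimately show ?thesis using t that by (cases "i = c") auto
  next
    case False
    then show ?thesis using \<chi>(2) that by simp
  qed
  ultimately show ?case unfolding eq by blast
qed

lemma interval_finite_enumeration:
  assumes I: "interval I" and S: "finite S" "S \<subseteq> Field I"
  obtains n \<chi> where "\<chi> \<in> interval_hom (star n) I" "inj_on \<chi> {..n + 1}" "S \<subseteq> \<chi> ` {..n + 1}"
proof -
  note lin = interval_Linear_order[OF I]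
  have b: "ibot I \<in> Field I" "\<And>x. x \<in> Field I \<Longrightarrow> (ibot I, x) \<in> I"
    using interval_ibot[OF I] by (auto simp: is_bot_def)
  have t: "itop I \<in> Field I" "\<And>x. x \<in> Field I \<Longrightarrow> (x, itop I) \<in> I"
    using interval_itop[OF I] by (auto simp: is_top_def)
  define T where "T = insert (ibot I) (insert (itop I) S)"
  have T: "finite T" "T \<subseteq> Field I" using S b t by (auto simp: T_def)
  have "card {ibot I, itop I} \<le> card T" by (rule card_mono[OF T(1)]) (auto simp: T_def)
  then have "2 \<le> card T"
    using interval_ibot_neq_itop[OF I] by (simp add: card_insert_if)
  \<comment> \<open>The interval \<open>star n\<close> has \<open>n + 2\<close> elements. The
    subtraction is exact because \<open>T\<close> contains two different end points.\<close>
  define n where "n = card T - 2"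
  with \<open>2 \<le> card T\<close> have n: "card T = n + 2" by simp
  obtain \<chi> where \<chi>: "bij_betw \<chi> {..<n + 2} T"
    and mono: "\<And>i j. i \<le> j \<Longrightarrow> j < n + 2 \<Longrightarrow> (\<chi> i, \<chi> j) \<in> I"
    using Linear_order_finite_enumeration[OF lin T n] by blast
  have eq: "{..<n + 2} = {..n + 1}" by auto
  have img: "\<chi> ` {..n + 1} = T" and inj: "inj_on \<chi> {..n + 1}"
    using \<chi> unfolding eq by (simp_all add: bij_betw_def)
  have in_F: "\<chi> i \<in> Field I" if "i \<le> n + 1" for i using img T(2) that by blast
  \<comment> \<open>A monotone enumeration of a set containing both end points takes them at the
    first and at the last index.\<close>
  have "ibot I \<in> \<chi> ` {..n + 1}" unfolding img by (simp add: T_def)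
  then obtain i where "i \<le> n + 1" "\<chi> i = ibot I" by auto
  then have 0: "\<chi> 0 = ibot I"
    using Linear_order_antisym[OF lin, of "\<chi> 0" "ibot I"] mono[of 0 i] b(2)[OF in_F, of 0] by simp
  have "itop I \<in> \<chi> ` {..n + 1}" unfolding img by (simp add: T_def)
  then obtain j where "j \<le> n + 1" "\<chi> j = itop I" by auto
  then have 1: "\<chi> (n + 1) = itop I"
    using Linear_order_antisym[OF lin, of "\<chi> (n + 1)" "itop I"] mono[of j "n + 1"]
      t(2)[OF in_F, of "n + 1"] by simp
  let ?\<chi> = "restrict \<chi> {..n + 1}"
  show ?thesis
  proof (rule that[of ?\<chi> n])
    show "?\<chi> \<in> interval_hom (star n) I"
      unfolding interval_hom_star_iff
    proof (intro conjI allI impI)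
      show "?\<chi> \<in> {..n + 1} \<rightarrow>\<^sub>E Field I" using in_F by auto
      show "(?\<chi> i, ?\<chi> j) \<in> I" if "i \<le> j" "j \<le> n + 1" for i j
        using mono[OF that(1)] that by simp
    qed (simp_all add: 0 1[simplified])
    show "inj_on ?\<chi> {..n + 1}" using inj by (simp add: inj_on_def)
    show "S \<subseteq> ?\<chi> ` {..n + 1}" using img by (auto simp: T_def)
  qed
qed

section \<open>Intervals give freely filtered functors, hence points\<close>

lemma interval_hom_compose:
  assumes "f \<in> interval_hom I J" "g \<in> interval_hom J K" "interval I"
  shows "compose (Field I) g f \<in> interval_hom I K"
proof -
  have "ibot I \<in> Field I" "itop I \<in> Field I"
    using interval_ibot[OF assms(3)] interval_itop[OF assms(3)] by (auto simp: is_bot_def is_top_def)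
  moreover have "x \<in> Field I \<and> y \<in> Field I" if "(x, y) \<in> I" for x y using that by (auto simp: Field_def)
  ultimately show ?thesis using assms(1,2) by (auto simp: interval_hom_def compose_def PiE_iff)
qed

lemma interval_star: "interval (star n)"
  unfolding interval_def
  by (intro conjI Linear_order_star exI[of _ 0] exI[of _ "n + 1"])
    (auto simp: is_bot_def is_top_def Field_star star_iff)

lemma flat_functor_Fo: "Fo (flat_functor I) n = interval_hom (star n) I"
  by (simp add: flat_functor_def)

lemma flat_functor_Fm:
  "\<phi> \<in> interval_hom (star n) I \<Longrightarrow>
    Fm (flat_functor I) n m f \<phi> = compose {..m + 1} \<phi> (star_map n m f)"
  by (simp add: flat_functor_def Field_star)

lemma flat_functor_Fm_in:
  assumes "f \<in> Hom delta n m" "\<phi> \<in> interval_hom (star n) I"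
  shows "compose {..m + 1} \<phi> (star_map n m f) \<in> interval_hom (star m) I"
  using interval_hom_compose[OF star_map_Hom[OF assms(1)] assms(2) interval_star]
  by (simp only: Field_star)

lemma is_functor_flat_functor: "is_functor delta sets (flat_functor I)"
  unfolding is_functor_def
proof (intro conjI ballI)
  fix n m f assume "f \<in> Hom delta n m"
  then show "Fm (flat_functor I) n m f \<in> Hom sets (Fo (flat_functor I) n) (Fo (flat_functor I) m)"
    using flat_functor_Fm_in by (auto simp: sets_def flat_functor_def Field_star)
next
  fix n
  have "compose {..n + 1} \<phi> (star_map n n (Ident delta n)) = \<phi>" if "\<phi> \<in> interval_hom (star n) I" for \<phi>
    by (rule extensionalityI[OF _ interval_hom_extensional[OF that]])
      (simp_all add: compose_def star_map_Ident[simplified])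
  then show "Fm (flat_functor I) n n (Ident delta n) = Ident sets (Fo (flat_functor I) n)"
    by (auto simp: sets_def flat_functor_def Field_star fun_eq_iff)
next
  fix n m l f g assume f: "f \<in> Hom delta n m" and g: "g \<in> Hom delta m l"
  have "compose {..l + 1} \<phi> (star_map n l (Comp delta n m l g f)) =
      compose {..l + 1} (compose {..m + 1} \<phi> (star_map n m f)) (star_map m l g)" for \<phi> :: "nat \<Rightarrow> 'a"
    using star_map_le[OF g] by (auto simp: compose_def fun_eq_iff star_map_Comp[OF f g, simplified])
  then show "Fm (flat_functor I) n l (Comp delta n m l g f) = Comp sets (Fo (flat_functor I) n)
      (Fo (flat_functor I) m) (Fo (flat_functor I) l) (Fm (flat_functor I) m l g) (Fm (flat_functor I) n m f)"
    using flat_functor_Fm_in[OF f]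
    by (auto simp: sets_def flat_functor_def Field_star compose_def[of "interval_hom (star n) I"] fun_eq_iff)
qed (simp_all add: sets_def)

text \<open>An injective \<open>\<chi>\<close> can be cancelled on the left, and
  \<open>star_map\<close> is faithful.\<close>

lemma free_element_flat_functor:
  assumes \<chi>: "\<chi> \<in> interval_hom (star n) I" and inj: "inj_on \<chi> {..n + 1}"
  shows "free_element (flat_functor I) n \<chi>"
  unfolding free_element_def flat_functor_Fo
proof (intro conjI allI ballI impI \<chi>)
  fix m f g assume f: "f \<in> Hom delta n m" and g: "g \<in> Hom delta n m"
    and eq: "Fm (flat_functor I) n m f \<chi> = Fm (flat_functor I) n m g \<chi>"
  show "f = g"
  proof (rule star_map_faithful[OF f g])
    fix j assume j: "j \<le> m + 1"
    have "compose {..m + 1} \<chi> (star_map n m f) j = compose {..m + 1} \<chi> (star_map n m g) j"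
      using eq \<chi> by (simp add: flat_functor_Fm)
    then have "\<chi> (star_map n m f j) = \<chi> (star_map n m g j)" using j by (simp add: compose_def)
    then show "star_map n m f j = star_map n m g j"
      using inj_onD[OF inj] star_map_le[OF f j] star_map_le[OF g j] by simp
  qed
qed

lemma interval_hom_image: "\<phi> \<in> interval_hom (star n) I \<Longrightarrow> \<phi> ` {..n + 1} \<subseteq> Field I"
  by (auto simp: interval_hom_star_iff)

lemma freely_filtered_flat_functor:
  assumes I: "interval I"
  shows "freely_filtered (flat_functor I)"
proof
  show "is_functor delta sets (flat_functor I)" by (rule is_functor_flat_functor)
  show "\<exists>n. Fo (flat_functor I) n \<noteq> {}"
    using interval_finite_enumeration[OF I finite.emptyI empty_subsetI] unfolding flat_functor_Fo by blast
next
  fix \<phi> n \<phi>' m assume "\<phi> \<in> Fo (flat_functor I) n" "\<phi>' \<in> Fo (flat_functor I) m"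
  then have \<phi>: "\<phi> \<in> interval_hom (star n) I" and \<phi>': "\<phi>' \<in> interval_hom (star m) I"
    by (simp_all add: flat_functor_Fo)
  have "finite (\<phi> ` {..n + 1} \<union> \<phi>' ` {..m + 1})" by simp
  then obtain l \<chi> where \<chi>: "\<chi> \<in> interval_hom (star l) I" "inj_on \<chi> {..l + 1}"
    and sub: "\<phi> ` {..n + 1} \<union> \<phi>' ` {..m + 1} \<subseteq> \<chi> ` {..l + 1}"
    using interval_hom_image[OF \<phi>] interval_hom_image[OF \<phi>']
    by (elim interval_finite_enumeration[OF I]) simp
  note factor = interval_hom_factor[OF interval_Linear_order[OF I] \<chi>]
  obtain f where f: "f \<in> Hom delta l n" "\<phi> = compose {..n + 1} \<chi> (star_map l n f)"
    using factor[OF \<phi>] sub by blast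
  obtain g where g: "g \<in> Hom delta l m" "\<phi>' = compose {..m + 1} \<chi> (star_map l m g)"
    using factor[OF \<phi>'] sub by blast
  have Fm: "Fm (flat_functor I) l n f \<chi> = \<phi>" "Fm (flat_functor I) l m g \<chi> = \<phi>'"
    by (simp_all only: flat_functor_Fm[OF \<chi>(1)] f(2)[symmetric] g(2)[symmetric])
  show "\<exists>l \<chi> f g. free_element (flat_functor I) l \<chi> \<and> f \<in> Hom delta l n \<and> g \<in> Hom delta l m \<and>
      Fm (flat_functor I) l n f \<chi> = \<phi> \<and> Fm (flat_functor I) l m g \<chi> = \<phi>'"
    using free_element_flat_functor[OF \<chi>] f(1) g(1) Fm by blast
qed

lemma point_of_eq: "point_of I = tensor_functor (flat_functor I)"
  by (simp add: point_of_def tensor_functor_def)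

text \<open>Postcomposition with \<open>h\<close> commutes with precomposition with
  \<open>star_map n m f\<close>, so it is natural in the level and passes to germs.\<close>

lemma interval_point_germ:
  assumes Y: "Y \<in> Obj presheaves" and h: "h \<in> interval_hom I J"
    and y: "y \<in> Fo Y n" and \<phi>: "\<phi> \<in> interval_hom (star n) I"
  shows "tensor_map Y (flat_functor I) Y (flat_functor J) (\<lambda>n y. y) (\<lambda>n \<phi>. compose (Field (star n)) h \<phi>)
      (germ Y (flat_functor I) n y \<phi>) = germ Y (flat_functor J) n y (compose {..n + 1} h \<phi>)"
proof -
  have in_J: "compose {..n + 1} h \<phi> \<in> interval_hom (star n) J" if "\<phi> \<in> interval_hom (star n) I" for n \<phi>
    using interval_hom_compose[OF that h interval_star] by (simp only: Field_star)
  have nat: "compose {..m + 1} h (compose {..m + 1} \<phi> (star_map n m f)) =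
      compose {..m + 1} (compose {..n + 1} h \<phi>) (star_map n m f)" if "f \<in> Hom delta n m" for n m f and \<phi>
    using star_map_le[OF that] by (auto simp: compose_def fun_eq_iff)
  show ?thesis
    unfolding Field_star
    by (rule tensor_map_germ[OF Y is_functor_flat_functor Y is_functor_flat_functor])
      (use y \<phi> in_J in \<open>simp_all only: flat_functor_Fo flat_functor_Fm nat\<close>)
qed

text \<open>Membership in \<open>points\<close> comes from \<open>freely_filtered\<close>. The
  remaining equations compare maps that are extensional on stalks, so they are checked on germs,
  where a morphism acts by postcomposition.\<close>

lemma is_functor_interval_point:
  "is_functor intervals points (interval_point :: ('a rel, 'a \<Rightarrow> 'a,
     ('u, ('u, 'a) stalk) topos_functor, ('u, ('u, 'a) stalk) topos_trans) cat_functor)"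
  unfolding is_functor_def
proof (intro conjI ballI)
  let ?P = "interval_point :: ('a rel, 'a \<Rightarrow> 'a,
     ('u, ('u, 'a) stalk) topos_functor, ('u, ('u, 'a) stalk) topos_trans) cat_functor"
  have Fo: "Fo ?P I = tensor_functor (flat_functor I)" for I
    by (simp add: interval_point_def point_of_eq)
  have Fm: "Fm ?P I J h Y = tensor_map Y (flat_functor I) Y (flat_functor J)
       (\<lambda>n y. y) (\<lambda>n \<phi>. compose (Field (star n)) h \<phi>)" if "Y \<in> Obj presheaves" for I J h Y
    using that by (simp add: interval_point_def)
  have ext: "Fm ?P I J h \<in> extensional (Obj presheaves)" for I J h
    by (simp add: interval_point_def)
  have in_J: "compose {..n + 1} h \<phi> \<in> interval_hom (star n) J"
    if "h \<in> interval_hom I J" "\<phi> \<in> interval_hom (star n) I" for n \<phi> h and I J :: "'a rel"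
    using interval_hom_compose[OF that(2,1) interval_star] by (simp only: Field_star)
  { fix I assume "I \<in> (Obj intervals :: 'a rel set)"
    then have I: "interval I" by (simp add: intervals_def)
    show "Fo ?P I \<in> Obj points"
      unfolding Fo by (rule freely_filtered.tensor_functor_in_points[OF freely_filtered_flat_functor[OF I]])
    have id: "Ident (intervals :: ('a rel, 'a \<Rightarrow> 'a) category) I \<in> interval_hom I I"
      using interval_ibot[OF I] interval_itop[OF I]
      by (auto simp: intervals_def interval_hom_def is_bot_def is_top_def Field_def)
    show "Fm ?P I I (Ident intervals I) = Ident points (Fo ?P I)"
    proof (rule extensionalityI[OF ext])
      show "Ident points (Fo ?P I) \<in> extensional (Obj presheaves)"
        by (simp add: points_def full_subcat_def functor_cat_def)
      fix Y :: "'u presheaf" assume Y: "Y \<in> Obj presheaves"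
      have *: "compose {..n + 1} (Ident intervals I) \<phi> = \<phi>" if "\<phi> \<in> interval_hom (star n) I" for n \<phi>
        by (rule extensionalityI[OF _ interval_hom_extensional[OF that]])
          (use that in \<open>auto simp: compose_def intervals_def interval_hom_star_iff PiE_iff\<close>)
      have "Fm ?P I I (Ident intervals I) Y = (\<lambda>A\<in>tensor Y (flat_functor I). A)"
        unfolding Fm[OF Y]
      proof (rule extensionalityI[OF tensor_map_extensional restrict_extensional])
        fix A assume A: "A \<in> tensor Y (flat_functor I)"
        then obtain n y \<phi> where "y \<in> Fo Y n" "\<phi> \<in> interval_hom (star n) I" "A = germ Y (flat_functor I) n y \<phi>"
          by (rule tensor_cases) (simp add: flat_functor_Fo)
        with A show "tensor_map Y (flat_functor I) Y (flat_functor I) (\<lambda>n y. y)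
            (\<lambda>n \<phi>. compose (Field (star n)) (Ident intervals I) \<phi>) A = (\<lambda>A\<in>tensor Y (flat_functor I). A) A"
          using interval_point_germ[OF Y id] * by simp
      qed
      then show "Fm ?P I I (Ident intervals I) Y = Ident points (Fo ?P I) Y"
        using Y by (simp add: Fo points_def full_subcat_def functor_cat_def sets_def tensor_functor_simps)
    qed
  }
  { fix I J h assume "I \<in> (Obj intervals :: 'a rel set)" "J \<in> (Obj intervals :: 'a rel set)"
      and "h \<in> Hom (intervals :: ('a rel, 'a \<Rightarrow> 'a) category) I J"
    then have I: "interval I" and J: "interval J" and h: "h \<in> interval_hom I J"
      by (simp_all add: intervals_def)
    note germ = interval_point_germ[OF _ h]
    note tg = tensor_functor_germ[OF is_functor_flat_functor, unfolded flat_functor_Fo]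
    note cases = tensor_cases[where F = "flat_functor I", unfolded flat_functor_Fo]
    have inH: "Fm ?P I J h Y \<in> tensor Y (flat_functor I) \<rightarrow>\<^sub>E tensor Y (flat_functor J)"
      if Y: "Y \<in> Obj presheaves" for Y
      unfolding Fm[OF Y] by (rule PiE_I)
        (auto simp: germ[OF Y] flat_functor_Fo in_J[OF h] extensional_arb[OF tensor_map_extensional]
          simp del: One_nat_def add_Suc_right intro!: germ_in_tensor elim!: cases)
    have nat: "compose (tensor Y (flat_functor I)) (Fm ?P I J h Z)
          (tensor_map Y (flat_functor I) Z (flat_functor I) \<eta> (\<lambda>n \<phi>. \<phi>)) =
        compose (tensor Y (flat_functor I)) (tensor_map Y (flat_functor J) Z (flat_functor J) \<eta> (\<lambda>n \<phi>. \<phi>))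
          (Fm ?P I J h Y)"
      if Y: "Y \<in> Obj presheaves" and Z: "Z \<in> Obj presheaves" and \<eta>: "\<eta> \<in> Hom presheaves Y Z" for Y Z \<eta>
    proof (rule extensionalityI[OF compose_extensional compose_extensional])
      fix A assume A: "A \<in> tensor Y (flat_functor I)"
      then obtain n y \<phi> where "y \<in> Fo Y n" "\<phi> \<in> interval_hom (star n) I" "A = germ Y (flat_functor I) n y \<phi>"
        by (rule cases)
      then show "compose (tensor Y (flat_functor I)) (Fm ?P I J h Z)
            (tensor_map Y (flat_functor I) Z (flat_functor I) \<eta> (\<lambda>n \<phi>. \<phi>)) A =
          compose (tensor Y (flat_functor I)) (tensor_map Y (flat_functor J) Z (flat_functor J) \<eta> (\<lambda>n \<phi>. \<phi>))
            (Fm ?P I J h Y) A"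
        using A in_J[OF h, of \<phi> n] presheaf_Hom_in[OF \<eta>]
        by (simp only: compose_eq Fm[OF Y] Fm[OF Z] germ[OF Y] germ[OF Z] tg[OF Y Z \<eta>])
    qed
    show "Fm ?P I J h \<in> Hom points (Fo ?P I) (Fo ?P J)"
      using ext[of I J h] inH nat
      by (simp add: Fo points_def full_subcat_def functor_cat_def nat_trans_def sets_def
          tensor_functor_simps PiE_iff)
  }
  { fix I J K f g
    assume "I \<in> (Obj intervals :: 'a rel set)" "J \<in> (Obj intervals :: 'a rel set)"
      "K \<in> (Obj intervals :: 'a rel set)"
      and "f \<in> Hom (intervals :: ('a rel, 'a \<Rightarrow> 'a) category) I J"
      and "g \<in> Hom (intervals :: ('a rel, 'a \<Rightarrow> 'a) category) J K"
    then have I: "interval I" and J: "interval J" and f: "f \<in> interval_hom I J" and g: "g \<in> interval_hom J K"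
      by (simp_all add: intervals_def)
    have Comp: "Comp intervals I J K g f = compose (Field I) g f" by (simp add: intervals_def)
    note gf = interval_hom_compose[OF f g I]
    show "Fm ?P I K (Comp intervals I J K g f) =
      Comp points (Fo ?P I) (Fo ?P J) (Fo ?P K) (Fm ?P J K g) (Fm ?P I J f)"
      unfolding Comp
    proof (rule extensionalityI[OF ext])
      show "Comp points (Fo ?P I) (Fo ?P J) (Fo ?P K) (Fm ?P J K g) (Fm ?P I J f) \<in> extensional (Obj presheaves)"
        by (simp add: points_def full_subcat_def functor_cat_def)
      fix Y :: "'u presheaf" assume Y: "Y \<in> Obj presheaves"
      have "Fm ?P I K (compose (Field I) g f) Y =
        compose (tensor Y (flat_functor I)) (Fm ?P J K g Y) (Fm ?P I J f Y)"
        unfolding Fm[OF Y]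
      proof (rule extensionalityI[OF tensor_map_extensional compose_extensional])
        fix A assume A: "A \<in> tensor Y (flat_functor I)"
        then obtain n y \<phi> where y: "y \<in> Fo Y n" and \<phi>: "\<phi> \<in> interval_hom (star n) I"
          and Aeq: "A = germ Y (flat_functor I) n y \<phi>"
          by (rule tensor_cases) (simp add: flat_functor_Fo)
        have "compose {..n + 1} (compose (Field I) g f) \<phi> = compose {..n + 1} g (compose {..n + 1} f \<phi>)"
          using \<phi> by (auto simp: compose_def fun_eq_iff interval_hom_star_iff PiE_iff)
        then show "tensor_map Y (flat_functor I) Y (flat_functor K) (\<lambda>n y. y)
              (\<lambda>n \<phi>. compose (Field (star n)) (compose (Field I) g f) \<phi>) A =
            compose (tensor Y (flat_functor I))
              (tensor_map Y (flat_functor J) Y (flat_functor K) (\<lambda>n y. y) (\<lambda>n \<phi>. compose (Field (star n)) g \<phi>))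
              (tensor_map Y (flat_functor I) Y (flat_functor J) (\<lambda>n y. y) (\<lambda>n \<phi>. compose (Field (star n)) f \<phi>)) A"
          using A y \<phi> in_J[OF f \<phi>] unfolding Aeq
          by (simp only: compose_eq interval_point_germ[OF Y gf] interval_point_germ[OF Y f]
              interval_point_germ[OF Y g])
      qed
      then show "Fm ?P I K (compose (Field I) g f) Y =
        Comp points (Fo ?P I) (Fo ?P J) (Fo ?P K) (Fm ?P J K g) (Fm ?P I J f) Y"
        using Y by (simp add: Fo points_def full_subcat_def functor_cat_def sets_def tensor_functor_simps)
    qed
  }
qed


section \<open>Barycentric subdivision of the simplicial category\<close>

lemma Sd_Fo: "Fo (Sd k) n = k * (n + 1) - 1"
  by (simp add: Sd_def)

text \<open>The subtraction in \<open>Sd\<close> is truncated, so \<open>1 \<le> k\<close> is used.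
  The right side is the largest element of the interval dual to the subdivided object.\<close>

lemma Sd_Fo_Suc:
  fixes k n :: nat
  assumes "1 \<le> k"
  shows "k * (n + 1) - 1 + 1 = k * (n + 1)"
proof -
  have "1 \<le> k * (n + 1)" using assms by simp
  then show ?thesis by (rule le_add_diff_inverse2)
qed

text \<open>The position \<open>x = n + 1\<close> is allowed: in the dual interval the last element
  of block \<open>j\<close> is the first element of block \<open>j + 1\<close>, and in the last
  block it is the top element \<open>k * (n + 1)\<close>.\<close>

lemma sd_index_le:
  fixes j k x n :: nat
  assumes "j < k" "x \<le> n + 1"
  shows "j * (n + 1) + x \<le> k * (n + 1)"
proof -
  have "Suc j * (n + 1) \<le> k * (n + 1)" using assms(1) by (intro mult_right_mono) auto
  then show ?thesis using assms(2) by simp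
qed

lemma sd_index_cases:
  fixes i k n :: nat
  assumes k: "1 \<le> k" and i: "i \<le> k * (n + 1) - 1"
  obtains j x where "j < k" "x \<le> n" "i = j * (n + 1) + x"
proof (rule that[of "i div (n + 1)" "i mod (n + 1)"])
  have "i + 1 \<le> k * (n + 1)" using add_right_mono[OF i, of 1] unfolding Sd_Fo_Suc[OF k] .
  then have "i < k * (n + 1)" by simp
  then show "i div (n + 1) < k" by (rule less_mult_imp_div_less)
  show "i mod (n + 1) \<le> n" using mod_less_divisor[of "n + 1" i] by linarith
  show "i = i div (n + 1) * (n + 1) + i mod (n + 1)" by (rule div_mult_mod_eq[symmetric])
qed

text \<open>Coordinates of block and position replace the inverse of \<open>sd_code\<close>; the
  values of \<open>Sd k\<close> on arrows are computed through them from here on.\<close>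

lemma Sd_Fm_index:
  assumes k: "1 \<le> k" and j: "j < k" and x: "x \<le> n"
  shows "Fm (Sd k) n m f (j * (n + 1) + x) = j * (m + 1) + f x"
proof -
  have "inj_on (sd_code n) ({..<k} \<times> {..n})" using sd_code_bij[OF k] by (simp add: bij_betw_def)
  from the_inv_into_f_f[OF this, of "(j, x)"] j x
  have "the_inv_into ({..<k} \<times> {..n}) (sd_code n) (j * (n + 1) + x) = (j, x)"
    by (simp add: sd_code_def)
  moreover have "j * (n + 1) + x \<le> k * (n + 1) - 1"
    using bij_betwE[OF sd_code_bij[OF k, of n]] j x by (force simp: sd_code_def)
  ultimately show ?thesis by (simp add: Sd_def sd_code_def)
qed

lemma sd_index_le_iff:
  fixes j j' x x' n :: nat
  assumes "x \<le> n" "x' \<le> n"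
  shows "j * (n + 1) + x \<le> j' * (n + 1) + x' \<longleftrightarrow> j < j' \<or> j = j' \<and> x \<le> x'"
proof -
  have "a * (n + 1) + y < a' * (n + 1) + y'" if "a < a'" "y \<le> n" for a a' y y'
    using sd_index_le[of a a' "y + 1" n] that by simp
  from this[of j j' x x'] this[of j' j x' x] assms show ?thesis
    by (cases j j' rule: linorder_cases) auto
qed

lemma Sd_Fm_Hom:
  assumes k: "1 \<le> k" and f: "f \<in> Hom delta n m"
  shows "Fm (Sd k) n m f \<in> Hom delta (k * (n + 1) - 1) (k * (m + 1) - 1)"
  unfolding Hom_delta_iff
proof
  show "mono_on {..k * (n + 1) - 1} (Fm (Sd k) n m f)"
  proof (rule mono_onI)
    fix i i' assume "i \<in> {..k * (n + 1) - 1}" "i' \<in> {..k * (n + 1) - 1}" and le: "i \<le> i'"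
    then have i: "i \<le> k * (n + 1) - 1" "i' \<le> k * (n + 1) - 1" by simp_all
    obtain j x where 1: "j < k" "x \<le> n" "i = j * (n + 1) + x"
      using i(1) by (rule sd_index_cases[OF k])
    obtain j' x' where 2: "j' < k" "x' \<le> n" "i' = j' * (n + 1) + x'"
      using i(2) by (rule sd_index_cases[OF k])
    note ij = 1 2
    have "j < j' \<or> j = j' \<and> x \<le> x'" using le sd_index_le_iff[OF 1(2) 2(2)] by (simp only: ij)
    then have "j < j' \<or> j = j' \<and> f x \<le> f x'" using Hom_delta_mono[OF f] ij(5) by blast
    then show "Fm (Sd k) n m f i \<le> Fm (Sd k) n m f i'"
      using sd_index_le_iff[OF Hom_delta_le[OF f ij(2)] Hom_delta_le[OF f ij(5)]] ij
      by (simp only: Sd_Fm_index[OF k])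
  qed
  have "Fm (Sd k) n m f i \<le> k * (m + 1) - 1" if i: "i \<le> k * (n + 1) - 1" for i
  proof -
    obtain j x where ij: "j < k" "x \<le> n" "i = j * (n + 1) + x"
      using i by (rule sd_index_cases[OF k])
    have "j * (m + 1) + (f x + 1) \<le> k * (m + 1)"
      by (rule sd_index_le) (use ij Hom_delta_le[OF f ij(2)] in auto)
    then show ?thesis using ij by (simp only: Sd_Fm_index[OF k])
  qed
  then show "Fm (Sd k) n m f \<in> {..k * (n + 1) - 1} \<rightarrow>\<^sub>E {..k * (m + 1) - 1}"
    by (auto simp: PiE_iff) (simp add: Sd_def)
qed

lemma is_functor_Sd:
  assumes k: "1 \<le> k"
  shows "is_functor delta delta (Sd k)"
  unfolding is_functor_def Sd_Fo
proof (intro conjI ballI)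
  fix n m f assume "f \<in> Hom delta n m"
  then show "Fm (Sd k) n m f \<in> Hom delta (k * (n + 1) - 1) (k * (m + 1) - 1)" by (rule Sd_Fm_Hom[OF k])
next
  fix n
  show "Fm (Sd k) n n (Ident delta n) = Ident delta (k * (n + 1) - 1)"
  proof (rule Hom_delta_eqI[OF Sd_Fm_Hom[OF k Ident_delta_Hom] Ident_delta_Hom])
    fix i assume i: "i \<le> k * (n + 1) - 1"
    then obtain j x where ij: "j < k" "x \<le> n" "i = j * (n + 1) + x"
      by (rule sd_index_cases[OF k])
    have "Fm (Sd k) n n (Ident delta n) i = i"
      unfolding ij(3) Sd_Fm_index[OF k ij(1,2)] using ij(2) by (simp add: delta_def)
    then show "Fm (Sd k) n n (Ident delta n) i = Ident delta (k * (n + 1) - 1) i"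
      using i by (simp add: delta_def)
  qed
next
  fix n m l f g assume f: "f \<in> Hom delta n m" and g: "g \<in> Hom delta m l"
  show "Fm (Sd k) n l (Comp delta n m l g f) =
    Comp delta (k * (n + 1) - 1) (k * (m + 1) - 1) (k * (l + 1) - 1) (Fm (Sd k) m l g) (Fm (Sd k) n m f)"
  proof (rule Hom_delta_eqI[OF Sd_Fm_Hom[OF k Comp_delta_Hom[OF f g]]
        Comp_delta_Hom[OF Sd_Fm_Hom[OF k f] Sd_Fm_Hom[OF k g]]])
    fix i assume i: "i \<le> k * (n + 1) - 1"
    then obtain j x where ij: "j < k" "x \<le> n" "i = j * (n + 1) + x"
      by (rule sd_index_cases[OF k])
    show "Fm (Sd k) n l (Comp delta n m l g f) i = Comp delta (k * (n + 1) - 1) (k * (m + 1) - 1)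
        (k * (l + 1) - 1) (Fm (Sd k) m l g) (Fm (Sd k) n m f) i"
      using ij(1,2) Hom_delta_le[OF f ij(2)]
      by (simp only: Comp_delta_apply[OF i]) (simp only: ij(3) Sd_Fm_index[OF k] Comp_delta_apply)
  qed
qed (simp add: delta_def)

text \<open>Dually, \<open>Sd k\<close> acts on each block by \<open>star_map n m f\<close>; the
  Galois condition is verified in the lexicographic order. The position \<open>x = m + 1\<close> is
  included, so the joints are covered from both adjacent blocks.\<close>

lemma star_map_Sd:
  assumes k: "1 \<le> k" and f: "f \<in> Hom delta n m" and j: "j < k" and x: "x \<le> m + 1"
  shows "star_map (k * (n + 1) - 1) (k * (m + 1) - 1) (Fm (Sd k) n m f) (j * (m + 1) + x)
    = j * (n + 1) + star_map n m f x"
proof (rule star_map_apply_eqI[OF Sd_Fm_Hom[OF k f]])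
  show "j * (m + 1) + x \<le> k * (m + 1) - 1 + 1"
    unfolding Sd_Fo_Suc[OF k] by (rule sd_index_le[OF j x])
  show "j * (n + 1) + star_map n m f x \<le> k * (n + 1) - 1 + 1"
    unfolding Sd_Fo_Suc[OF k] by (rule sd_index_le[OF j star_map_le[OF f x]])
  fix i assume "i \<le> k * (n + 1) - 1"
  then obtain j' x' where i: "j' < k" "x' \<le> n" "i = j' * (n + 1) + x'"
    by (rule sd_index_cases[OF k])
  note x'm = Hom_delta_le[OF f i(2)]
  have lt: "a * (l + 1) + y < a' * (l + 1) + y'" if "a < a'" "y \<le> l" for a a' l y y' :: nat
    using sd_index_le[of a a' "y + 1" l] that by simp
  \<comment> \<open>The value \<open>star_map n m f x\<close> may be \<open>n + 1\<close>, outside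
    the range of \<open>sd_index_le_iff\<close>. The equivalence persists since block
    \<open>j\<close> then ends where block \<open>j + 1\<close> begins, while \<open>x'\<close>
    stays at most \<open>n\<close>.\<close>
  have "j * (n + 1) + star_map n m f x \<le> i \<longleftrightarrow> j < j' \<or> j = j' \<and> star_map n m f x \<le> x'"
    using lt[of j' j x' n "star_map n m f x"] sd_index_le[of j j' "star_map n m f x" n]
      star_map_le[OF f x] i by (cases j j' rule: linorder_cases) auto
  also have "\<dots> \<longleftrightarrow> j < j' \<or> j = j' \<and> x \<le> f x'" using star_map_galois[OF f x i(2)] by simp
  also have "\<dots> \<longleftrightarrow> j * (m + 1) + x \<le> Fm (Sd k) n m f i"
    using lt[of j' j "f x'" m x] sd_index_le[of j j' x m] x x'm
    unfolding i(3) Sd_Fm_index[OF k i(1,2)] by (cases j j' rule: linorder_cases) auto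
  finally show "j * (n + 1) + star_map n m f x \<le> i \<longleftrightarrow> j * (m + 1) + x \<le> Fm (Sd k) n m f i" .
qed

section \<open>Subdivision on presheaves and on points\<close>

lemma is_functor_full_subcat:
  assumes "is_functor C D F" "\<And>a. a \<in> Obj C \<Longrightarrow> P a \<Longrightarrow> Q (Fo F a)"
  shows "is_functor (full_subcat C P) (full_subcat D Q) F"
  using assms unfolding is_functor_def full_subcat_def by simp

lemma is_functor_sd_inverse_image:
  assumes k: "1 \<le> k"
  shows "is_functor presheaves presheaves (sd_inverse_image k)"
  unfolding presheaves_def sd_inverse_image_def
  by (intro is_functor_precomp is_functor_op_functor is_functor_Sd k)

lemma sd_inverse_image_simps:
  "Fo (Fo (sd_inverse_image k) Y) n = Fo Y (k * (n + 1) - 1)"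
  "Fm (Fo (sd_inverse_image k) Y) m n f = Fm Y (k * (m + 1) - 1) (k * (n + 1) - 1) (Fm (Sd k) n m f)"
  "Fm (sd_inverse_image k) Y Z \<eta> n = \<eta> (k * (n + 1) - 1)"
  by (simp_all add: sd_inverse_image_def precomp_def functor_comp_def op_functor_def Sd_Fo
      op_cat_def delta_def)

text \<open>Limits and colimits of presheaves are objectwise, and \<open>sd_inverse_image k\<close>
  only re-indexes levels: a condition at all levels holds in particular at the levels
  \<open>k * (n + 1) - 1\<close>. Hence composing with it keeps both preservation
  properties.\<close>

lemma is_functor_sd_on_points:
  assumes k: "1 \<le> k"
  shows "is_functor points points (sd_on_points k :: (('u, 'v) topos_functor, ('u, 'v) topos_trans,
            ('u, 'v) topos_functor, ('u, 'v) topos_trans) cat_functor)"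
  unfolding points_def
proof (rule is_functor_full_subcat)
  have S: "is_functor (presheaves :: ('u presheaf, nat \<Rightarrow> 'u \<Rightarrow> 'u) category) presheaves (sd_inverse_image k)"
    by (rule is_functor_sd_inverse_image[OF k])
  show "is_functor (functor_cat presheaves sets) (functor_cat presheaves sets)
      (sd_on_points k :: (('u, 'v) topos_functor, ('u, 'v) topos_trans,
            ('u, 'v) topos_functor, ('u, 'v) topos_trans) cat_functor)"
    unfolding sd_on_points_def by (rule is_functor_precomp[OF S])
  have obj: "Fo (sd_inverse_image k) Y \<in> Obj presheaves" if "Y \<in> Obj presheaves" for Y :: "'u presheaf"
    using S that by (simp add: is_functor_def)
  have hom: "Fm (sd_inverse_image k) Y Z \<eta> \<in>
      Hom presheaves (Fo (sd_inverse_image k) Y) (Fo (sd_inverse_image k) Z)"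
    if "Y \<in> Obj presheaves" "Z \<in> Obj presheaves" "\<eta> \<in> Hom presheaves Y Z" for Y Z :: "'u presheaf" and \<eta>
    using S that by (simp add: is_functor_def)
  fix P :: "('u, 'v) topos_functor"
  assume P: "preserves_finite_limits P \<and> preserves_colimits P"
  have eq: "Fo (sd_on_points k) P = functor_comp P (sd_inverse_image k)"
    by (simp add: sd_on_points_def precomp_def)
  show "preserves_finite_limits (Fo (sd_on_points k) P) \<and> preserves_colimits (Fo (sd_on_points k) P)"
    unfolding eq
  proof
    show "preserves_finite_limits (functor_comp P (sd_inverse_image k))"
      using P obj hom unfolding preserves_finite_limits_def functor_comp_def
      by (simp add: sd_inverse_image_simps)
    show "preserves_colimits (functor_comp P (sd_inverse_image k))"
      using P obj hom unfolding preserves_colimits_def functor_comp_def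
      by (simp add: sd_inverse_image_simps)
  qed
qed


section \<open>Barycentric subdivision of intervals\<close>

text \<open>The representative of a class that is largest in the lexicographic order.\<close>

definition sd_normal :: "nat \<Rightarrow> 'a rel \<Rightarrow> nat \<times> 'a \<Rightarrow> nat \<times> 'a" where
  "sd_normal k I = (\<lambda>(j, x). if x = itop I \<and> j + 1 < k then (j + 1, ibot I) else (j, x))"

definition sd_class :: "nat \<Rightarrow> 'a rel \<Rightarrow> nat \<times> 'a \<Rightarrow> (nat \<times> 'a) set" where
  "sd_class k I p = sdstar_rel k I `` {p}"

locale subdivided_interval =
  fixes k :: nat and I :: "'a rel"
  assumes k: "1 \<le> k" and I: "interval I"
begin

lemmas lin = interval_Linear_order[OF I]

lemma bot: "ibot I \<in> Field I" "x \<in> Field I \<Longrightarrow> (ibot I, x) \<in> I"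
  using interval_ibot[OF I] by (auto simp: is_bot_def)

lemma top: "itop I \<in> Field I" "x \<in> Field I \<Longrightarrow> (x, itop I) \<in> I"
  using interval_itop[OF I] by (auto simp: is_top_def)

lemma refl: "x \<in> Field I \<Longrightarrow> (x, x) \<in> I"
  using Linear_order_total[OF lin] by blast

abbreviation "C \<equiv> sdstar_carrier k I"

lemma C_iff: "(j, x) \<in> C \<longleftrightarrow> j < k \<and> x \<in> Field I"
  by (auto simp: sdstar_carrier_def)

lemma equiv_sdstar_rel: "equiv C (sdstar_rel k I)"
  unfolding sdstar_rel_def by (rule equiv_equiv_gen)

text \<open>Because the end points differ, \<open>(j + 1, ibot I)\<close> is its own normal form, so
  \<open>sd_normal\<close> agrees on the two sides of a generator; conversely a pair is at most one
  generator away from its normal form. This replaces zigzags by an equation.\<close>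

lemma sdstar_rel_iff:
  "(p, q) \<in> sdstar_rel k I \<longleftrightarrow> p \<in> C \<and> q \<in> C \<and> sd_normal k I p = sd_normal k I q"
proof
  have E: "equiv C {(p, q) \<in> C \<times> C. sd_normal k I p = sd_normal k I q}"
    by (intro equivI refl_onI symI transI) auto
  have "sdstar_rel k I \<subseteq> {(p, q) \<in> C \<times> C. sd_normal k I p = sd_normal k I q}"
    unfolding sdstar_rel_def
    by (rule equiv_gen_least[OF E])
      (use interval_ibot_neq_itop[OF I] in \<open>auto simp: sd_normal_def C_iff bot(1) top(1)\<close>)
  then show "(p, q) \<in> sdstar_rel k I \<Longrightarrow> p \<in> C \<and> q \<in> C \<and> sd_normal k I p = sd_normal k I q" by blast
next
  have normal: "(p, sd_normal k I p) \<in> sdstar_rel k I" if "p \<in> C" for p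
  proof (cases "snd p = itop I \<and> fst p + 1 < k")
    case True
    then have "(p, sd_normal k I p) = ((fst p, itop I), (fst p + 1, ibot I))"
      by (cases p) (simp add: sd_normal_def)
    moreover have "\<dots> \<in> sdstar_rel k I"
      unfolding sdstar_rel_def by (rule equiv_gen_base) (use True in \<open>auto simp: C_iff bot(1) top(1)\<close>)
    ultimately show ?thesis by (simp only:)
  next
    case False
    then have "sd_normal k I p = p" by (cases p) (auto simp: sd_normal_def)
    then show ?thesis using equiv_class_self[OF equiv_sdstar_rel that] by simp
  qed
  assume "p \<in> C \<and> q \<in> C \<and> sd_normal k I p = sd_normal k I q"
  then show "(p, q) \<in> sdstar_rel k I"
    using equiv_class_eq_iff[OF equiv_sdstar_rel] equiv_class_eq[OF equiv_sdstar_rel normal, of p]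
      equiv_class_eq[OF equiv_sdstar_rel normal, of q] by simp
qed

lemma sd_class_eq_iff:
  "p \<in> C \<Longrightarrow> q \<in> C \<Longrightarrow> sd_class k I p = sd_class k I q \<longleftrightarrow> sd_normal k I p = sd_normal k I q"
  unfolding sd_class_def by (simp add: eq_equiv_class_iff[OF equiv_sdstar_rel] sdstar_rel_iff)

lemma quotient_cases:
  assumes "X \<in> C // sdstar_rel k I"
  obtains j x where "j < k" "x \<in> Field I" "X = sd_class k I (j, x)"
  using assms unfolding sd_class_def by (elim quotientE) (auto simp: C_iff)

lemma quotient_class:
  assumes X: "X \<in> C // sdstar_rel k I" and p: "p \<in> X"
  shows "p \<in> C" "X = sd_class k I p"
proof -
  obtain a where a: "X = sdstar_rel k I `` {a}" using X by (rule quotientE)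
  then have ap: "(a, p) \<in> sdstar_rel k I" using p by simp
  then show "p \<in> C" by (simp add: sdstar_rel_iff)
  show "X = sd_class k I p" unfolding a sd_class_def by (rule equiv_class_eq[OF equiv_sdstar_rel ap])
qed

lemma sd_class_in: "j < k \<Longrightarrow> x \<in> Field I \<Longrightarrow> sd_class k I (j, x) \<in> C // sdstar_rel k I"
  unfolding sd_class_def by (rule quotientI) (simp add: C_iff)

lemma sd_class_glue: "j + 1 < k \<Longrightarrow> sd_class k I (j, itop I) = sd_class k I (j + 1, ibot I)"
  using interval_ibot_neq_itop[OF I] by (subst sd_class_eq_iff) (auto simp: C_iff bot top sd_normal_def)

lemma sd_normal_in: "p \<in> C \<Longrightarrow> sd_normal k I p \<in> C"
  by (cases p) (auto simp: sd_normal_def C_iff bot)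

lemma sd_normal_idem: "sd_normal k I (sd_normal k I p) = sd_normal k I p"
  using interval_ibot_neq_itop[OF I] by (cases p) (auto simp: sd_normal_def)

text \<open>The critical case is a moved pair \<open>(j, itop I)\<close> below a pair in the same
  copy: that pair then also has second component \<open>itop I\<close> and is moved along. Below a
  pair in a later copy, the new value \<open>(j + 1, ibot I)\<close> is still below,
  \<open>ibot I\<close> being least.\<close>

lemma sd_normal_mono:
  assumes "p \<in> C" "q \<in> C" "(p, q) \<in> less_than <*lex*> I"
  shows "(sd_normal k I p, sd_normal k I q) \<in> less_than <*lex*> I"
proof -
  obtain j x j' x' where pq: "p = (j, x)" "q = (j', x')" by (cases p, cases q)
  have "x' = itop I" if "x = itop I" "j = j'"
    using assms that Linear_order_antisym[OF lin, of x x'] top(2)[of x'] by (auto simp: pq C_iff)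
  then show ?thesis
    using assms by (auto simp: pq sd_normal_def C_iff bot refl)
qed

text \<open>The order on classes asks for some pair of representatives; passing to normal forms,
  which preserves the order, makes the choice canonical.\<close>

lemma sdstar_class_iff:
  assumes p: "p \<in> C" and q: "q \<in> C"
  shows "(sd_class k I p, sd_class k I q) \<in> sdstar k I \<longleftrightarrow>
    (sd_normal k I p, sd_normal k I q) \<in> less_than <*lex*> I"
proof
  assume "(sd_class k I p, sd_class k I q) \<in> sdstar k I"
  then obtain p' q' where "p' \<in> sd_class k I p" "q' \<in> sd_class k I q" "(p', q') \<in> less_than <*lex*> I"
    unfolding sdstar_def by blast
  then show "(sd_normal k I p, sd_normal k I q) \<in> less_than <*lex*> I"
    using sd_normal_mono[of p' q'] by (simp add: sd_class_def sdstar_rel_iff)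
next
  assume "(sd_normal k I p, sd_normal k I q) \<in> less_than <*lex*> I"
  moreover have "sd_normal k I p \<in> sd_class k I p" "sd_normal k I q \<in> sd_class k I q"
    using p q by (simp_all add: sd_class_def sdstar_rel_iff sd_normal_in sd_normal_idem)
  moreover have "sd_class k I p \<in> C // sdstar_rel k I" "sd_class k I q \<in> C // sdstar_rel k I"
    unfolding sd_class_def using p q by (auto intro: quotientI)
  ultimately show "(sd_class k I p, sd_class k I q) \<in> sdstar k I" unfolding sdstar_def by blast
qed

lemma sdstar_lexI:
  assumes "j < k" "x \<in> Field I" "j' < k" "x' \<in> Field I" "j < j' \<or> j = j' \<and> (x, x') \<in> I"
  shows "(sd_class k I (j, x), sd_class k I (j', x')) \<in> sdstar k I"
  using assms by (subst sdstar_class_iff) (auto simp: C_iff intro!: sd_normal_mono)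

lemma Field_sdstar: "Field (sdstar k I) = C // sdstar_rel k I"
proof
  show "Field (sdstar k I) \<subseteq> C // sdstar_rel k I" by (auto simp: Field_def sdstar_def)
  show "C // sdstar_rel k I \<subseteq> Field (sdstar k I)"
  proof
    fix X assume "X \<in> C // sdstar_rel k I"
    then obtain j x where "j < k" "x \<in> Field I" "X = sd_class k I (j, x)" by (rule quotient_cases)
    then have "(X, X) \<in> sdstar k I" by (auto intro: sdstar_lexI refl)
    then show "X \<in> Field (sdstar k I)" by (auto simp: Field_def)
  qed
qed

lemma sdstar_cases:
  assumes "X \<in> Field (sdstar k I)"
  obtains j x where "j < k" "x \<in> Field I" "X = sd_class k I (j, x)"
  using assms unfolding Field_sdstar by (rule quotient_cases)

text \<open>Classes are ordered as their normal forms, so the axioms are inherited from the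
  lexicographic order; antisymmetry uses that a class is determined by its normal form.\<close>

lemma Linear_order_sdstar: "Linear_order (sdstar k I)"
proof -
  have cls: "\<exists>p\<in>C. X = sd_class k I p" if "X \<in> Field (sdstar k I)" for X
    using that by (elim sdstar_cases) (auto simp: C_iff)
  have lex_trans: "(p, r) \<in> less_than <*lex*> I"
    if "(p, q) \<in> less_than <*lex*> I" "(q, r) \<in> less_than <*lex*> I" for p q r
    using that Linear_order_trans[OF lin] by (cases p, cases q, cases r) auto
  have lex_antisym: "p = q"
    if "(p, q) \<in> less_than <*lex*> I" "(q, p) \<in> less_than <*lex*> I" for p q
    using that Linear_order_antisym[OF lin] by (cases p, cases q) auto
  have lex_total: "(p, q) \<in> less_than <*lex*> I \<or> (q, p) \<in> less_than <*lex*> I"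
    if "p \<in> C" "q \<in> C" for p q
    using that Linear_order_total[OF lin] by (cases p, cases q) (auto simp: C_iff)
  have total: "(X, Y) \<in> sdstar k I \<or> (Y, X) \<in> sdstar k I"
    if XY: "X \<in> Field (sdstar k I)" "Y \<in> Field (sdstar k I)" for X Y
  proof -
    obtain p q where "p \<in> C" "q \<in> C" "X = sd_class k I p" "Y = sd_class k I q"
      using cls[OF XY(1)] cls[OF XY(2)] by blast
    then show ?thesis
      using lex_total[OF sd_normal_in sd_normal_in, of p q] by (simp add: sdstar_class_iff)
  qed
  have "trans (sdstar k I)"
  proof (rule transI)
    fix X Y Z assume XYZ: "(X, Y) \<in> sdstar k I" "(Y, Z) \<in> sdstar k I"
    then have F: "X \<in> Field (sdstar k I)" "Y \<in> Field (sdstar k I)" "Z \<in> Field (sdstar k I)"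
      by (auto simp: Field_def)
    obtain p q r where "p \<in> C" "q \<in> C" "r \<in> C"
      "X = sd_class k I p" "Y = sd_class k I q" "Z = sd_class k I r"
      using cls[OF F(1)] cls[OF F(2)] cls[OF F(3)] by blast
    then show "(X, Z) \<in> sdstar k I"
      using XYZ lex_trans[of "sd_normal k I p" "sd_normal k I q" "sd_normal k I r"]
      by (simp add: sdstar_class_iff)
  qed
  moreover have "antisym (sdstar k I)"
  proof (rule antisymI)
    fix X Y assume XY: "(X, Y) \<in> sdstar k I" "(Y, X) \<in> sdstar k I"
    then have F: "X \<in> Field (sdstar k I)" "Y \<in> Field (sdstar k I)" by (auto simp: Field_def)
    obtain p q where "p \<in> C" "q \<in> C" "X = sd_class k I p" "Y = sd_class k I q"
      using cls[OF F(1)] cls[OF F(2)] by blast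
    then show "X = Y"
      using XY lex_antisym[of "sd_normal k I p" "sd_normal k I q"]
      by (simp add: sdstar_class_iff sd_class_eq_iff)
  qed
  ultimately show ?thesis
    using total by (auto simp: linear_order_on_def partial_order_on_def preorder_on_def total_on_def
      refl_on_def Field_def)
qed

lemma sdstar_bot: "is_bot (sdstar k I) (sd_class k I (0, ibot I))"
  unfolding is_bot_def
proof
  show "sd_class k I (0, ibot I) \<in> Field (sdstar k I)"
    unfolding Field_sdstar using k by (intro sd_class_in bot) simp
  show "\<forall>X\<in>Field (sdstar k I). (sd_class k I (0, ibot I), X) \<in> sdstar k I"
    using k by (auto elim!: sdstar_cases intro!: sdstar_lexI simp: bot)
qed

lemma sdstar_top: "is_top (sdstar k I) (sd_class k I (k - 1, itop I))"
  unfolding is_top_def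
proof
  show "sd_class k I (k - 1, itop I) \<in> Field (sdstar k I)"
    unfolding Field_sdstar using k by (intro sd_class_in top) simp
  show "\<forall>X\<in>Field (sdstar k I). (X, sd_class k I (k - 1, itop I)) \<in> sdstar k I"
    using k by (auto elim!: sdstar_cases intro!: sdstar_lexI simp: top)
qed

lemmas ibot_sdstar = ibot_eqI[OF Linear_order_sdstar sdstar_bot]
lemmas itop_sdstar = itop_eqI[OF Linear_order_sdstar sdstar_top]

lemma interval_sdstar: "interval (sdstar k I)"
proof -
  \<comment> \<open>No copy follows the last one, so \<open>(k - 1, itop I)\<close> is its own
    normal form, as is \<open>(0, ibot I)\<close>; they differ in the second component, also for
    \<open>k = 1\<close>.\<close>
  have "sd_class k I (k - 1, itop I) \<noteq> sd_class k I (0, ibot I)"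
    using interval_ibot_neq_itop[OF I] k
    by (subst sd_class_eq_iff) (auto simp: C_iff bot top sd_normal_def)
  then show ?thesis unfolding interval_def using Linear_order_sdstar sdstar_bot sdstar_top by blast
qed

end

section \<open>Functoriality of the subdivision of intervals\<close>

lemma sdstar_map_class:
  assumes k: "1 \<le> k" and I: "interval I" and J: "interval J" and h: "h \<in> interval_hom I J"
    and j: "j < k" and x: "x \<in> Field I"
  shows "sdstar_map k I J h (sd_class k I (j, x)) = sd_class k J (j, h x)"
proof -
  interpret SI: subdivided_interval k I using k I by unfold_locales
  interpret SJ: subdivided_interval k J using k J by unfold_locales
  have hF: "h y \<in> Field J" if "y \<in> Field I" for y using h that by (auto simp: interval_hom_def)
  have ht: "h (itop I) = itop J" "h (ibot I) = ibot J" using h by (auto simp: interval_hom_def)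
  \<comment> \<open>Morphisms of intervals preserve both end points, so \<open>map_prod id h\<close>
    carries gluing generators to gluing generators.\<close>
  have "(map_prod id h p, map_prod id h q) \<in> sdstar_rel k J" if "(p, q) \<in> sdstar_rel k I" for p q
  proof (rule equiv_gen_map[OF that[unfolded sdstar_rel_def] SJ.equiv_sdstar_rel])
    show "map_prod id h \<in> SI.C \<rightarrow> SJ.C" using hF by (auto simp: SI.C_iff SJ.C_iff)
  next
    fix p q assume "(p, q) \<in> {((j, itop I), j + 1, ibot I) |j. j + 1 < k}"
    then show "(map_prod id h p, map_prod id h q) \<in> sdstar_rel k J"
      unfolding sdstar_rel_def
      by (intro equiv_gen_base) (auto simp: ht SJ.C_iff SJ.bot SJ.top)
  qed (auto simp: SI.C_iff SI.bot SI.top)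
  from Image_image_class[OF SI.equiv_sdstar_rel SJ.equiv_sdstar_rel _ this, of "(j, x)"] j x
  show ?thesis
    using SI.sd_class_in[OF j x] by (simp add: sdstar_map_def sd_class_def SI.C_iff)
qed

lemma sdstar_map_Hom:
  assumes k: "1 \<le> k" and I: "interval I" and J: "interval J" and h: "h \<in> interval_hom I J"
  shows "sdstar_map k I J h \<in> interval_hom (sdstar k I) (sdstar k J)"
proof -
  interpret SI: subdivided_interval k I using k I by unfold_locales
  interpret SJ: subdivided_interval k J using k J by unfold_locales
  note cls = sdstar_map_class[OF k I J h]
  have hF: "h y \<in> Field J" if "y \<in> Field I" for y using h that by (auto simp: interval_hom_def)
  have ht: "h (itop I) = itop J" "h (ibot I) = ibot J" using h by (auto simp: interval_hom_def)
  have "sdstar_map k I J h \<in> Field (sdstar k I) \<rightarrow>\<^sub>E Field (sdstar k J)"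
  proof (rule PiE_I)
    fix X assume "X \<in> Field (sdstar k I)"
    then show "sdstar_map k I J h X \<in> Field (sdstar k J)"
      by (elim SI.sdstar_cases) (simp add: cls SJ.Field_sdstar SJ.sd_class_in hF)
  qed (simp add: sdstar_map_def SI.Field_sdstar)
  moreover have "(sdstar_map k I J h X, sdstar_map k I J h Y) \<in> sdstar k J" if XY: "(X, Y) \<in> sdstar k I" for X Y
  proof -
    obtain p q where XY': "X \<in> SI.C // sdstar_rel k I" "Y \<in> SI.C // sdstar_rel k I"
      "p \<in> X" "q \<in> Y" and lex: "(p, q) \<in> less_than <*lex*> I"
      using XY unfolding sdstar_def by blast
    note p = SI.quotient_class[OF XY'(1,3)] and q = SI.quotient_class[OF XY'(2,4)]
    obtain j x j' x' where pq: "p = (j, x)" "q = (j', x')" by (cases p, cases q)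
    have "j < j' \<or> j = j' \<and> (h x, h x') \<in> J"
      using lex h by (auto simp: pq interval_hom_def)
    then show ?thesis
      using p q by (auto simp: pq SI.C_iff cls hF intro!: SJ.sdstar_lexI)
  qed
  moreover have "sdstar_map k I J h (ibot (sdstar k I)) = ibot (sdstar k J)"
    unfolding SI.ibot_sdstar SJ.ibot_sdstar using k by (subst cls) (auto simp: SI.bot ht)
  moreover have "sdstar_map k I J h (itop (sdstar k I)) = itop (sdstar k J)"
    unfolding SI.itop_sdstar SJ.itop_sdstar using k by (subst cls) (auto simp: SI.top ht)
  ultimately show ?thesis unfolding interval_hom_def by blast
qed

lemma is_functor_Sdstar:
  assumes k: "1 \<le> k"
  shows "is_functor intervals intervals (Sdstar k)"
  unfolding is_functor_def
proof (intro conjI ballI)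
  fix I :: "'a rel" assume "I \<in> Obj intervals"
  then have I: "interval I" by (simp add: intervals_def)
  interpret subdivided_interval k I using k I by unfold_locales
  show "Fo (Sdstar k) I \<in> Obj intervals" by (simp add: Sdstar_def intervals_def interval_sdstar)
  have id: "(\<lambda>x\<in>Field I. x) \<in> interval_hom I I"
    by (auto simp: interval_hom_def bot top) (auto simp: Field_def)
  have "sdstar_map k I I (\<lambda>x\<in>Field I. x) = (\<lambda>X\<in>C // sdstar_rel k I. X)"
  proof (rule extensionalityI)
    fix X assume X: "X \<in> C // sdstar_rel k I"
    then show "sdstar_map k I I (\<lambda>x\<in>Field I. x) X = (\<lambda>X\<in>C // sdstar_rel k I. X) X"
      by (elim quotient_cases) (simp add: sdstar_map_class[OF k I I id] sd_class_in)
  qed (auto simp: sdstar_map_def)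
  then show "Fm (Sdstar k) I I (Ident intervals I) = Ident intervals (Fo (Sdstar k) I)"
    by (simp add: Sdstar_def intervals_def Field_sdstar)
next
  fix I J :: "'a rel" and h
  assume "I \<in> Obj intervals" "J \<in> Obj intervals" "h \<in> Hom intervals I J"
  then show "Fm (Sdstar k) I J h \<in> Hom intervals (Fo (Sdstar k) I) (Fo (Sdstar k) J)"
    using sdstar_map_Hom[OF k] by (simp add: intervals_def Sdstar_def)
next
  fix I J K :: "'a rel" and f g
  assume "I \<in> Obj intervals" "J \<in> Obj intervals" "K \<in> Obj intervals"
    "f \<in> Hom intervals I J" "g \<in> Hom intervals J K"
  then have I: "interval I" and J: "interval J" and K: "interval K"
    and f: "f \<in> interval_hom I J" and g: "g \<in> interval_hom J K" by (simp_all add: intervals_def)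
  interpret subdivided_interval k I using k I by unfold_locales
  have fF: "f x \<in> Field J" if "x \<in> Field I" for x using f that by (auto simp: interval_hom_def)
  have "sdstar_map k I K (compose (Field I) g f) =
    compose (Field (sdstar k I)) (sdstar_map k J K g) (sdstar_map k I J f)"
  proof (rule extensionalityI[of _ "Field (sdstar k I)"])
    fix X assume X: "X \<in> Field (sdstar k I)"
    then obtain j x where jx: "j < k" "x \<in> Field I" "X = sd_class k I (j, x)" by (rule sdstar_cases)
    then show "sdstar_map k I K (compose (Field I) g f) X =
        compose (Field (sdstar k I)) (sdstar_map k J K g) (sdstar_map k I J f) X"
      using X fF[OF jx(2)]
      by (simp add: compose_eq sdstar_map_class[OF k I K interval_hom_compose[OF f g I]]
        sdstar_map_class[OF k I J f] sdstar_map_class[OF k J K g])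
  qed (auto simp: sdstar_map_def Field_sdstar)
  then show "Fm (Sdstar k) I K (Comp intervals I J K g f) =
      Comp intervals (Fo (Sdstar k) I) (Fo (Sdstar k) J) (Fo (Sdstar k) K)
        (Fm (Sdstar k) J K g) (Fm (Sdstar k) I J f)"
    by (simp add: Sdstar_def intervals_def)
qed


section \<open>The comparison of stalks\<close>

text \<open>The map from \<open>(Sd\<^sub>k [n])\<^sup>*\<close> to the subdivision of \<open>I\<close> that sends \<open>j (n + 1) + x\<close> to the class
  of \<open>(j, \<phi> x)\<close>, also for \<open>x = n + 1\<close>.\<close>

definition sd_hom :: "nat \<Rightarrow> 'a rel \<Rightarrow> nat \<Rightarrow> (nat \<Rightarrow> 'a) \<Rightarrow> nat \<Rightarrow> (nat \<times> 'a) set" where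
  "sd_hom k I n \<phi> = (\<lambda>i\<in>{..k * (n + 1)}.
     if i = k * (n + 1) then sd_class k I (k - 1, \<phi> (n + 1))
     else sd_class k I (i div (n + 1), \<phi> (i mod (n + 1))))"

context subdivided_interval begin

text \<open>Inside a block this is division with remainder by \<open>n + 1\<close>. At a joint,
  \<open>x = n + 1\<close> in block \<open>j\<close>, the division selects position \<open>0\<close>
  of block \<open>j + 1\<close>, and the two pairs are glued. At the very end it would select a
  block \<open>k\<close> that does not exist, which is why \<open>sd_hom\<close> treats
  \<open>i = k * (n + 1)\<close> separately.\<close>

lemma sd_hom_index:
  assumes \<phi>: "\<phi> \<in> interval_hom (star n) I" and j: "j < k" and x: "x \<le> n + 1"
  shows "sd_hom k I n \<phi> (j * (n + 1) + x) = sd_class k I (j, \<phi> x)"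
proof -
  have small: "sd_hom k I n \<phi> (j * (n + 1) + x) = sd_class k I (j, \<phi> x)" if "j < k" "x \<le> n" for j x
  proof -
    have "j * (n + 1) + (x + 1) \<le> k * (n + 1)" using that by (intro sd_index_le) auto
    moreover have "(j * (n + 1) + x) div (n + 1) = j"
      using that(2) div_mult_self3[of "n + 1" j x] by simp
    moreover have "(j * (n + 1) + x) mod (n + 1) = x"
      using that(2) mod_mult_self3[of j "n + 1" x] by simp
    ultimately show ?thesis unfolding sd_hom_def by (simp only: restrict_apply) simp
  qed
  consider "x \<le> n" | "x = n + 1" "j + 1 < k" | "x = n + 1" "j = k - 1" using j x by linarith
  then show ?thesis
  proof cases
    case 1
    then show ?thesis by (rule small[OF j])
  next
    case 2
    have "sd_hom k I n \<phi> ((j + 1) * (n + 1) + 0) = sd_class k I (j + 1, \<phi> 0)"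
      by (rule small) (use 2 in auto)
    moreover have "(j + 1) * (n + 1) + 0 = j * (n + 1) + x" using 2(1) by simp
    ultimately have "sd_hom k I n \<phi> (j * (n + 1) + x) = sd_class k I (j + 1, ibot I)"
      using \<phi> by (simp only: interval_hom_star_iff)
    also have "\<dots> = sd_class k I (j, \<phi> x)"
      using sd_class_glue[OF 2(2)] \<phi> 2(1) by (simp only: interval_hom_star_iff)
    finally show ?thesis .
  next
    case 3
    have "j * (n + 1) + x = (j + 1) * (n + 1)" using 3(1) by simp
    also have "j + 1 = k" using 3(2) j by simp
    finally have "j * (n + 1) + x = k * (n + 1)" .
    then show ?thesis using 3 by (simp only:) (simp add: sd_hom_def)
  qed
qed

lemma sd_index_cases_top:
  assumes "i \<le> k * (n + 1)"
  obtains j x where "j < k" "x \<le> n" "i = j * (n + 1) + x" | "i = (k - 1) * (n + 1) + (n + 1)"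
proof (cases "i = k * (n + 1)")
  case True
  moreover have "k * (n + 1) = (k - 1) * (n + 1) + (n + 1)" using k by (cases k) auto
  ultimately show ?thesis using that(2) by simp
next
  case False
  then have "i \<le> k * (n + 1) - 1" using assms by linarith
  then show ?thesis using that(1) by (rule sd_index_cases[OF k])
qed

lemma sd_hom_in:
  assumes \<phi>: "\<phi> \<in> interval_hom (star n) I"
  shows "sd_hom k I n \<phi> \<in> interval_hom (star (k * (n + 1) - 1)) (sdstar k I)"
  unfolding interval_hom_star_iff Sd_Fo_Suc[OF k]
proof (intro conjI allI impI)
  have \<phi>F: "\<phi> x \<in> Field I" if "x \<le> n + 1" for x using \<phi> that by (auto simp: interval_hom_star_iff)
  have \<phi>mono: "(\<phi> x, \<phi> y) \<in> I" if "x \<le> y" "y \<le> n + 1" for x y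
    using \<phi> that by (simp add: interval_hom_star_iff)
  have \<phi>0: "\<phi> 0 = ibot I" and \<phi>1: "\<phi> (n + 1) = itop I" using \<phi> by (simp_all add: interval_hom_star_iff)
  note index = sd_hom_index[OF \<phi>]
  have k1: "k - 1 < k" using k by simp
  have top_index: "sd_hom k I n \<phi> ((k - 1) * (n + 1) + (n + 1)) = sd_class k I (k - 1, itop I)"
    using index[OF k1, of "n + 1"] \<phi>1 by (simp only: order_refl)
  have F: "sd_hom k I n \<phi> i \<in> Field (sdstar k I)" if "i \<le> k * (n + 1)" for i
    using that
  proof (cases rule: sd_index_cases_top)
    case (1 j x)
    then show ?thesis
      by (simp only: index Field_sdstar) (simp add: sd_class_in \<phi>F)
  next
    case 2
    then show ?thesis using sdstar_top by (simp only: top_index is_top_def)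
  qed
  then show "sd_hom k I n \<phi> \<in> {..k * (n + 1)} \<rightarrow>\<^sub>E Field (sdstar k I)"
    by (auto simp: PiE_iff) (simp add: sd_hom_def)
  have "sd_hom k I n \<phi> (0 * (n + 1) + 0) = sd_class k I (0, \<phi> 0)" by (rule index) (use k in auto)
  then show "sd_hom k I n \<phi> 0 = ibot (sdstar k I)" by (simp add: ibot_sdstar \<phi>0)
  have "k * (n + 1) = (k - 1) * (n + 1) + (n + 1)" using k by (cases k) auto
  then show "sd_hom k I n \<phi> (k * (n + 1)) = itop (sdstar k I)" by (simp only: itop_sdstar top_index)
  fix i i' assume le: "i \<le> i'" and i': "i' \<le> k * (n + 1)"
  then have i: "i \<le> k * (n + 1)" by simp
  show "(sd_hom k I n \<phi> i, sd_hom k I n \<phi> i') \<in> sdstar k I"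
    using i'
  proof (cases rule: sd_index_cases_top)
    case 2
    then show ?thesis using sdstar_top F[OF i] by (simp only: top_index is_top_def)
  next
    case (1 j' x')
    have "j' * (n + 1) + (x' + 1) \<le> k * (n + 1)" using 1 by (intro sd_index_le) auto
    then have "i \<le> k * (n + 1) - 1" using le 1(3) by linarith
    then obtain j x where ij: "j < k" "x \<le> n" "i = j * (n + 1) + x" by (rule sd_index_cases[OF k])
    have "j < j' \<or> j = j' \<and> x \<le> x'"
      using le sd_index_le_iff[OF ij(2) 1(2)] unfolding ij(3) 1(3) by blast
    then have "j < j' \<or> j = j' \<and> (\<phi> x, \<phi> x') \<in> I" using \<phi>mono 1(2) by auto
    moreover have xx': "x \<le> n + 1" "x' \<le> n + 1" using ij(2) 1(2) by simp_all
    ultimately show ?thesis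
      unfolding ij(3) 1(3) index[OF ij(1) xx'(1)] index[OF 1(1) xx'(2)]
      by (intro sdstar_lexI ij(1) 1(1) \<phi>F)
  qed
qed

text \<open>Coordinates can be chosen with \<open>x = n + 1\<close> only in the last block. As
  \<open>\<phi>\<close> is injective, \<open>\<phi> x = itop I\<close> happens for
  \<open>x = n + 1\<close> alone, so each value is the class of a pair that is its own normal form,
  and equal classes have equal pairs.\<close>

lemma sd_hom_inj:
  assumes \<phi>: "\<phi> \<in> interval_hom (star n) I" and inj: "inj_on \<phi> {..n + 1}"
  shows "inj_on (sd_hom k I n \<phi>) {..k * (n + 1)}"
proof (rule inj_onI)
  have \<phi>F: "\<phi> x \<in> Field I" if "x \<le> n + 1" for x using \<phi> that by (auto simp: interval_hom_star_iff)
  have \<phi>1: "\<phi> (n + 1) = itop I" using \<phi> by (simp add: interval_hom_star_iff)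
  have k1: "k - 1 < k" using k by simp
  have v: "\<exists>j x. j < k \<and> x \<le> n + 1 \<and> (x = n + 1 \<longrightarrow> j = k - 1) \<and> i = j * (n + 1) + x" if "i \<le> k * (n + 1)" for i
    using that
  proof (cases rule: sd_index_cases_top)
    case (1 j x)
    then show ?thesis by (intro exI[of _ j] exI[of _ x]) auto
  next
    case 2
    then show ?thesis using k1 by blast
  qed
  fix i i' assume "i \<in> {..k * (n + 1)}" "i' \<in> {..k * (n + 1)}"
    and eq: "sd_hom k I n \<phi> i = sd_hom k I n \<phi> i'"
  then obtain j x j' x' where i: "j < k" "x \<le> n + 1" "x = n + 1 \<longrightarrow> j = k - 1" "i = j * (n + 1) + x"
    and i': "j' < k" "x' \<le> n + 1" "x' = n + 1 \<longrightarrow> j' = k - 1" "i' = j' * (n + 1) + x'"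
    using v[of i] v[of i'] by (simp only: atMost_iff) blast
  have normal: "sd_normal k I (j, \<phi> x) = (j, \<phi> x)"
    if "j < k" "x \<le> n + 1" "x = n + 1 \<longrightarrow> j = k - 1" for j x
  proof -
    have "\<phi> x = itop I \<longrightarrow> x = n + 1" using inj_onD[OF inj, of x "n + 1"] \<phi>1 that(2) by simp
    then show ?thesis using that by (auto simp: sd_normal_def)
  qed
  have "sd_class k I (j, \<phi> x) = sd_class k I (j', \<phi> x')"
    using eq unfolding i(4) i'(4) sd_hom_index[OF \<phi> i(1,2)] sd_hom_index[OF \<phi> i'(1,2)] .
  then have "(j, \<phi> x) = (j', \<phi> x')"
    using i i' \<phi>F by (subst (asm) sd_class_eq_iff) (auto simp: C_iff normal)
  then have "j = j'" "x = x'" using inj_onD[OF inj, of x x'] i(2) i'(2) by auto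
  then show "i = i'" by (simp only: i(4) i'(4))
qed

text \<open>The blockwise description of the dual map in \<open>star_map_Sd\<close>, read off index
  by index. It makes subdividing \<open>\<phi>\<close> compatible with the relation defining the
  tensor product.\<close>

lemma sd_hom_natural:
  assumes \<phi>: "\<phi> \<in> interval_hom (star n) I" and f: "f \<in> Hom delta n m"
  shows "sd_hom k I m (compose {..m + 1} \<phi> (star_map n m f)) =
    compose {..k * (m + 1)} (sd_hom k I n \<phi>)
      (star_map (k * (n + 1) - 1) (k * (m + 1) - 1) (Fm (Sd k) n m f))"
    (is "?l = ?r")
proof (rule extensionalityI)
  show "?l \<in> extensional {..k * (m + 1)}" by (simp add: sd_hom_def)
  show "?r \<in> extensional {..k * (m + 1)}" by simp
  fix i assume i: "i \<in> {..k * (m + 1)}"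
  then obtain j x where jx: "j < k" "x \<le> m + 1" "i = j * (m + 1) + x"
  proof -
    assume *: "\<And>j x. j < k \<Longrightarrow> x \<le> m + 1 \<Longrightarrow> i = j * (m + 1) + x \<Longrightarrow> thesis"
    have "i \<le> k * (m + 1)" using i by simp
    then show thesis
    proof (cases rule: sd_index_cases_top)
      case (1 j x)
      then show ?thesis by (intro *[of j x]) auto
    next
      case 2
      then show ?thesis by (intro *[of "k - 1" "m + 1"]) (use k in auto)
    qed
  qed
  have "?l i = sd_class k I (j, \<phi> (star_map n m f x))"
    unfolding jx(3) sd_hom_index[OF flat_functor_Fm_in[OF f \<phi>] jx(1,2)]
    using jx(2) by (simp add: compose_def)
  also have "\<dots> = sd_hom k I n \<phi> (j * (n + 1) + star_map n m f x)"
    by (rule sd_hom_index[OF \<phi> jx(1) star_map_le[OF f jx(2)], symmetric])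
  also have "\<dots> = ?r i"
    unfolding compose_eq[OF i] by (simp only: jx(3) star_map_Sd[OF k f jx(1,2)])
  finally show "?l i = ?r i" .
qed

text \<open>A common refinement of an element over \<open>I\<close> and an element over the subdivision of \<open>I\<close>: it is
  obtained from all the points of \<open>I\<close> that occur in either of them.\<close>

lemma sd_refine:
  assumes \<phi>: "\<phi> \<in> interval_hom (star n) I" and \<theta>: "\<theta> \<in> interval_hom (star m) (sdstar k I)"
  obtains l \<chi> f g where "\<chi> \<in> interval_hom (star l) I"
    "f \<in> Hom delta l n" "\<phi> = compose {..n + 1} \<chi> (star_map l n f)"
    "free_element (flat_functor (sdstar k I)) (k * (l + 1) - 1) (sd_hom k I l \<chi>)"
    "g \<in> Hom delta (k * (l + 1) - 1) m"
    "\<theta> = compose {..m + 1} (sd_hom k I l \<chi>) (star_map (k * (l + 1) - 1) m g)"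
proof -
  have "\<exists>p. p \<in> {..<k} \<times> Field I \<and> \<theta> i = sd_class k I p" if "i \<le> m + 1" for i
  proof -
    have "\<theta> i \<in> Field (sdstar k I)" using \<theta> that by (auto simp: interval_hom_star_iff)
    then show ?thesis by (elim sdstar_cases) auto
  qed
  then obtain r where r: "\<And>i. i \<le> m + 1 \<Longrightarrow> r i \<in> {..<k} \<times> Field I \<and> \<theta> i = sd_class k I (r i)"
    by metis
  \<comment> \<open>A class in the subdivision contributes one point of \<open>I\<close>, the second
    component of a chosen representative; the first component only selects the copy.\<close>
  have "finite (\<phi> ` {..n + 1} \<union> (\<lambda>i. snd (r i)) ` {..m + 1})" by simp
  moreover have "\<phi> ` {..n + 1} \<union> (\<lambda>i. snd (r i)) ` {..m + 1} \<subseteq> Field I"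
  proof -
    have "snd (r i) \<in> Field I" if "i \<le> m + 1" for i using r[OF that] by auto
    then show ?thesis using interval_hom_image[OF \<phi>] by auto
  qed
  ultimately obtain l \<chi> where \<chi>: "\<chi> \<in> interval_hom (star l) I" "inj_on \<chi> {..l + 1}"
    and sub: "\<phi> ` {..n + 1} \<union> (\<lambda>i. snd (r i)) ` {..m + 1} \<subseteq> \<chi> ` {..l + 1}"
    by (rule interval_finite_enumeration[OF I])
  obtain f where f: "f \<in> Hom delta l n" "\<phi> = compose {..n + 1} \<chi> (star_map l n f)"
    using interval_hom_factor[OF lin \<chi> \<phi>] sub by blast
  have inj: "inj_on (sd_hom k I l \<chi>) {..k * (l + 1) - 1 + 1}"
    unfolding Sd_Fo_Suc[OF k] by (rule sd_hom_inj[OF \<chi>])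
  \<comment> \<open>If \<open>\<theta> i\<close> is represented in copy \<open>j\<close> by the
    point \<open>\<chi> x\<close>, it is the value of \<open>sd_hom k I l \<chi>\<close> at
    \<open>j * (l + 1) + x\<close>.\<close>
  have "\<theta> ` {..m + 1} \<subseteq> sd_hom k I l \<chi> ` {..k * (l + 1) - 1 + 1}"
    unfolding Sd_Fo_Suc[OF k]
  proof (rule image_subsetI)
    fix i assume "i \<in> {..m + 1}"
    then have i: "i \<le> m + 1" by simp
    then have "snd (r i) \<in> \<chi> ` {..l + 1}" using sub by blast
    then obtain x where x: "x \<le> l + 1" "snd (r i) = \<chi> x" by auto
    have "fst (r i) < k" and "\<theta> i = sd_class k I (fst (r i), snd (r i))" using r[OF i] by auto
    then have "\<theta> i = sd_hom k I l \<chi> (fst (r i) * (l + 1) + x)"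
      by (simp only: sd_hom_index[OF \<chi>(1) _ x(1)] x(2))
    then show "\<theta> i \<in> sd_hom k I l \<chi> ` {..k * (l + 1)}"
      using sd_index_le[OF \<open>fst (r i) < k\<close> x(1)] by blast
  qed
  then obtain g where g: "g \<in> Hom delta (k * (l + 1) - 1) m"
    "\<theta> = compose {..m + 1} (sd_hom k I l \<chi>) (star_map (k * (l + 1) - 1) m g)"
    using interval_hom_factor[OF Linear_order_sdstar sd_hom_in[OF \<chi>(1)] inj \<theta>] by blast
  show ?thesis
    by (rule that[OF \<chi>(1) f free_element_flat_functor[OF sd_hom_in[OF \<chi>(1)] inj] g])
qed

end

text \<open>The section \<open>y\<close> does not change: an element of
  \<open>Y \<circ> Sd k\<close> at level \<open>n\<close> is an element of \<open>Y\<close> at level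
  \<open>k * (n + 1) - 1\<close>. The level is renamed and \<open>\<phi>\<close> is
  subdivided.\<close>

definition sd_stalk_map :: "nat \<Rightarrow> 'a rel \<Rightarrow> 'u presheaf \<Rightarrow> ('u, 'a) stalk \<Rightarrow> ('u, (nat \<times> 'a) set) stalk" where
  "sd_stalk_map k I Y A = tensor_rel Y (flat_functor (sdstar k I)) ``
     ((\<lambda>(n, y, \<phi>). (k * (n + 1) - 1, y, sd_hom k I n \<phi>)) ` A)"

lemma sd_inverse_image_Obj:
  assumes "1 \<le> k" "Y \<in> Obj presheaves"
  shows "Fo (sd_inverse_image k) Y \<in> Obj presheaves"
  using is_functor_sd_inverse_image[OF assms(1)] assms(2) unfolding is_functor_def by blast

lemma sd_inverse_image_Hom:
  assumes "1 \<le> k" "Y \<in> Obj presheaves" "Z \<in> Obj presheaves" "\<eta> \<in> Hom presheaves Y Z"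
  shows "Fm (sd_inverse_image k) Y Z \<eta> \<in>
    Hom presheaves (Fo (sd_inverse_image k) Y) (Fo (sd_inverse_image k) Z)"
  using is_functor_sd_inverse_image[OF assms(1)] assms(2-) unfolding is_functor_def by blast

context subdivided_interval begin

context
  fixes Y :: "'u presheaf"
  assumes Y: "Y \<in> Obj presheaves"
begin

abbreviation "SY \<equiv> Fo (sd_inverse_image k) Y"

abbreviation "SI \<equiv> sdstar k I"

lemmas SY = sd_inverse_image_Obj[OF k Y]

lemma sd_stalk_map_germ:
  assumes y: "y \<in> Fo Y (k * (n + 1) - 1)" and \<phi>: "\<phi> \<in> interval_hom (star n) I"
  shows "sd_stalk_map k I Y (germ SY (flat_functor I) n y \<phi>) =
    germ Y (flat_functor SI) (k * (n + 1) - 1) y (sd_hom k I n \<phi>)"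
  unfolding sd_stalk_map_def
proof (rule germ_Image_map[OF SY is_functor_flat_functor])
  show "y \<in> Fo SY n" "\<phi> \<in> Fo (flat_functor I) n"
    using y \<phi> by (simp_all add: sd_inverse_image_simps flat_functor_Fo)
next
  fix n y \<phi> assume "y \<in> Fo SY n" "\<phi> \<in> Fo (flat_functor I) n"
  then show "sd_hom k I n \<phi> \<in> Fo (flat_functor SI) (k * (n + 1) - 1) \<and> y \<in> Fo Y (k * (n + 1) - 1)"
    by (simp only: sd_inverse_image_simps flat_functor_Fo sd_hom_in)
next
  fix n m f y \<phi>
  assume f: "f \<in> Hom delta n m" and "y \<in> Fo SY m" and "\<phi> \<in> Fo (flat_functor I) n"
  then have y: "y \<in> Fo Y (k * (m + 1) - 1)" and \<phi>: "\<phi> \<in> interval_hom (star n) I"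
    by (simp_all only: sd_inverse_image_simps flat_functor_Fo)
  have "sd_hom k I m (Fm (flat_functor I) n m f \<phi>) = Fm (flat_functor SI) (k * (n + 1) - 1)
      (k * (m + 1) - 1) (Fm (Sd k) n m f) (sd_hom k I n \<phi>)"
    by (simp only: flat_functor_Fm[OF \<phi>] flat_functor_Fm[OF sd_hom_in[OF \<phi>]] sd_hom_natural[OF \<phi> f]
        Sd_Fo_Suc[OF k])
  then show "germ Y (flat_functor SI) (k * (n + 1) - 1) (Fm SY m n f y) (sd_hom k I n \<phi>) =
      germ Y (flat_functor SI) (k * (m + 1) - 1) y (sd_hom k I m (Fm (flat_functor I) n m f \<phi>))"
    using germ_transport[OF Y is_functor_flat_functor Sd_Fm_Hom[OF k f] y, of "sd_hom k I n \<phi>" SI]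
      sd_hom_in[OF \<phi>] by (simp only: sd_inverse_image_simps flat_functor_Fo)
qed

lemma sd_stalk_map_bij:
  "bij_betw (sd_stalk_map k I Y) (tensor SY (flat_functor I)) (tensor Y (flat_functor SI))"
  unfolding bij_betw_def
proof
  interpret FI: freely_filtered "flat_functor I" by (rule freely_filtered_flat_functor[OF I])
  interpret FS: freely_filtered "flat_functor SI"
    by (rule freely_filtered_flat_functor[OF interval_sdstar])
  show "inj_on (sd_stalk_map k I Y) (tensor SY (flat_functor I))"
  proof (rule inj_onI)
    fix A B assume A: "A \<in> tensor SY (flat_functor I)" and B: "B \<in> tensor SY (flat_functor I)"
      and eq: "sd_stalk_map k I Y A = sd_stalk_map k I Y B"
    obtain n \<phi> y z where "\<phi> \<in> Fo (flat_functor I) n" "y \<in> Fo SY n" "z \<in> Fo SY n"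
      and AB: "A = germ SY (flat_functor I) n y \<phi>" "B = germ SY (flat_functor I) n z \<phi>"
      using FI.common_germs[OF SY SY A B] .
    then have \<phi>: "\<phi> \<in> interval_hom (star n) I"
      and y: "y \<in> Fo Y (k * (n + 1) - 1)" and z: "z \<in> Fo Y (k * (n + 1) - 1)"
      by (simp_all only: sd_inverse_image_simps flat_functor_Fo)
    note \<phi>' = sd_hom_in[OF \<phi>]
    have "germ Y (flat_functor SI) (k * (n + 1) - 1) y (sd_hom k I n \<phi>) =
        germ Y (flat_functor SI) (k * (n + 1) - 1) z (sd_hom k I n \<phi>)"
      using eq unfolding AB sd_stalk_map_germ[OF y \<phi>] sd_stalk_map_germ[OF z \<phi>] .
    then obtain m \<psi> e where "\<psi> \<in> Fo (flat_functor SI) m" and e: "e \<in> Hom delta m (k * (n + 1) - 1)"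
      and e\<psi>: "Fm (flat_functor SI) m (k * (n + 1) - 1) e \<psi> = sd_hom k I n \<phi>"
      and yz: "Fm Y (k * (n + 1) - 1) m e y = Fm Y (k * (n + 1) - 1) m e z"
      by (rule FS.germ_eqD[OF Y y z \<phi>'[folded flat_functor_Fo]])
    then have \<psi>: "\<psi> \<in> interval_hom (star m) SI" by (simp only: flat_functor_Fo)
    \<comment> \<open>The arrow \<open>e\<close> need not be in the image of \<open>Sd k\<close>.
      Refining \<open>\<phi>\<close> and \<open>\<psi>\<close> together puts a subdivided element
      \<open>sd_hom k I l \<chi>\<close> above \<open>\<psi>\<close>.\<close>
    obtain l \<chi> f g where \<chi>: "\<chi> \<in> interval_hom (star l) I"
      and f: "f \<in> Hom delta l n" "\<phi> = compose {..n + 1} \<chi> (star_map l n f)"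
      and free: "free_element (flat_functor SI) (k * (l + 1) - 1) (sd_hom k I l \<chi>)"
      and g: "g \<in> Hom delta (k * (l + 1) - 1) m"
        "\<psi> = compose {..m + 1} (sd_hom k I l \<chi>) (star_map (k * (l + 1) - 1) m g)"
      by (rule sd_refine[OF \<phi> \<psi>])
    note \<chi>' = sd_hom_in[OF \<chi>]
    let ?c = "Comp delta (k * (l + 1) - 1) m (k * (n + 1) - 1) e g"
    have "Fm (flat_functor SI) (k * (l + 1) - 1) m g (sd_hom k I l \<chi>) = \<psi>"
      by (simp only: flat_functor_Fm[OF \<chi>'] g(2))
    \<comment> \<open>The composite of \<open>g\<close> and \<open>e\<close>, and
      \<open>Sd k\<close> of \<open>f\<close>, both carry the free element
      \<open>sd_hom k I l \<chi>\<close> to \<open>sd_hom k I n \<phi>\<close>, so they are the same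
      arrow.\<close>
    then have "Fm (flat_functor SI) (k * (l + 1) - 1) (k * (n + 1) - 1) ?c (sd_hom k I l \<chi>) = sd_hom k I n \<phi>"
      by (simp only: covariant_Comp[OF is_functor_flat_functor g(1) e \<chi>'[folded flat_functor_Fo]] e\<psi>)
    also have "\<dots> = Fm (flat_functor SI) (k * (l + 1) - 1) (k * (n + 1) - 1) (Fm (Sd k) l n f) (sd_hom k I l \<chi>)"
      by (simp only: flat_functor_Fm[OF \<chi>'] f(2) sd_hom_natural[OF \<chi> f(1)] Sd_Fo_Suc[OF k])
    finally have c: "?c = Fm (Sd k) l n f"
      using free Comp_delta_Hom[OF g(1) e] Sd_Fm_Hom[OF k f(1)] unfolding free_element_def by blast
    \<comment> \<open>Restriction along \<open>f\<close> in \<open>SY\<close> is restriction along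
      \<open>Sd k\<close> of \<open>f\<close> in \<open>Y\<close>, hence factors through
      \<open>e\<close>, where \<open>y\<close> and \<open>z\<close> already agree.\<close>
    have "Fm SY n l f y = Fm SY n l f z"
      using presheaf_Comp[OF Y g(1) e y] presheaf_Comp[OF Y g(1) e z]
      by (simp only: sd_inverse_image_simps c yz)
    moreover have "germ SY (flat_functor I) l (Fm SY n l f x) \<chi> = germ SY (flat_functor I) n x \<phi>"
      if "x \<in> Fo SY n" for x
      using germ_transport[OF SY is_functor_flat_functor f(1) that \<chi>[folded flat_functor_Fo]]
      by (simp only: flat_functor_Fm[OF \<chi>] f(2))
    ultimately show "A = B"
      using y z AB unfolding sd_inverse_image_simps by metis
  qed
  show "sd_stalk_map k I Y ` tensor SY (flat_functor I) = tensor Y (flat_functor SI)"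
  proof (intro equalityI subsetI)
    fix B assume "B \<in> sd_stalk_map k I Y ` tensor SY (flat_functor I)"
    then obtain A where A: "A \<in> tensor SY (flat_functor I)" "B = sd_stalk_map k I Y A" by blast
    obtain n y \<phi> where "y \<in> Fo SY n" "\<phi> \<in> Fo (flat_functor I) n" "A = germ SY (flat_functor I) n y \<phi>"
      using A(1) by (rule tensor_cases)
    then show "B \<in> tensor Y (flat_functor SI)"
      unfolding A(2) sd_inverse_image_simps flat_functor_Fo
      using germ_in_tensor[OF _ sd_hom_in[folded flat_functor_Fo]]
      by (simp only: sd_stalk_map_germ flat_functor_Fo)
  next
    fix B assume "B \<in> tensor Y (flat_functor SI)"
    then obtain m y \<theta> where y: "y \<in> Fo Y m" and "\<theta> \<in> Fo (flat_functor SI) m"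
      and B: "B = germ Y (flat_functor SI) m y \<theta>" by (rule tensor_cases)
    then have \<theta>: "\<theta> \<in> interval_hom (star m) SI" by (simp only: flat_functor_Fo)
    \<comment> \<open>Surjectivity prescribes no element over \<open>I\<close>, so
      \<open>sd_refine\<close> is given an arbitrary one; its part about \<open>\<theta>\<close>
      does the work.\<close>
    obtain n \<phi> where \<phi>: "\<phi> \<in> interval_hom (star n) I"
      using FI.nonempty by (auto simp: flat_functor_Fo)
    obtain l \<chi> f g where \<chi>: "\<chi> \<in> interval_hom (star l) I"
      and "f \<in> Hom delta l n" "\<phi> = compose {..n + 1} \<chi> (star_map l n f)"
      and "free_element (flat_functor SI) (k * (l + 1) - 1) (sd_hom k I l \<chi>)"
      and g: "g \<in> Hom delta (k * (l + 1) - 1) m"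
        "\<theta> = compose {..m + 1} (sd_hom k I l \<chi>) (star_map (k * (l + 1) - 1) m g)"
      by (rule sd_refine[OF \<phi> \<theta>])
    note gy = presheaf_Fm_in[OF Y g(1) y]
    \<comment> \<open>Once \<open>g\<close> is moved to the section, the representative sits over a
      subdivided element and is visibly in the image.\<close>
    have "B = germ Y (flat_functor SI) (k * (l + 1) - 1) (Fm Y m (k * (l + 1) - 1) g y) (sd_hom k I l \<chi>)"
      using germ_transport[OF Y is_functor_flat_functor g(1) y sd_hom_in[OF \<chi>, folded flat_functor_Fo]]
      by (simp only: B flat_functor_Fm[OF sd_hom_in[OF \<chi>]] g(2))
    also have "\<dots> = sd_stalk_map k I Y (germ SY (flat_functor I) l (Fm Y m (k * (l + 1) - 1) g y) \<chi>)"
      by (rule sd_stalk_map_germ[OF gy \<chi>, symmetric])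
    finally show "B \<in> sd_stalk_map k I Y ` tensor SY (flat_functor I)"
      using gy \<chi> by (simp only: image_eqI germ_in_tensor sd_inverse_image_simps flat_functor_Fo)
  qed
qed

end

end

theorem theoremA3:
  fixes k :: nat
  assumes "k \<ge> 1"
  shows
    "is_functor intervals intervals
       (Sdstar k :: ('a rel, 'a \<Rightarrow> 'a, (nat \<times> 'a) set rel, (nat \<times> 'a) set \<Rightarrow> (nat \<times> 'a) set) cat_functor)
     \<and> is_functor intervals points
         (interval_point :: ('a rel, 'a \<Rightarrow> 'a,
            ('u, ('u, 'a) stalk) topos_functor, ('u, ('u, 'a) stalk) topos_trans) cat_functor)
     \<and> is_functor points points
         (sd_on_points k :: (('u, 'v) topos_functor, ('u, 'v) topos_trans,
            ('u, 'v) topos_functor, ('u, 'v) topos_trans) cat_functor)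
     \<and> (\<exists>\<Phi>. set_valued_nat_iso
              (intervals :: ('a rel, 'a \<Rightarrow> 'a) category)
              (presheaves :: ('u presheaf, nat \<Rightarrow> 'u \<Rightarrow> 'u) category)
              (functor_comp (sd_on_points k) interval_point)
              (functor_comp interval_point (Sdstar k)) \<Phi>)"
proof (intro conjI exI)
  note k = assms
  show "is_functor intervals intervals (Sdstar k ::
      ('a rel, 'a \<Rightarrow> 'a, (nat \<times> 'a) set rel, (nat \<times> 'a) set \<Rightarrow> (nat \<times> 'a) set) cat_functor)"
    by (rule is_functor_Sdstar[OF k])
  show "is_functor intervals points (interval_point :: ('a rel, 'a \<Rightarrow> 'a,
      ('u, ('u, 'a) stalk) topos_functor, ('u, ('u, 'a) stalk) topos_trans) cat_functor)"
    by (rule is_functor_interval_point)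
  show "is_functor points points (sd_on_points k :: (('u, 'v) topos_functor, ('u, 'v) topos_trans,
      ('u, 'v) topos_functor, ('u, 'v) topos_trans) cat_functor)"
    by (rule is_functor_sd_on_points[OF k])
  let ?S = "sd_inverse_image k :: ('u presheaf, nat \<Rightarrow> 'u \<Rightarrow> 'u, 'u presheaf, nat \<Rightarrow> 'u \<Rightarrow> 'u) cat_functor"
  let ?T = "functor_comp (sd_on_points k) interval_point ::
    ('a rel, 'a \<Rightarrow> 'a, ('u, ('u, 'a) stalk) topos_functor, ('u, ('u, 'a) stalk) topos_trans) cat_functor"
  let ?T' = "functor_comp interval_point (Sdstar k) ::
    ('a rel, 'a \<Rightarrow> 'a, ('u, ('u, (nat \<times> 'a) set) stalk) topos_functor,
      ('u, ('u, (nat \<times> 'a) set) stalk) topos_trans) cat_functor"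
  have T: "Fo (Fo ?T I) Y = tensor (Fo ?S Y) (flat_functor I)"
    "Fm (Fo ?T I) Y Z \<eta> = tensor_map (Fo ?S Y) (flat_functor I) (Fo ?S Z) (flat_functor I)
      (Fm ?S Y Z \<eta>) (\<lambda>n \<phi>. \<phi>)" for I Y Z \<eta>
    by (simp_all add: functor_comp_def sd_on_points_def precomp_def interval_point_def point_of_eq
        tensor_functor_simps)
  have T': "Fo (Fo ?T' I) Y = tensor Y (flat_functor (sdstar k I))"
    "Fm (Fo ?T' I) Y Z \<eta> = tensor_map Y (flat_functor (sdstar k I)) Z (flat_functor (sdstar k I))
      \<eta> (\<lambda>n \<phi>. \<phi>)" for I Y Z \<eta>
    by (simp_all add: functor_comp_def Sdstar_def interval_point_def point_of_eq tensor_functor_simps)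
  have TT': "Fm ?T I J h Y = tensor_map (Fo ?S Y) (flat_functor I) (Fo ?S Y) (flat_functor J)
      (\<lambda>n y. y) (\<lambda>n \<phi>. compose (Field (star n)) h \<phi>)"
    "Fm ?T' I J h Y = tensor_map Y (flat_functor (sdstar k I)) Y (flat_functor (sdstar k J))
      (\<lambda>n y. y) (\<lambda>n \<phi>. compose (Field (star n)) (sdstar_map k I J h) \<phi>)"
    if "Y \<in> Obj presheaves" for I J h Y
    using that sd_inverse_image_Obj[OF k that]
    by (simp_all add: functor_comp_def sd_on_points_def precomp_def interval_point_def Sdstar_def)
  show "set_valued_nat_iso intervals presheaves ?T ?T' (sd_stalk_map k)"
    unfolding set_valued_nat_iso_def T T'
  proof (intro conjI ballI)
    fix I :: "'a rel" and Y :: "'u presheaf" assume "I \<in> Obj intervals" and Y: "Y \<in> Obj presheaves"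
    then interpret subdivided_interval k I using k by unfold_locales (simp_all add: intervals_def)
    show "bij_betw (sd_stalk_map k I Y) (tensor (Fo ?S Y) (flat_functor I))
        (tensor Y (flat_functor (sdstar k I)))"
      by (rule sd_stalk_map_bij[OF Y])
  next
    fix I :: "'a rel" and Y Z :: "'u presheaf" and \<eta> A
    assume "I \<in> Obj intervals" and Y: "Y \<in> Obj presheaves" and Z: "Z \<in> Obj presheaves"
      and \<eta>: "\<eta> \<in> Hom presheaves Y Z" and A: "A \<in> tensor (Fo ?S Y) (flat_functor I)"
    then interpret subdivided_interval k I using k by unfold_locales (simp_all add: intervals_def)
    obtain n y \<phi> where y: "y \<in> Fo (Fo ?S Y) n" and \<phi>: "\<phi> \<in> Fo (flat_functor I) n"
      and Aeq: "A = germ (Fo ?S Y) (flat_functor I) n y \<phi>" using A by (rule tensor_cases)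
    have y': "y \<in> Fo Y (k * (n + 1) - 1)" and \<phi>': "\<phi> \<in> interval_hom (star n) I"
      using y \<phi> by (simp_all only: sd_inverse_image_simps flat_functor_Fo)
    \<comment> \<open>On germs \<open>\<eta>\<close> acts on the section only, and its component on
      \<open>Y \<circ> Sd k\<close> at level \<open>n\<close> is the component of
      \<open>\<eta>\<close> at level \<open>k * (n + 1) - 1\<close>.\<close>
    show "sd_stalk_map k I Z (tensor_map (Fo ?S Y) (flat_functor I) (Fo ?S Z) (flat_functor I)
          (Fm ?S Y Z \<eta>) (\<lambda>n \<phi>. \<phi>) A) =
        tensor_map Y (flat_functor (sdstar k I)) Z (flat_functor (sdstar k I)) \<eta> (\<lambda>n \<phi>. \<phi>)
          (sd_stalk_map k I Y A)"
      unfolding Aeq sd_stalk_map_germ[OF Y y' \<phi>']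
        tensor_functor_germ[OF is_functor_flat_functor sd_inverse_image_Obj[OF k Y]
          sd_inverse_image_Obj[OF k Z] sd_inverse_image_Hom[OF k Y Z \<eta>] y \<phi>]
        tensor_functor_germ[OF is_functor_flat_functor Y Z \<eta> y' sd_hom_in[OF \<phi>', folded flat_functor_Fo]]
        sd_inverse_image_simps
      by (rule sd_stalk_map_germ[OF Z presheaf_Hom_in[OF \<eta> y'] \<phi>'])
  next
    fix I J :: "'a rel" and h and Y :: "'u presheaf" and A
    assume "I \<in> Obj intervals" "J \<in> Obj intervals" "h \<in> Hom intervals I J"
      and Y: "Y \<in> Obj presheaves" and A: "A \<in> tensor (Fo ?S Y) (flat_functor I)"
    then have I: "interval I" and J: "interval J" and h: "h \<in> interval_hom I J"
      by (simp_all add: intervals_def)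
    interpret SI: subdivided_interval k I using k I by unfold_locales
    interpret SJ: subdivided_interval k J using k J by unfold_locales
    obtain n y \<phi> where y: "y \<in> Fo (Fo ?S Y) n" and "\<phi> \<in> Fo (flat_functor I) n"
      and Aeq: "A = germ (Fo ?S Y) (flat_functor I) n y \<phi>" using A by (rule tensor_cases)
    then have \<phi>: "\<phi> \<in> interval_hom (star n) I" and y': "y \<in> Fo Y (k * (n + 1) - 1)"
      by (simp_all only: sd_inverse_image_simps flat_functor_Fo)
    have h\<phi>: "compose {..n + 1} h \<phi> \<in> interval_hom (star n) J"
      using interval_hom_compose[OF \<phi> h interval_star] by (simp only: Field_star)
    \<comment> \<open>Naturality in the interval comes down to this: both sides send
      \<open>j * (n + 1) + x\<close> to the class of \<open>(j, h (\<phi> x))\<close>. The position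
      \<open>x = n + 1\<close> serves the top index.\<close>
    have "sd_hom k J n (compose {..n + 1} h \<phi>) =
        compose {..k * (n + 1)} (sdstar_map k I J h) (sd_hom k I n \<phi>)"
    proof (rule extensionalityI)
      fix i assume i: "i \<in> {..k * (n + 1)}"
      have *: "sd_hom k J n (compose {..n + 1} h \<phi>) i = sdstar_map k I J h (sd_hom k I n \<phi> i)"
        if "j < k" "x \<le> n + 1" "i = j * (n + 1) + x" for j x
      proof -
        have "\<phi> x \<in> Field I" using \<phi> that(2) by (auto simp: interval_hom_star_iff)
        then show ?thesis
          using that(2) unfolding that(3) SI.sd_hom_index[OF \<phi> that(1,2)] SJ.sd_hom_index[OF h\<phi> that(1,2)]
          by (simp add: sdstar_map_class[OF k I J h that(1)] compose_def)
      qed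
      have "i \<le> k * (n + 1)" using i by simp
      then have "sd_hom k J n (compose {..n + 1} h \<phi>) i = sdstar_map k I J h (sd_hom k I n \<phi> i)"
      proof (cases rule: SI.sd_index_cases_top)
        case (1 j x)
        then show ?thesis by (intro *[of j x]) auto
      next
        case 2
        then show ?thesis by (intro *[of "k - 1" "n + 1"]) (use k in auto)
      qed
      then show "sd_hom k J n (compose {..n + 1} h \<phi>) i =
          compose {..k * (n + 1)} (sdstar_map k I J h) (sd_hom k I n \<phi>) i"
        by (simp only: compose_eq[OF i])
    qed (simp_all add: sd_hom_def)
    then show "sd_stalk_map k J Y (Fm ?T I J h Y A) = Fm ?T' I J h Y (sd_stalk_map k I Y A)"
      unfolding TT'[OF Y] Aeq SI.sd_stalk_map_germ[OF Y y' \<phi>]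
        interval_point_germ[OF sd_inverse_image_Obj[OF k Y] h y \<phi>]
        interval_point_germ[OF Y sdstar_map_Hom[OF k I J h] y' SI.sd_hom_in[OF \<phi>]]
        SJ.sd_stalk_map_germ[OF Y y' h\<phi>] Sd_Fo_Suc[OF k]
      by (simp only:)
  qed
qed

end
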